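(* Let $q\in[1,2)$, $B\in L^2(\mathbb{R}^3,\mathbb{R}^3)\cap L^\infty(\mathbb{R}^3,\mathbb{R}^3)$ and $\rho\in X_B^*$. There exists a unique minimiser $\phi_\rho$ of $I_B$ in $X_B$. If $\rho\neq0$, then $\phi_\rho\neq0$.
   Context: $\mathcal{D}^{1,2}(\mathbb{R}^3)$ is the completion of $C_0^\infty(\mathbb{R}^3)$ with respect to $\|\phi\|:=\left(\int_{\mathbb{R}^3}|\nabla\phi|^2\,dx\right)^{1/2}$, and $C^{0,1}(\mathbb{R}^3)$ is the set of Lipschitz continuous functions. $$X_B:=\mathcal{D}^{1,2}(\mathbb{R}^3)\cap\{\phi\in C^{0,1}(\mathbb{R}^3):\ |\nabla\phi|^2+(\nabla\phi\cdot B)^2\le 1+|B|^2\ \text{a.e. in }\mathbb{R}^3\},$$ a convex subset of $\mathcal{D}^{1,2}(\mathbb{R}^3)$ equipped with the norm $\|\cdot\|$. $X_B^*$ denotes the dual of $X_B$, with duality pairing $\langle\rho,\phi\rangle$: since $X_B$ is a convex symmetric set, this is understood as the set of linear functionals $\rho$ on the linear span of $X_B$ (which equals $\mathcal{D}^{1,2}(\mathbb{R}^3)\cap C^{0,1}(\mathbb{R}^3)$) whose restriction to $X_B$ is continuous with respect to $\|\cdot\|$. $$I_B(\phi)=\frac1q\int_{\mathbb{R}^3}\Big(1-\big(1+|B|^2-|\nabla\phi|^2-(\nabla\phi\cdot B)^2\big)^{q/2}\Big)\,dx-\langle\rho,\phi\rangle,\qquad \phi\in X_B.$$ *)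

theory Defs
  imports "HOL-Analysis.Analysis"
begin

definition L2 :: "(real^3 \<Rightarrow> real^3) set" where
  "L2 = {f \<in> borel_measurable lebesgue. integrable lebesgue (\<lambda>x. (norm (f x))\<^sup>2)}"

definition Linf :: "(real^3 \<Rightarrow> real^3) set" where
  "Linf = {f \<in> borel_measurable lebesgue. \<exists>M. AE x in lebesgue. norm (f x) \<le> M}"

definition partial_deriv :: "3 \<Rightarrow> (real^3 \<Rightarrow> real) \<Rightarrow> real^3 \<Rightarrow> real" where
  "partial_deriv i f = (\<lambda>x. frechet_derivative f (at x) (axis i 1))"

definition classical_grad :: "(real^3 \<Rightarrow> real) \<Rightarrow> real^3 \<Rightarrow> real^3" where
  "classical_grad f = (\<lambda>x. \<chi> i. partial_deriv i f x)"

fun Ck :: "nat \<Rightarrow> (real^3 \<Rightarrow> real) \<Rightarrow> bool" where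
  "Ck 0 f \<longleftrightarrow> continuous_on UNIV f"
| "Ck (Suc k) f \<longleftrightarrow> (\<forall>x. f differentiable (at x)) \<and> (\<forall>i. Ck k (partial_deriv i f))"

definition test_functions :: "(real^3 \<Rightarrow> real) set" where
  "test_functions = {f. (\<forall>k. Ck k f) \<and> compact (closure {x. f x \<noteq> 0})}"

definition dirichlet_norm :: "(real^3 \<Rightarrow> real) \<Rightarrow> real" where
  "dirichlet_norm f = sqrt (\<integral>x. (norm (classical_grad f x))\<^sup>2 \<partial>lebesgue)"

text \<open>
  The completion of the test functions under the Dirichlet norm, realised as usual (by the
  Sobolev inequality) as a space of functions: a Cauchy sequence for the Dirichlet norm
  converges in \<open>L\<^sup>6\<close>, and is identified with its limit. Elements are functions, not
  classes modulo null sets; after intersecting with the Lipschitz functions this makes no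
  difference, because continuous functions that agree almost everywhere are equal.
\<close>

definition D12 :: "(real^3 \<Rightarrow> real) set" where
  "D12 = {u \<in> borel_measurable lebesgue. \<exists>f :: nat \<Rightarrow> real^3 \<Rightarrow> real.
      (\<forall>n. f n \<in> test_functions) \<and>
      (\<forall>e>0. \<exists>N. \<forall>m\<ge>N. \<forall>n\<ge>N. dirichlet_norm (\<lambda>x. f m x - f n x) < e) \<and>
      (\<lambda>n. \<integral>\<^sup>+x. ennreal (\<bar>f n x - u x\<bar> ^ 6) \<partial>lebesgue) \<longlonglongrightarrow> 0}"

definition has_weak_grad :: "(real^3 \<Rightarrow> real) \<Rightarrow> (real^3 \<Rightarrow> real^3) \<Rightarrow> bool" where
  "has_weak_grad u g \<longleftrightarrow>
     (\<forall>K. compact K \<longrightarrow> set_integrable lebesgue K u \<and> set_integrable lebesgue K g) \<and>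
     (\<forall>\<eta>\<in>test_functions.
        (\<integral>x. u x *\<^sub>R classical_grad \<eta> x \<partial>lebesgue) = - (\<integral>x. \<eta> x *\<^sub>R g x \<partial>lebesgue))"

text \<open>
  Every function in \<^const>\<open>D12\<close> has a weak gradient, and it is unique up to null sets;
  \<open>weak_grad\<close> picks a representative. It is used below only in integrals and in
  statements that hold almost everywhere.
\<close>

definition weak_grad :: "(real^3 \<Rightarrow> real) \<Rightarrow> real^3 \<Rightarrow> real^3" where
  "weak_grad u = (SOME g. has_weak_grad u g)"

definition D12_norm :: "(real^3 \<Rightarrow> real) \<Rightarrow> real" where
  "D12_norm u = sqrt (\<integral>x. (norm (weak_grad u x))\<^sup>2 \<partial>lebesgue)"

definition C01 :: "(real^3 \<Rightarrow> real) set" where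
  "C01 = {u. \<exists>L. L-lipschitz_on UNIV u}"

definition XB :: "(real^3 \<Rightarrow> real^3) \<Rightarrow> (real^3 \<Rightarrow> real) set" where
  "XB B = D12 \<inter> {u \<in> C01. AE x in lebesgue.
      (norm (weak_grad u x))\<^sup>2 + (weak_grad u x \<bullet> B x)\<^sup>2 \<le> 1 + (norm (B x))\<^sup>2}"

text \<open>The linear span, written out since functions are not an instance of \<^class>\<open>real_vector\<close>.\<close>

definition XB_span :: "(real^3 \<Rightarrow> real^3) \<Rightarrow> (real^3 \<Rightarrow> real) set" where
  "XB_span B = {(\<lambda>x. \<Sum>v\<in>S. c v * v x) | S c. finite S \<and> S \<subseteq> XB B}"

text \<open>
  A functional is a total function of which only the values on \<^term>\<open>XB_span B\<close> are meaningful;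
  accordingly, \<open>\<rho>\<close> is nonzero iff it is nonzero somewhere on the span.
\<close>

definition XB_dual :: "(real^3 \<Rightarrow> real^3) \<Rightarrow> ((real^3 \<Rightarrow> real) \<Rightarrow> real) set" where
  "XB_dual B = {\<rho>.
     (\<forall>u\<in>XB_span B. \<forall>v\<in>XB_span B. \<rho> (\<lambda>x. u x + v x) = \<rho> u + \<rho> v) \<and>
     (\<forall>c. \<forall>u\<in>XB_span B. \<rho> (\<lambda>x. c * u x) = c * \<rho> u) \<and>
     (\<forall>u\<in>XB B. \<forall>e>0. \<exists>d>0. \<forall>v\<in>XB B.
        D12_norm (\<lambda>x. v x - u x) < d \<longrightarrow> \<bar>\<rho> v - \<rho> u\<bar> < e)}"

definition XB_dual_nonzero :: "(real^3 \<Rightarrow> real^3) \<Rightarrow> ((real^3 \<Rightarrow> real) \<Rightarrow> real) \<Rightarrow> bool" where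
  "XB_dual_nonzero B \<rho> \<longleftrightarrow> (\<exists>u\<in>XB_span B. \<rho> u \<noteq> 0)"

text \<open>
  For \<open>B \<in> L\<^sup>2 \<inter> L\<^sup>\<infinity>\<close> and \<open>u\<close> in \<^term>\<open>XB B\<close> the integrand is integrable and the
  base of the power is nonnegative almost everywhere.
\<close>

definition I_B :: "real \<Rightarrow> (real^3 \<Rightarrow> real^3) \<Rightarrow> ((real^3 \<Rightarrow> real) \<Rightarrow> real) \<Rightarrow> (real^3 \<Rightarrow> real) \<Rightarrow> real" where
  "I_B q B \<rho> u =
     1 / q * (\<integral>x. 1 - (1 + (norm (B x))\<^sup>2 - (norm (weak_grad u x))\<^sup>2
                          - (weak_grad u x \<bullet> B x)\<^sup>2) powr (q / 2) \<partial>lebesgue)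
     - \<rho> u"

definition is_minimiser :: "real \<Rightarrow> (real^3 \<Rightarrow> real^3) \<Rightarrow> ((real^3 \<Rightarrow> real) \<Rightarrow> real) \<Rightarrow> (real^3 \<Rightarrow> real) \<Rightarrow> bool" where
  "is_minimiser q B \<rho> u \<longleftrightarrow> is_arg_min (I_B q B \<rho>) (\<lambda>v. v \<in> XB B) u"

end

theory Submission
  imports Defs
begin

text \<open>
  The direct method works without weak compactness, because the functional is uniformly convex: the
  map \<open>t \<mapsto> t powr (q/2)\<close> is concave with derivative bounded below on the bounded range
  of its argument, so that
  \<open>I((u+v)/2) \<le> (I(u) + I(v))/2 - \<kappa> \<parallel>u - v\<parallel>\<^sup>2\<close>. Hence minimising sequences are Cauchy
  and minimisers are unique. The constraint bounds the Lipschitz constants uniformly; together with the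
  Sobolev inequality this makes a Cauchy sequence in the constraint set converge pointwise to a Lipschitz
  function, in the Dirichlet norm, and along a subsequence with gradients converging almost everywhere.
  Fatou's lemma then gives lower semicontinuity. Finally \<open>I(tu) - I(0) \<le> t\<^sup>2 A - t \<langle>\<rho>, u\<rangle>\<close>
  shows that \<open>0\<close> minimises only if \<open>\<rho> = 0\<close>.
\<close>

section \<open>Test functions and smooth bumps\<close>

text \<open>Membership in \<open>C01\<close> carries no uniform constant, so closedness of
  \<open>XB B\<close> under limits needs a passage from an almost-everywhere bound on a weak
  gradient to a pointwise Lipschitz bound; it is obtained by testing with bumps on boxes.
  \<open>weak_grad\<close> is a choice, so computations use an explicit gradient
  (\<open>D12g\<close>) and are transferred by uniqueness of weak gradients, which rests on a
  sufficient supply of test functions. The Sobolev constant is immaterial: only the conversion of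
  small gradients into small functions matters, hence the crude triangle inequalities for powers of
  norms. The energy density may be negative; Fatou's lemma is applied after adding
  \<open>q / 2 * (norm (B x))\<^sup>2\<close>, integrable since \<open>B\<close> lies in
  \<open>L2\<close>, while the bound from \<open>Linf\<close> fixes the modulus of convexity. The
  functional \<rho> is only known to be continuous on a set that is not a cone, so its growth bound
  is affine and comes from shrinking elements, never from enlarging them.\<close>

lemma partial_deriv_eqI:
  assumes "\<And>x. (f has_derivative f' x) (at x)"
  shows "partial_deriv i f = (\<lambda>x. f' x (axis i 1))"
  unfolding partial_deriv_def using frechet_derivative_at[OF assms] by simp

text \<open>\<open>Ck\<close> recurses through \<open>frechet_derivative\<close>; this rule lets a
  derivative in closed form be supplied instead, so that closure properties go by induction on
  \<open>k\<close> with \<open>f\<close> general.\<close>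

lemma Ck_SucI:
  assumes "\<And>x. (f has_derivative f' x) (at x)" "\<And>i. Ck k (\<lambda>x. f' x (axis i 1))"
  shows "Ck (Suc k) f"
  using assms by (auto simp: partial_deriv_eqI[OF assms(1)] differentiable_def)

lemma frechet_derivative_works_at:
  "f differentiable (at x) \<Longrightarrow> (f has_derivative frechet_derivative f (at x)) (at x)"
  by (simp add: frechet_derivative_works)

lemma Ck_lincomb:
  assumes "Ck k f" "Ck k g"
  shows "Ck k (\<lambda>x. a * f x + b * g x)"
  using assms
proof (induction k arbitrary: f g)
  case 0
  then show ?case by (auto intro!: continuous_intros)
next
  case (Suc k)
  show ?case
  proof (rule Ck_SucI)
    show "((\<lambda>x. a * f x + b * g x) has_derivative
        (\<lambda>h. a * frechet_derivative f (at x) h + b * frechet_derivative g (at x) h)) (at x)" for x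
      using Suc.prems
      by (auto intro!: derivative_eq_intros frechet_derivative_works_at)
    show "Ck k (\<lambda>x. a * frechet_derivative f (at x) (axis i 1) + b * frechet_derivative g (at x) (axis i 1))" for i
      using Suc.IH[of "partial_deriv i f" "partial_deriv i g"] Suc.prems
      by (simp add: partial_deriv_def)
  qed
qed

lemma Ck_shift:
  assumes "Ck k f"
  shows "Ck k (\<lambda>x. f (x + h))"
  using assms
proof (induction k arbitrary: f)
  case 0
  have "continuous_on UNIV (f \<circ> (\<lambda>x. x + h))"
    using 0 by (intro continuous_on_compose continuous_intros) (auto intro: continuous_on_subset)
  then show ?case by (simp add: o_def)
next
  case (Suc k)
  show ?case
  proof (rule Ck_SucI)
    have "((\<lambda>x. x + h) has_derivative (\<lambda>x. x)) (at x)" for x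
      by (auto intro!: derivative_eq_intros)
    then show "((\<lambda>x. f (x + h)) has_derivative frechet_derivative f (at (x + h))) (at x)" for x
      using has_derivative_compose[of "\<lambda>x. x + h" "\<lambda>x. x" x UNIV f "frechet_derivative f (at (x + h))"] Suc.prems
      by (simp add: frechet_derivative_works_at)
    show "Ck k (\<lambda>x. frechet_derivative f (at (x + h)) (axis i 1))" for i
      using Suc.IH[of "partial_deriv i f"] Suc.prems
      by (simp add: partial_deriv_def)
  qed
qed

lemma compact_closure_supportI:
  fixes f :: "real^3 \<Rightarrow> real"
  assumes "compact K" "\<And>x. x \<notin> K \<Longrightarrow> f x = 0"
  shows "compact (closure {x. f x \<noteq> 0})"
proof -
  have "{x. f x \<noteq> 0} \<subseteq> K" using assms by auto
  then show ?thesis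
    using assms(1) by (meson bounded_subset compact_closure compact_imp_bounded)
qed

lemma zero_outside_closure_support: "x \<notin> closure {x. f x \<noteq> 0} \<Longrightarrow> f x = 0"
  using closure_subset[of "{x. f x \<noteq> 0}"] by blast

lemma test_functions_lincomb:
  assumes "f \<in> test_functions" "g \<in> test_functions"
  shows "(\<lambda>x. a * f x + b * g x) \<in> test_functions"
proof -
  have "compact (closure {x. a * f x + b * g x \<noteq> 0})"
  proof (rule compact_closure_supportI)
    show "compact (closure {x. f x \<noteq> 0} \<union> closure {x. g x \<noteq> 0})"
      using assms by (auto simp: test_functions_def)
    show "a * f x + b * g x = 0" if "x \<notin> closure {x. f x \<noteq> 0} \<union> closure {x. g x \<noteq> 0}" for x
    proof -
      have "f x = 0" "g x = 0"
        by (rule zero_outside_closure_support; use that in blast)+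
      then show ?thesis by simp
    qed
  qed
  then show ?thesis using assms by (simp add: test_functions_def Ck_lincomb)
qed

lemma test_functions_shift:
  assumes "f \<in> test_functions"
  shows "(\<lambda>x. f (x + h)) \<in> test_functions"
proof -
  let ?K = "closure {x. f x \<noteq> 0}"
  have "compact (closure {x. f (x + h) \<noteq> 0})"
  proof (rule compact_closure_supportI)
    show "compact ((\<lambda>y. y - h) ` ?K)"
      using assms by (intro compact_continuous_image continuous_intros) (auto simp: test_functions_def)
    show "f (x + h) = 0" if "x \<notin> (\<lambda>y. y - h) ` ?K" for x
    proof -
      have "x + h \<notin> ?K" using that by (metis add_diff_cancel_right' image_eqI)
      then show ?thesis by (rule zero_outside_closure_support)
    qed
  qed
  then show ?thesis using assms by (simp add: test_functions_def Ck_shift)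
qed

lemma zero_test_function: "(\<lambda>x. 0) \<in> test_functions"
proof -
  have "Ck k (\<lambda>x. 0)" for k
    by (induction k) (auto intro!: Ck_SucI simp: partial_deriv_eqI[of "\<lambda>x. 0" "\<lambda>x h. 0"])
  then show ?thesis by (simp add: test_functions_def)
qed

text \<open>The classical function exp(-1/t), extended by 0, with a polynomial in 1/t as a factor.
  The factor is a parameter because it makes the family closed under differentiation.\<close>

definition flat :: "real poly \<Rightarrow> real \<Rightarrow> real" where
  "flat p t = (if t > 0 then poly p (1 / t) * exp (- 1 / t) else 0)"

lemma tendsto_poly_exp_0: "((\<lambda>y. poly p y * exp (- y)) \<longlongrightarrow> (0::real)) at_top"
proof -
  have "((\<lambda>y. \<Sum>i\<le>degree p. coeff p i * (y ^ i / exp y)) \<longlongrightarrow> (\<Sum>i\<le>degree p. coeff p i * (0::real))) at_top"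
    by (intro tendsto_intros tendsto_power_div_exp_0)
  then show ?thesis
    by (simp add: poly_altdef sum_distrib_right sum_divide_distrib exp_minus field_simps)
qed

text \<open>For t > 0, differentiating p(1/t) exp(-1/t) brings out 1/t^2 times (p - p')(1/t), that
  is, the polynomial X^2 (p - p'). At 0 only the difference quotient from the right needs an
  argument.\<close>

lemma flat_has_real_derivative:
  "(flat p has_real_derivative flat ([:0, 0, 1:] * (p - pderiv p)) t) (at t)"
proof (rule linorder_cases[of t 0])
  assume t: "t < 0"
  have "(flat p has_real_derivative 0) (at t)"
    by (rule has_field_derivative_transform_within_open[of "\<lambda>_. 0" _ _ "{..<0}"])
       (use t in \<open>auto simp: flat_def\<close>)
  then show ?thesis using t by (simp add: flat_def)
next
  assume t: "t > 0"
  have "((\<lambda>t. poly p (1 / t) * exp (- 1 / t)) has_real_derivative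
      flat ([:0, 0, 1:] * (p - pderiv p)) t) (at t)"
    using t by (auto intro!: derivative_eq_intros DERIV_chain2[OF poly_DERIV]
        simp: flat_def field_simps power2_eq_square)
  then show ?thesis
    by (rule has_field_derivative_transform_within_open[of _ _ _ "{0<..}"])
       (use t in \<open>auto simp: flat_def\<close>)
next
  assume t: "t = 0"
  \<comment> \<open>\<open>pCons 0 p\<close> is X p: its extra factor 1/h absorbs the division in
    the difference quotient.\<close>
  have "((\<lambda>h. poly (pCons 0 p) (inverse h) * exp (- inverse h)) \<longlongrightarrow> 0) (at_right (0::real))"
    by (rule filterlim_compose[OF tendsto_poly_exp_0 filterlim_inverse_at_top_right])
  then have "((\<lambda>h. flat p h / h) \<longlongrightarrow> 0) (at_right (0::real))"
    by (rule Lim_transform_eventually)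
       (rule eventually_mono[OF eventually_at_right_less[of 0]], simp add: flat_def field_simps)
  moreover have "((\<lambda>h. flat p h / h) \<longlongrightarrow> 0) (at_left (0::real))"
    by (rule tendsto_eventually)
       (auto simp: flat_def eventually_at_left_field intro!: exI[of _ "-1"])
  ultimately have "((\<lambda>h. flat p h / h) \<longlongrightarrow> 0) (at (0::real))"
    using filterlim_at_split by blast
  then show ?thesis
    unfolding t by (simp add: has_field_derivative_iff flat_def)
qed

text \<open>An algebra of functions that contains its own partial derivatives. Smoothness of all its
  members then follows at once, without formulas for higher derivatives of products.\<close>

inductive_set bump_alg :: "(real^3 \<Rightarrow> real) set" where
  const: "(\<lambda>x. c) \<in> bump_alg"
| flat: "(\<lambda>x. flat p (c * x $ i + d)) \<in> bump_alg"
| add: "f \<in> bump_alg \<Longrightarrow> g \<in> bump_alg \<Longrightarrow> (\<lambda>x. f x + g x) \<in> bump_alg"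
| mult: "f \<in> bump_alg \<Longrightarrow> g \<in> bump_alg \<Longrightarrow> (\<lambda>x. f x * g x) \<in> bump_alg"

lemma bump_alg_derivative:
  assumes "f \<in> bump_alg"
  shows "\<exists>f'. (\<forall>x. (f has_derivative f' x) (at x)) \<and> (\<forall>i. (\<lambda>x. f' x (axis i 1)) \<in> bump_alg)"
  using assms
proof induction
  case (const c)
  then show ?case by (intro exI[of _ "\<lambda>x h. 0"]) (auto intro: bump_alg.const)
next
  case (flat p c i d)
  let ?p = "[:0, 0, 1:] * (p - pderiv p)"
  have "((\<lambda>x::real^3. flat p (c * x $ i + d)) has_derivative (\<lambda>h. c * h $ i * flat ?p (c * x $ i + d))) (at x)" for x
  proof -
    have "((\<lambda>x::real^3. c * x $ i + d) has_derivative (\<lambda>h. c * h $ i)) (at x)"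
      by (auto intro!: derivative_eq_intros bounded_linear_imp_has_derivative bounded_linear_vec_nth)
    from has_derivative_compose[OF this flat_has_real_derivative[unfolded has_field_derivative_def]]
    show ?thesis by (simp add: mult.commute)
  qed
  moreover have "(\<lambda>x::real^3. c * axis j 1 $ i * flat ?p (c * x $ i + d)) \<in> bump_alg" for j
    by (rule bump_alg.mult[OF bump_alg.const bump_alg.flat])
  ultimately show ?case
    by (intro exI[of _ "\<lambda>x h. c * h $ i * flat ?p (c * x $ i + d)"]) blast
next
  case (add f g)
  then obtain f' g' where "\<And>x. (f has_derivative f' x) (at x)" "\<And>i. (\<lambda>x. f' x (axis i 1)) \<in> bump_alg"
    "\<And>x. (g has_derivative g' x) (at x)" "\<And>i. (\<lambda>x. g' x (axis i 1)) \<in> bump_alg" by metis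
  then show ?case
    by (intro exI[of _ "\<lambda>x h. f' x h + g' x h"]) (auto intro!: derivative_intros bump_alg.add)
next
  case (mult f g)
  then obtain f' g' where "\<And>x. (f has_derivative f' x) (at x)" "\<And>i. (\<lambda>x. f' x (axis i 1)) \<in> bump_alg"
    "\<And>x. (g has_derivative g' x) (at x)" "\<And>i. (\<lambda>x. g' x (axis i 1)) \<in> bump_alg" by metis
  then show ?case using mult.hyps
    by (intro exI[of _ "\<lambda>x h. f x * g' x h + f' x h * g x"])
       (auto intro!: derivative_intros bump_alg.add bump_alg.mult)
qed

lemma bump_alg_Ck: "f \<in> bump_alg \<Longrightarrow> Ck k f"
proof (induction k arbitrary: f)
  case 0
  then show ?case
    using bump_alg_derivative[OF 0] by (auto simp: continuous_on_eq_continuous_at intro: has_derivative_continuous)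
next
  case (Suc k)
  from bump_alg_derivative[OF Suc.prems] obtain f'
    where "\<And>x. (f has_derivative f' x) (at x)" "\<And>i. (\<lambda>x. f' x (axis i 1)) \<in> bump_alg" by blast
  then show ?case by (intro Ck_SucI Suc.IH)
qed

lemma bump_alg_prod: "finite S \<Longrightarrow> (\<And>i. i \<in> S \<Longrightarrow> f i \<in> bump_alg) \<Longrightarrow> (\<lambda>x. \<Prod>i\<in>S. f i x) \<in> bump_alg"
  by (induction S rule: finite_induct) (auto intro: bump_alg.intros)

text \<open>A product of flat functions of the distances to the faces, with arguments scaled by n +
  1 so that the bumps converge to the indicator of the open box. The arguments have the shape
  \<open>c * x $ i + d\<close> of \<open>bump_alg.flat\<close>; \<open>box_bump_alt\<close> is the
  readable form.\<close>

definition box_bump :: "real^3 \<Rightarrow> real^3 \<Rightarrow> nat \<Rightarrow> real^3 \<Rightarrow> real" where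
  "box_bump a b n x = (\<Prod>i\<in>UNIV. flat 1 (real (Suc n) * x $ i + - real (Suc n) * a $ i) *
     flat 1 (- real (Suc n) * x $ i + real (Suc n) * b $ i))"

lemma flat_1_bounds: "0 \<le> flat 1 t" "flat 1 t \<le> 1" "flat 1 t > 0 \<longleftrightarrow> t > 0"
  by (auto simp: flat_def)

lemma flat_1_mult_tendsto:
  assumes "t > 0"
  shows "(\<lambda>n. flat 1 (real (Suc n) * t)) \<longlonglongrightarrow> 1"
proof -
  have "(\<lambda>n. exp (- (inverse (real (Suc n)) * inverse t))) \<longlonglongrightarrow> exp (- (0 * inverse t))"
    by (intro tendsto_intros LIMSEQ_inverse_real_of_nat)
  moreover have "real (Suc n) * t > 0" for n using assms by (intro mult_pos_pos) auto
  ultimately show ?thesis by (simp add: flat_def field_simps del: of_nat_Suc)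
qed

lemma box_bump_alt:
  "box_bump a b n x = (\<Prod>i\<in>UNIV. flat 1 (real (Suc n) * (x $ i - a $ i)) * flat 1 (real (Suc n) * (b $ i - x $ i)))"
  by (simp add: box_bump_def algebra_simps)

lemma box_bump_nonneg: "0 \<le> box_bump a b n x"
  unfolding box_bump_def by (intro prod_nonneg mult_nonneg_nonneg ballI flat_1_bounds)

lemma box_bump_le_1: "box_bump a b n x \<le> 1"
  unfolding box_bump_def by (intro prod_le_1 conjI mult_nonneg_nonneg mult_le_one ballI flat_1_bounds)

lemma box_bump_eq_0:
  assumes "x \<notin> box a b"
  shows "box_bump a b n x = 0"
proof -
  obtain i where "x $ i - a $ i \<le> 0 \<or> b $ i - x $ i \<le> 0"
    using assms by (auto simp: mem_box_cart not_less)
  then have "flat 1 (real (Suc n) * (x $ i - a $ i)) * flat 1 (real (Suc n) * (b $ i - x $ i)) = 0"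
    by (auto simp: flat_def zero_less_mult_iff)
  then show ?thesis
    unfolding box_bump_alt by (intro prod_zero) auto
qed

lemma box_bump_pos: "x \<in> box a b \<Longrightarrow> box_bump a b n x > 0"
  unfolding box_bump_alt mem_box_cart by (intro prod_pos mult_pos_pos ballI iffD2[OF flat_1_bounds(3)]) auto

lemma box_bump_test: "box_bump a b n \<in> test_functions"
proof -
  have "box_bump a b n \<in> bump_alg"
    unfolding box_bump_def by (intro bump_alg_prod bump_alg.mult bump_alg.flat) auto
  moreover have "compact (closure {x. box_bump a b n x \<noteq> 0})"
    by (rule compact_closure_supportI[of "cbox a b"])
       (auto intro!: box_bump_eq_0 dest: subsetD[OF box_subset_cbox])
  ultimately show ?thesis by (simp add: test_functions_def bump_alg_Ck)
qed

lemma box_bump_tendsto: "(\<lambda>n. box_bump a b n x) \<longlonglongrightarrow> indicator (box a b) x"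
proof (cases "x \<in> box a b")
  case True
  then have "(\<lambda>n. box_bump a b n x) \<longlonglongrightarrow> (\<Prod>i\<in>(UNIV::3 set). 1 * 1)"
    unfolding box_bump_alt
    by (intro tendsto_prod tendsto_mult flat_1_mult_tendsto) (auto simp: mem_box_cart)
  then show ?thesis using True by simp
qed (simp add: box_bump_eq_0)

section \<open>Integration by parts\<close>

text \<open>A class that contains the test functions and is easily seen to be closed under products.
  One derivative is all that integration by parts and the Sobolev inequality use, the latter for a
  fourth power.\<close>

definition C1c :: "(real^3 \<Rightarrow> real) \<Rightarrow> bool" where
  "C1c f \<longleftrightarrow> (\<forall>x. f differentiable (at x)) \<and> continuous_on UNIV (classical_grad f) \<and>
     compact (closure {x. f x \<noteq> 0})"

lemma test_functions_C1c: "f \<in> test_functions \<Longrightarrow> C1c f"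
proof -
  assume "f \<in> test_functions"
  then have "Ck (Suc 0) f" "compact (closure {x. f x \<noteq> 0})"
    unfolding test_functions_def by blast+
  then show "C1c f"
    unfolding C1c_def classical_grad_def by (auto intro!: continuous_intros)
qed

lemma classical_grad_eqI:
  assumes "(f has_derivative (\<lambda>h. v \<bullet> h)) (at x)"
  shows "classical_grad f x = v"
proof -
  have "frechet_derivative f (at x) = (\<lambda>h. v \<bullet> h)"
    using frechet_derivative_at[OF assms] by simp
  then show ?thesis
    by (simp add: classical_grad_def partial_deriv_def vec_eq_iff inner_axis)
qed

lemma classical_grad_derivative:
  assumes "f differentiable (at x)"
  shows "(f has_derivative (\<lambda>h. classical_grad f x \<bullet> h)) (at x)"
proof -
  let ?D = "frechet_derivative f (at x)"
  have D: "(f has_derivative ?D) (at x)" using assms by (rule frechet_derivative_works_at)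
  then have lin: "linear ?D" by (rule has_derivative_linear)
  have "?D h = classical_grad f x \<bullet> h" for h
  proof -
    have "?D h = ?D (\<Sum>i\<in>UNIV. h $ i *\<^sub>R axis i 1)"
      by (simp add: basis_expansion flip: scalar_mult_eq_scaleR)
    also have "\<dots> = (\<Sum>i\<in>UNIV. h $ i * ?D (axis i 1))"
      by (simp add: linear_sum[OF lin] linear_cmul[OF lin])
    also have "\<dots> = classical_grad f x \<bullet> h"
      by (simp add: classical_grad_def partial_deriv_def inner_vec_def mult.commute)
    finally show ?thesis .
  qed
  then have "?D = (\<lambda>h. classical_grad f x \<bullet> h)" by (rule ext)
  then show ?thesis using D by simp
qed

lemma C1c_derivative: "C1c f \<Longrightarrow> (f has_derivative (\<lambda>h. classical_grad f x \<bullet> h)) (at x)"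
  by (simp add: C1c_def classical_grad_derivative)

lemma classical_grad_lincomb:
  assumes "f differentiable (at x)" "g differentiable (at x)"
  shows "classical_grad (\<lambda>x. a * f x + b * g x) x = a *\<^sub>R classical_grad f x + b *\<^sub>R classical_grad g x"
  by (rule classical_grad_eqI)
     (auto intro!: derivative_eq_intros classical_grad_derivative assms simp: inner_simps)

lemma classical_grad_mult:
  assumes "f differentiable (at x)" "g differentiable (at x)"
  shows "classical_grad (\<lambda>x. f x * g x) x = f x *\<^sub>R classical_grad g x + g x *\<^sub>R classical_grad f x"
  by (rule classical_grad_eqI)
     (auto intro!: derivative_eq_intros classical_grad_derivative assms simp: inner_simps)

lemma classical_grad_shift:
  assumes "f differentiable (at (x + h))"
  shows "classical_grad (\<lambda>x. f (x + h)) x = classical_grad f (x + h)"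
proof (rule classical_grad_eqI)
  have "((\<lambda>x. x + h) has_derivative (\<lambda>x. x)) (at x)"
    by (auto intro!: derivative_eq_intros)
  then show "((\<lambda>x. f (x + h)) has_derivative (\<bullet>) (classical_grad f (x + h))) (at x)"
    using has_derivative_compose[of "\<lambda>x. x + h" "\<lambda>x. x" x UNIV f "(\<bullet>) (classical_grad f (x + h))"]
      classical_grad_derivative[OF assms] by simp
qed

lemma C1c_continuous: "C1c f \<Longrightarrow> continuous_on A f"
  unfolding continuous_on_eq_continuous_within
  by (meson C1c_def continuous_at_imp_continuous_within differentiable_imp_continuous_within)

lemma C1c_grad_continuous: "C1c f \<Longrightarrow> continuous_on A (classical_grad f)"
  unfolding C1c_def by (auto intro: continuous_on_subset)

lemma C1c_measurable [measurable_dest]: "C1c f \<Longrightarrow> f \<in> borel_measurable borel"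
  by (simp add: C1c_continuous borel_measurable_continuous_onI)

lemma C1c_grad_measurable: "C1c f \<Longrightarrow> classical_grad f \<in> borel_measurable borel"
  by (simp add: C1c_grad_continuous borel_measurable_continuous_onI)

lemma C1c_measurable_lebesgue: "C1c f \<Longrightarrow> f \<in> borel_measurable lebesgue"
  using C1c_measurable by (auto intro: measurable_completion)

lemma C1c_grad_measurable_lebesgue: "C1c f \<Longrightarrow> classical_grad f \<in> borel_measurable lebesgue"
  using C1c_grad_measurable by (auto intro: measurable_completion)

lemma C1c_bounds:
  assumes "C1c f"
  obtains r M where "r > 0" "M \<ge> 0"
    "\<And>x. \<bar>f x\<bar> \<le> M" "\<And>x. norm (classical_grad f x) \<le> M"
    "\<And>x. norm x > r \<Longrightarrow> f x = 0" "\<And>x. norm x > r \<Longrightarrow> classical_grad f x = 0"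
proof -
  let ?K = "closure {x. f x \<noteq> 0}"
  have K: "compact ?K" using assms by (simp add: C1c_def)
  have f0: "f x = 0" if "x \<notin> ?K" for x using that by (rule zero_outside_closure_support)
  have g0: "classical_grad f x = 0" if "x \<notin> ?K" for x
  proof (rule classical_grad_eqI)
    have "((\<lambda>_. 0) has_derivative (\<lambda>h. 0 \<bullet> h)) (at x)" by simp
    then show "(f has_derivative (\<bullet>) 0) (at x)"
    proof (rule has_derivative_transform_within_open)
      show "open (- ?K)" "x \<in> - ?K" using that by auto
      show "0 = f y" if "y \<in> - ?K" for y
        by (rule f0[symmetric]) (use that in blast)
    qed
  qed
  have "bounded (f ` ?K)" "bounded (classical_grad f ` ?K)" "bounded ?K"
    using K by (auto intro!: compact_imp_bounded compact_continuous_image C1c_continuous C1c_grad_continuous assms)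
  then obtain M1 M2 r where "\<forall>y\<in>f ` ?K. norm y \<le> M1" "\<forall>y\<in>classical_grad f ` ?K. norm y \<le> M2"
      "\<forall>x\<in>?K. norm x \<le> r"
    unfolding bounded_iff by blast
  then have M: "\<bar>f x\<bar> \<le> M1" "norm (classical_grad f x) \<le> M2" "norm x \<le> r" if "x \<in> ?K" for x
    using that by auto
  show ?thesis
  proof (rule that[of "max 1 r" "max 0 (max M1 M2)"])
    fix x
    show "\<bar>f x\<bar> \<le> max 0 (max M1 M2)"
      by (cases "x \<in> ?K") (use M(1)[of x] f0[of x] in force)+
    show "norm (classical_grad f x) \<le> max 0 (max M1 M2)"
      by (cases "x \<in> ?K") (use M(2)[of x] g0[of x] in force)+
    assume "norm x > max 1 r"
    then have "x \<notin> ?K" using M(3)[of x] by linarith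
    then show "f x = 0" "classical_grad f x = 0" by (rule f0, rule g0)
  qed auto
qed

lemma C1c_lipschitz:
  assumes "C1c f" "M \<ge> 0" "\<And>x. norm (classical_grad f x) \<le> M"
  shows "\<bar>f x - f y\<bar> \<le> M * norm (x - y)"
proof -
  have "onorm ((\<bullet>) (classical_grad f x)) \<le> M" for x
  proof (rule onorm_le)
    show "norm (classical_grad f x \<bullet> h) \<le> M * norm h" for h
      using Cauchy_Schwarz_ineq2[of "classical_grad f x" h] assms(3)[of x]
      by (metis mult_right_mono norm_ge_zero order_trans real_norm_def)
  qed
  then have "norm (f x - f y) \<le> M * norm (x - y)"
    by (intro differentiable_bound[of UNIV f "\<lambda>x. (\<bullet>) (classical_grad f x)"])
       (auto intro!: C1c_derivative assms)
  then show ?thesis by simp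
qed

lemma C1c_mult:
  assumes "C1c f" "C1c g"
  shows "C1c (\<lambda>x. f x * g x)"
proof -
  have d: "f differentiable (at x)" "g differentiable (at x)" for x using assms by (auto simp: C1c_def)
  have "classical_grad (\<lambda>x. f x * g x) = (\<lambda>x. f x *\<^sub>R classical_grad g x + g x *\<^sub>R classical_grad f x)"
    using classical_grad_mult[OF d] by auto
  moreover have "compact (closure {x. f x * g x \<noteq> 0})"
  proof (rule compact_closure_supportI)
    show "compact (closure {x. f x \<noteq> 0})" using assms by (auto simp: C1c_def)
    show "f x * g x = 0" if "x \<notin> closure {x. f x \<noteq> 0}" for x
    proof -
      have "f x = 0" using that by (rule zero_outside_closure_support)
      then show ?thesis by simp
    qed
  qed
  ultimately show ?thesis
    unfolding C1c_def using d
    by (auto intro!: continuous_intros C1c_continuous C1c_grad_continuous assms)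
qed

section \<open>Integrals of translates, and integration by parts without boundary terms\<close>

lemma integrable_indicator_cball: "integrable lborel (\<lambda>x::'a::euclidean_space. (M::real) * indicator (cball a r) x)"
proof -
  have "emeasure lborel (cball a r) < \<infinity>" by (rule emeasure_bounded_finite) simp
  then show ?thesis by (intro integrable_mult_right integrable_real_indicator) auto
qed

lemma continuous_bounded_cball:
  fixes u :: "'a::euclidean_space \<Rightarrow> real"
  assumes "continuous_on UNIV u"
  obtains U where "U \<ge> 0" "\<And>x. x \<in> cball a r \<Longrightarrow> \<bar>u x\<bar> \<le> U"
proof -
  have "bounded (u ` cball a r)"
    by (intro compact_imp_bounded compact_continuous_image continuous_on_subset[OF assms]) auto
  then obtain U where U: "\<forall>x\<in>cball a r. \<bar>u x\<bar> \<le> U" by (auto simp: bounded_iff)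
  show ?thesis by (rule that[of "\<bar>U\<bar>"]) (use U in force)+
qed

lemma integrable_bounded_cball:
  fixes f :: "'a::euclidean_space \<Rightarrow> 'b::{banach, second_countable_topology}"
  assumes "f \<in> borel_measurable lborel" "\<And>x. norm x \<le> r \<Longrightarrow> norm (f x) \<le> M" "\<And>x. norm x > r \<Longrightarrow> f x = 0"
  shows "integrable lborel f"
proof (rule Bochner_Integration.integrable_bound)
  show "integrable lborel (\<lambda>x. M * indicator (cball (0::'a) r) x)" by (rule integrable_indicator_cball)
  show "AE x in lborel. norm (f x) \<le> norm (M * indicator (cball 0 r) x)"
  proof (rule AE_I2)
    show "norm (f x) \<le> norm (M * indicator (cball 0 r) x)" for x
      using assms(2)[of x] assms(3)[of x] by (cases "norm x \<le> r") auto
  qed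
qed (use assms in auto)

lemma integral_shift_lborel:
  fixes f :: "'a::euclidean_space \<Rightarrow> 'b::{banach, second_countable_topology}"
  assumes [measurable]: "f \<in> borel_measurable borel"
  shows "(\<integral>x. f (x + c) \<partial>lborel) = (\<integral>x. f x \<partial>lborel)"
proof -
  have "(\<integral>x. f x \<partial>distr lborel borel ((+) c)) = (\<integral>x. f (c + x) \<partial>lborel)"
    by (rule integral_distr) auto
  then show ?thesis by (simp add: lborel_distr_plus add.commute)
qed

lemma C1c_shift:
  assumes "C1c f"
  shows "C1c (\<lambda>x. f (x + h))"
proof -
  have d: "f differentiable (at x)" for x using assms by (auto simp: C1c_def)
  have g: "classical_grad (\<lambda>x. f (x + h)) = (\<lambda>x. classical_grad f (x + h))"
    using classical_grad_shift[OF d] by auto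
  have "(\<lambda>x. f (x + h)) differentiable at x" for x
    using differentiable_chain_at[of "\<lambda>x. x + h" x f] d by (auto simp: o_def)
  moreover have "continuous_on UNIV (\<lambda>x. classical_grad f (x + h))"
    by (rule continuous_on_compose2[OF C1c_grad_continuous[OF assms, of UNIV]]) (auto intro!: continuous_intros)
  moreover obtain r where r: "\<And>x. norm x > r \<Longrightarrow> f x = 0" using C1c_bounds[OF assms] by metis
  have "compact (closure {x. f (x + h) \<noteq> 0})"
  proof (rule compact_closure_supportI)
    show "f (x + h) = 0" if "x \<notin> cball (- h) r" for x
      by (rule r) (use that in \<open>simp add: dist_norm norm_minus_commute add.commute\<close>)
  qed simp
  ultimately show ?thesis by (simp add: C1c_def g)
qed

text \<open>The translation parameter is differentiated at \<open>0\<close> by dominated convergence of the difference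
  quotients; they vanish outside a fixed ball because the quotients use bounded translations.\<close>

lemma translation_integral_derivative_0:
  fixes u :: "real^3 \<Rightarrow> real"
  assumes u: "continuous_on UNIV u" and \<eta>: "C1c \<eta>"
  shows "((\<lambda>t. \<integral>z. u z * \<eta> (z + t *\<^sub>R h) \<partial>lborel) has_real_derivative
      (\<integral>z. u z * (classical_grad \<eta> z \<bullet> h) \<partial>lborel)) (at 0)"
proof -
  obtain r M where r: "r > 0" "M \<ge> 0" and M: "\<And>x. \<bar>\<eta> x\<bar> \<le> M" "\<And>x. norm (classical_grad \<eta> x) \<le> M"
      "\<And>x. norm x > r \<Longrightarrow> \<eta> x = 0"
    using C1c_bounds[OF \<eta>] by metis
  note [measurable] = C1c_measurable[OF \<eta>] C1c_grad_measurable[OF \<eta>] borel_measurable_continuous_onI[OF u]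
  have lip: "\<bar>\<eta> x - \<eta> y\<bar> \<le> M * norm (x - y)" for x y
    using C1c_lipschitz[OF \<eta> r(2) M(2)] .
  have int: "integrable lborel (\<lambda>z. u z * \<eta> (z + t *\<^sub>R h))" for t
  proof -
    obtain U where "U \<ge> 0" and U: "\<And>x. x \<in> cball 0 (r + norm (t *\<^sub>R h)) \<Longrightarrow> \<bar>u x\<bar> \<le> U"
      using continuous_bounded_cball[OF u] by blast
    show ?thesis
    proof (rule integrable_bounded_cball)
      fix z :: "real^3"
      show "norm (u z * \<eta> (z + t *\<^sub>R h)) \<le> U * M" if "norm z \<le> r + norm (t *\<^sub>R h)"
        using U[of z] M(1)[of "z + t *\<^sub>R h"] that \<open>U \<ge> 0\<close> unfolding norm_mult by (intro mult_mono) auto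
      show "u z * \<eta> (z + t *\<^sub>R h) = 0" if "norm z > r + norm (t *\<^sub>R h)"
        using M(3)[of "z + t *\<^sub>R h"] that norm_triangle_ineq2[of z "- (t *\<^sub>R h)"] by simp
    qed measurable
  qed
  show ?thesis
    unfolding has_field_derivative_iff tendsto_at_iff_sequentially
  proof (intro allI impI)
    fix s :: "nat \<Rightarrow> real"
    assume s0: "\<forall>k. s k \<in> UNIV - {0}" and s: "s \<longlonglongrightarrow> 0"
    obtain S where S: "\<And>k. \<bar>s k\<bar> \<le> S" "S > 0"
      using convergent_imp_Bseq[OF convergentI[OF s]] by (auto simp: Bseq_def)
    let ?R = "r + S * norm h"
    obtain U where "U \<ge> 0" and U: "\<And>x. x \<in> cball 0 ?R \<Longrightarrow> \<bar>u x\<bar> \<le> U"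
      using continuous_bounded_cball[OF u] by blast
    have "(\<lambda>k. \<integral>z. u z * ((\<eta> (z + s k *\<^sub>R h) - \<eta> z) / s k) \<partial>lborel) \<longlonglongrightarrow> (\<integral>z. u z * (classical_grad \<eta> z \<bullet> h) \<partial>lborel)"
    proof (rule integral_dominated_convergence)
      show "integrable lborel (\<lambda>z::real^3. (U * (M * norm h)) * indicator (cball 0 ?R) z)"
        by (rule integrable_indicator_cball)
      show "AE z in lborel. norm (u z * ((\<eta> (z + s k *\<^sub>R h) - \<eta> z) / s k)) \<le> (U * (M * norm h)) * indicator (cball 0 ?R) z" for k
      proof (rule AE_I2)
        fix z :: "real^3"
        have sk: "\<bar>s k\<bar> * norm h \<le> S * norm h" using S by (intro mult_right_mono) auto
        show "norm (u z * ((\<eta> (z + s k *\<^sub>R h) - \<eta> z) / s k)) \<le> (U * (M * norm h)) * indicator (cball 0 ?R) z"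
        proof (cases "norm z \<le> ?R")
          case True
          have "\<bar>(\<eta> (z + s k *\<^sub>R h) - \<eta> z) / s k\<bar> \<le> M * norm h"
            using lip[of "z + s k *\<^sub>R h" z] s0 by (simp add: field_simps)
          moreover have "\<bar>u z\<bar> \<le> U" using U[of z] True by auto
          ultimately have "\<bar>u z\<bar> * \<bar>(\<eta> (z + s k *\<^sub>R h) - \<eta> z) / s k\<bar> \<le> U * (M * norm h)"
            using \<open>U \<ge> 0\<close> by (intro mult_mono) auto
          then show ?thesis using True by (simp add: abs_mult)
        next
          case False
          have "norm (z + s k *\<^sub>R h) > r" using norm_triangle_ineq2[of z "- (s k *\<^sub>R h)"] False sk by auto
          moreover have "norm z > r" using False S(2) by (smt (verit) mult_nonneg_nonneg norm_ge_zero)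
          ultimately show ?thesis using M(3)[of "z + s k *\<^sub>R h"] M(3)[of z] False by simp
        qed
      qed
      show "AE z in lborel. (\<lambda>k. u z * ((\<eta> (z + s k *\<^sub>R h) - \<eta> z) / s k)) \<longlonglongrightarrow> u z * (classical_grad \<eta> z \<bullet> h)"
      proof (intro AE_I2 tendsto_mult tendsto_const)
        fix z
        have "((\<lambda>t. z + t *\<^sub>R h) has_derivative (\<lambda>t. t *\<^sub>R h)) (at 0)"
          by (auto intro!: derivative_eq_intros)
        from has_derivative_compose[OF this, of \<eta> "\<lambda>y. classical_grad \<eta> z \<bullet> y"]
        have "((\<lambda>t. \<eta> (z + t *\<^sub>R h)) has_real_derivative (classical_grad \<eta> z \<bullet> h)) (at 0)"
          using C1c_derivative[OF \<eta>, of z] by (simp add: has_field_derivative_def mult_commute_abs)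
        then show "(\<lambda>k. (\<eta> (z + s k *\<^sub>R h) - \<eta> z) / s k) \<longlonglongrightarrow> classical_grad \<eta> z \<bullet> h"
          unfolding has_field_derivative_iff tendsto_at_iff_sequentially using s0 s by (auto simp: o_def)
      qed
    qed measurable
    moreover have "(\<integral>z. u z * ((\<eta> (z + s k *\<^sub>R h) - \<eta> z) / s k) \<partial>lborel) =
        ((\<integral>z. u z * \<eta> (z + s k *\<^sub>R h) \<partial>lborel) - (\<integral>z. u z * \<eta> (z + 0 *\<^sub>R h) \<partial>lborel)) / (s k - 0)" for k
      by (subst Bochner_Integration.integral_diff[symmetric, OF int int], subst integral_divide_zero[symmetric])
         (simp add: algebra_simps diff_divide_distrib)
    ultimately show "((\<lambda>t. ((\<integral>z. u z * \<eta> (z + t *\<^sub>R h) \<partial>lborel) - (\<integral>z. u z * \<eta> (z + 0 *\<^sub>R h) \<partial>lborel)) / (t - 0)) \<circ> s)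
        \<longlonglongrightarrow> (\<integral>z. u z * (classical_grad \<eta> z \<bullet> h) \<partial>lborel)"
      unfolding o_def by (simp only:)
  qed
qed

text \<open>The case t = 0 applied to the translate of \<open>\<eta>\<close> by
  \<open>t *\<^sub>R h\<close>, which is again of class \<open>C1c\<close>.\<close>

lemma translation_integral_derivative:
  fixes u :: "real^3 \<Rightarrow> real"
  assumes u: "continuous_on UNIV u" and \<eta>: "C1c \<eta>"
  shows "((\<lambda>t. \<integral>z. u z * \<eta> (z + t *\<^sub>R h) \<partial>lborel) has_real_derivative
      (\<integral>z. u z * (classical_grad \<eta> (z + t *\<^sub>R h) \<bullet> h) \<partial>lborel)) (at t)"
proof -
  have "((\<lambda>s. \<integral>z. u z * \<eta> (z + s *\<^sub>R h + t *\<^sub>R h) \<partial>lborel) has_real_derivative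
      (\<integral>z. u z * (classical_grad \<eta> (z + t *\<^sub>R h) \<bullet> h) \<partial>lborel)) (at 0)"
    using translation_integral_derivative_0[OF u C1c_shift[OF \<eta>, of "t *\<^sub>R h"], of h]
      classical_grad_shift[of \<eta> _ "t *\<^sub>R h"] \<eta> by (simp add: C1c_def)
  then have "((\<lambda>s. \<integral>z. u z * \<eta> (z + (s + t) *\<^sub>R h) \<partial>lborel) has_real_derivative
      (\<integral>z. u z * (classical_grad \<eta> (z + t *\<^sub>R h) \<bullet> h) \<partial>lborel)) (at 0)"
    by (simp add: scaleR_left_distrib add.assoc)
  then show ?thesis
    using DERIV_shift[of "\<lambda>s. \<integral>z. u z * \<eta> (z + s *\<^sub>R h) \<partial>lborel" _ 0 t] by simp
qed

lemma C1c_integrable_grad: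
  assumes "C1c f"
  shows "integrable lborel (classical_grad f)"
proof -
  obtain r M where "\<And>x. norm (classical_grad f x) \<le> M" "\<And>x. norm x > r \<Longrightarrow> classical_grad f x = 0"
    using C1c_bounds[OF assms] by metis
  with C1c_grad_measurable[OF assms] show ?thesis by (intro integrable_bounded_cball[of _ r M]) auto
qed

text \<open>With \<open>u = 1\<close> the translated integral is constant in the translation
  parameter, so its derivative, the integral of a directional derivative, vanishes.\<close>

lemma C1c_integral_grad:
  assumes "C1c f"
  shows "(\<integral>x. classical_grad f x \<partial>lborel) = 0"
proof -
  have "(\<integral>x. classical_grad f x \<partial>lborel) \<bullet> h = 0" for h
  proof -
    have "((\<lambda>t. \<integral>z. 1 * f (z + t *\<^sub>R h) \<partial>lborel) has_real_derivative
        (\<integral>z. 1 * (classical_grad f z \<bullet> h) \<partial>lborel)) (at 0)"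
      by (rule translation_integral_derivative_0) (use assms in auto)
    then have "((\<lambda>t. \<integral>z. f z \<partial>lborel) has_real_derivative (\<integral>z. classical_grad f z \<bullet> h \<partial>lborel)) (at (0::real))"
      using integral_shift_lborel[OF C1c_measurable[OF assms]] by simp
    then have "(\<integral>z. classical_grad f z \<bullet> h \<partial>lborel) = 0"
      using DERIV_const DERIV_unique by blast
    then show ?thesis using C1c_integrable_grad[OF assms] by simp
  qed
  then show ?thesis by (metis inner_eq_zero_iff)
qed

lemma C1c_integration_by_parts:
  assumes "C1c f" "C1c g"
  shows "(\<integral>x. f x *\<^sub>R classical_grad g x \<partial>lborel) = - (\<integral>x. g x *\<^sub>R classical_grad f x \<partial>lborel)"
proof -
  have int: "integrable lborel (\<lambda>x. f x *\<^sub>R classical_grad g x)" if f: "C1c f" and g: "C1c g" for f g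
  proof -
    obtain r M where M: "M \<ge> 0" "\<And>x. \<bar>f x\<bar> \<le> M" "\<And>x. norm x > r \<Longrightarrow> f x = 0" using C1c_bounds[OF f] by metis
    obtain N where N: "N \<ge> 0" "\<And>x. norm (classical_grad g x) \<le> N" using C1c_bounds[OF g] by metis
    note [measurable] = C1c_measurable[OF f] C1c_grad_measurable[OF g]
    show ?thesis
    proof (rule integrable_bounded_cball)
      show "norm (f x *\<^sub>R classical_grad g x) \<le> M * N" for x
        unfolding norm_scaleR by (intro mult_mono M N) auto
      show "f x *\<^sub>R classical_grad g x = 0" if "norm x > r" for x
        using M(3)[OF that] by simp
    qed measurable
  qed
  have "0 = (\<integral>x. classical_grad (\<lambda>x. f x * g x) x \<partial>lborel)"
    using C1c_integral_grad[OF C1c_mult[OF assms]] by simp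
  also have "\<dots> = (\<integral>x. f x *\<^sub>R classical_grad g x + g x *\<^sub>R classical_grad f x \<partial>lborel)"
    using assms by (simp add: classical_grad_mult C1c_def)
  also have "\<dots> = (\<integral>x. f x *\<^sub>R classical_grad g x \<partial>lborel) + (\<integral>x. g x *\<^sub>R classical_grad f x \<partial>lborel)"
    using int assms by (intro Bochner_Integration.integral_add) auto
  finally show ?thesis by (simp add: eq_neg_iff_add_eq_0)
qed

section \<open>Uniqueness of the weak gradient\<close>

lemma sigma_finite_completion:
  assumes "sigma_finite_measure M"
  shows "sigma_finite_measure (completion M)"
proof -
  obtain A where "countable A" "A \<subseteq> sets M" "\<Union>A = space M" "\<forall>a\<in>A. emeasure M a \<noteq> \<infinity>"
    using assms unfolding sigma_finite_measure_def by blast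
  then show ?thesis
    unfolding sigma_finite_measure_def by (intro exI[of _ A]) (auto intro: sets_completionI_sets)
qed

lemmas sigma_finite_lebesgue = sigma_finite_completion[OF sigma_finite_lborel]

text \<open>A Dynkin argument: boxes are an intersection-stable generator of the Borel sets, and the
  sets over which \<open>f\<close> integrates to 0 are closed under complements and disjoint unions.
  Lebesgue sets differ from Borel sets by null sets, and a density is determined by its integrals
  over all measurable sets.\<close>

lemma AE_zero_if_box_integrals_zero:
  fixes f :: "'a::euclidean_space \<Rightarrow> 'b::{banach, second_countable_topology}"
  assumes int: "integrable lebesgue f"
    and box: "\<And>a b. (\<integral>x. indicator (box a b) x *\<^sub>R f x \<partial>lebesgue) = 0"
    and supp: "\<And>x. x \<notin> box c d \<Longrightarrow> f x = 0"
  shows "AE x in lebesgue. f x = 0"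
proof -
  have set_int: "set_integrable lebesgue A f" if "A \<in> sets lebesgue" for A
    unfolding set_integrable_def using that int by (rule integrable_mult_indicator)
  \<comment> \<open>Complements require the integral over the whole space to vanish; the support
    condition makes it a box integral.\<close>
  have UNIV: "(\<integral>x. f x \<partial>lebesgue) = 0"
    using box[of c d] by (rule trans[rotated]) (intro Bochner_Integration.integral_cong, auto simp: indicator_def supp)
  have borel: "(LINT x:A|lebesgue. f x) = 0" if "A \<in> sigma_sets UNIV (range (\<lambda>(a, b). box a b))" for A
  proof (rule sigma_sets_induct_disjoint[OF _ _ that])
    show "Int_stable (range (\<lambda>(a, b). box a b :: 'a set))"
      by (auto simp: Int_stable_def box_Int_box)
    have sets: "A \<in> sets lebesgue" if "A \<in> sigma_sets UNIV (range (\<lambda>(a, b). box a b :: 'a set))" for A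
    proof -
      have "A \<in> sets borel" using that by (simp add: borel_eq_box)
      then show ?thesis by (simp add: sets_completionI_sets)
    qed
    fix A :: "'a set" assume A: "A \<in> sigma_sets UNIV (range (\<lambda>(a, b). box a b))" "(LINT x:A|lebesgue. f x) = 0"
    have "f = (\<lambda>x. indicator A x *\<^sub>R f x + indicator (UNIV - A) x *\<^sub>R f x)"
      by (auto simp: indicator_def)
    then have "(\<integral>x. f x \<partial>lebesgue) = (LINT x:A|lebesgue. f x) + (LINT x:UNIV - A|lebesgue. f x)"
      unfolding set_lebesgue_integral_def
      using set_int[of A] set_int[of "UNIV - A"] sets[OF A(1)]
        sets.Diff[OF sets.top[of lebesgue] sets[OF A(1)]]
      unfolding set_integrable_def space_completion space_lborel
      by (subst Bochner_Integration.integral_add[symmetric]) auto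
    then show "(LINT x:UNIV - A|lebesgue. f x) = 0" using A(2) UNIV by simp
  next
    fix A :: "nat \<Rightarrow> 'a set"
    assume A: "disjoint_family A" "range A \<subseteq> sigma_sets UNIV (range (\<lambda>(a, b). box a b))"
      "\<And>i. (LINT x:A i|lebesgue. f x) = 0"
    have "A i \<in> sets lebesgue" for i
    proof -
      have "A i \<in> sets borel" using A(2) by (auto simp: borel_eq_box)
      then show ?thesis by (simp add: sets_completionI_sets)
    qed
    then have "(LINT x:(\<Union>i. A i)|lebesgue. f x) = (\<Sum>i. (LINT x:A i|lebesgue. f x))"
      using A(1) by (intro lebesgue_integral_countable_add set_int)
        (auto simp: disjoint_family_on_def)
    then show "(LINT x:\<Union>(range A)|lebesgue. f x) = 0" using A(3) by simp
  qed (use box in \<open>auto simp: set_lebesgue_integral_def\<close>)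
  show ?thesis
  proof (rule sigma_finite_measure.density_unique_banach[OF sigma_finite_lebesgue, of f "\<lambda>_. 0"])
    fix A :: "'a set" assume "A \<in> sets lebesgue"
    then obtain S N N' where A: "A = S \<union> N" "N \<subseteq> N'" "N' \<in> null_sets lborel" "S \<in> sets lborel"
      by (rule sets_completionE)
    have "AE x in lborel. x \<notin> N'" using A(3) by (rule AE_not_in)
    then have "AE x in lebesgue. x \<notin> N'" by (rule AE_completion)
    then have "AE x in lebesgue. indicator A x *\<^sub>R f x = indicator S x *\<^sub>R f x"
      by eventually_elim (use A(1,2) in \<open>auto simp: indicator_def\<close>)
    then have "(LINT x:A|lebesgue. f x) = (LINT x:S|lebesgue. f x)"
      unfolding set_lebesgue_integral_def
      using set_int[unfolded set_integrable_def] \<open>A \<in> sets lebesgue\<close> A(4)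
      by (intro integral_cong_AE) (auto intro!: borel_measurable_integrable)
    then show "(LINT x:A|lebesgue. f x) = (LINT x:A|lebesgue. 0)"
      using borel[of S] A(4) by (simp add: borel_eq_box set_lebesgue_integral_def)
  qed (use int in auto)
qed

definition locally_integrable :: "(real^3 \<Rightarrow> 'b::{banach, second_countable_topology}) \<Rightarrow> bool" where
  "locally_integrable f \<longleftrightarrow> (\<forall>K. compact K \<longrightarrow> set_integrable lebesgue K f)"

text \<open>The function is the pointwise limit of its restrictions to balls, each of which is
  integrable.\<close>

lemma locally_integrable_measurable:
  assumes "locally_integrable f"
  shows "f \<in> borel_measurable lebesgue"
proof (rule borel_measurable_LIMSEQ_metric)
  show "(\<lambda>x. indicator (cball 0 (real n)) x *\<^sub>R f x) \<in> borel_measurable lebesgue" for n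
    using assms unfolding locally_integrable_def set_integrable_def by (auto intro: borel_measurable_integrable)
  show "(\<lambda>n. indicator (cball 0 (real n)) x *\<^sub>R f x) \<longlonglongrightarrow> f x" for x
  proof (rule tendsto_eventually)
    have "eventually (\<lambda>n. real n \<ge> norm x) sequentially"
      using filterlim_real_sequentially by (auto simp: filterlim_at_top)
    then show "eventually (\<lambda>n. indicator (cball 0 (real n)) x *\<^sub>R f x = f x) sequentially"
      by eventually_elim simp
  qed
qed

lemma locally_integrable_mult_bounded:
  fixes f :: "real^3 \<Rightarrow> 'b::{banach, second_countable_topology}"
    and F :: "real^3 \<Rightarrow> 'c::{banach, second_countable_topology}"
  assumes "locally_integrable f" "F \<in> borel_measurable lebesgue"
    "\<And>x. norm (F x) \<le> M * norm (f x)" "\<And>x. norm x > r \<Longrightarrow> F x = 0"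
  shows "integrable lebesgue F"
proof (rule Bochner_Integration.integrable_bound)
  show "integrable lebesgue (\<lambda>x. M *\<^sub>R norm (indicator (cball 0 r) x *\<^sub>R f x))"
    using assms(1) unfolding locally_integrable_def set_integrable_def
    by (intro integrable_scaleR_right integrable_norm) auto
  show "AE x in lebesgue. norm (F x) \<le> norm (M *\<^sub>R norm (indicator (cball 0 r) x *\<^sub>R f x))"
  proof (rule AE_I2)
    show "norm (F x) \<le> norm (M *\<^sub>R norm (indicator (cball 0 r) x *\<^sub>R f x))" for x
      using assms(3)[of x] assms(4)[of x] by (cases "norm x \<le> r") auto
  qed
qed (use assms in auto)

lemma test_mult_integrable:
  fixes f :: "real^3 \<Rightarrow> 'b::{banach, second_countable_topology}"
  assumes "locally_integrable f" "\<eta> \<in> test_functions"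
  shows "integrable lebesgue (\<lambda>x. \<eta> x *\<^sub>R f x)"
proof -
  note C = test_functions_C1c[OF assms(2)]
  obtain r M where "\<And>x. \<bar>\<eta> x\<bar> \<le> M" "\<And>x. norm x > r \<Longrightarrow> \<eta> x = 0" using C1c_bounds[OF C] by metis
  then show ?thesis
    using locally_integrable_measurable[OF assms(1)] C1c_measurable_lebesgue[OF C]
    by (intro locally_integrable_mult_bounded[OF assms(1), of _ M r])
      (auto intro!: mult_right_mono borel_measurable_scaleR)
qed

lemma test_grad_integrable:
  assumes "locally_integrable u" "\<eta> \<in> test_functions"
  shows "integrable lebesgue (\<lambda>x. u x *\<^sub>R classical_grad \<eta> x)"
proof -
  note C = test_functions_C1c[OF assms(2)]
  obtain r M where M: "\<And>x. norm (classical_grad \<eta> x) \<le> M" "\<And>x. norm x > r \<Longrightarrow> classical_grad \<eta> x = 0"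
    using C1c_bounds[OF C] by metis
  show ?thesis
  proof (rule locally_integrable_mult_bounded[OF assms(1)])
    show "norm (u x *\<^sub>R classical_grad \<eta> x) \<le> M * norm (u x)" for x
      using mult_left_mono[OF M(1)[of x], of "\<bar>u x\<bar>"] by (simp add: mult.commute)
  qed (use M(2) locally_integrable_measurable[OF assms(1)] C1c_grad_measurable_lebesgue[OF C] in
      \<open>auto intro!: borel_measurable_scaleR\<close>)
qed

text \<open>The bumps \<open>box_bump a b n\<close> are bounded by 1 and tend to the indicator of
  the box, so dominated convergence turns the test condition into vanishing box integrals.\<close>

lemma fundamental_lemma:
  fixes f :: "real^3 \<Rightarrow> 'b::{banach, second_countable_topology}"
  assumes loc: "locally_integrable f"
    and test: "\<And>\<eta>. \<eta> \<in> test_functions \<Longrightarrow> (\<integral>x. \<eta> x *\<^sub>R f x \<partial>lebesgue) = 0"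
  shows "AE x in lebesgue. f x = 0"
proof -
  note [measurable] = locally_integrable_measurable[OF loc]
  have int: "integrable lebesgue (\<lambda>x. indicator (cbox a b) x *\<^sub>R f x)" for a b
    using loc unfolding locally_integrable_def set_integrable_def by auto
  have box: "(\<integral>x. indicator (box a b) x *\<^sub>R f x \<partial>lebesgue) = 0" for a b
  proof -
    have "(\<lambda>n. \<integral>x. box_bump a b n x *\<^sub>R f x \<partial>lebesgue) \<longlonglongrightarrow> (\<integral>x. indicator (box a b) x *\<^sub>R f x \<partial>lebesgue)"
    proof (rule integral_dominated_convergence)
      show "integrable lebesgue (\<lambda>x. norm (indicator (cbox a b) x *\<^sub>R f x))"
        using int by (rule integrable_norm)
      show "AE x in lebesgue. norm (box_bump a b n x *\<^sub>R f x) \<le> norm (indicator (cbox a b) x *\<^sub>R f x)" for n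
      proof (rule AE_I2)
        show "norm (box_bump a b n x *\<^sub>R f x) \<le> norm (indicator (cbox a b) x *\<^sub>R f x)" for x
          using box_bump_nonneg[of a b n x] box_bump_le_1[of a b n x] box_bump_eq_0[of x a b n] box_subset_cbox[of a b]
          by (cases "x \<in> box a b") (auto simp: subset_iff intro: mult_left_le_one_le)
      qed
      show "AE x in lebesgue. (\<lambda>n. box_bump a b n x *\<^sub>R f x) \<longlonglongrightarrow> indicator (box a b) x *\<^sub>R f x"
        by (intro AE_I2 tendsto_scaleR box_bump_tendsto tendsto_const)
      show "(\<lambda>x. box_bump a b n x *\<^sub>R f x) \<in> borel_measurable lebesgue" for n
        by (intro borel_measurable_integrable test_mult_integrable loc box_bump_test)
      show "(\<lambda>x. indicator (box a b) x *\<^sub>R f x) \<in> borel_measurable lebesgue"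
        by (intro borel_measurable_scaleR borel_measurable_indicator locally_integrable_measurable loc) simp
    qed
    then show ?thesis using test[OF box_bump_test] by (simp add: LIMSEQ_const_iff)
  qed
  \<comment> \<open>Only local integrability is available, so \<open>f\<close> is truncated to boxes
    that exhaust the space. An intersection of two boxes is a box, so the box integrals of the
    truncations vanish too.\<close>
  have "AE x in lebesgue. indicator (box (- (real n *\<^sub>R One)) (real n *\<^sub>R One)) x *\<^sub>R f x = 0" for n
  proof (rule AE_zero_if_box_integrals_zero)
    let ?B = "box (- (real n *\<^sub>R One)) (real n *\<^sub>R One) :: (real^3) set"
    have B: "?B \<in> sets lebesgue" by simp
    show "integrable lebesgue (\<lambda>x. indicator ?B x *\<^sub>R f x)"
      using integrable_mult_indicator[OF B int[of "- (real n *\<^sub>R One)" "real n *\<^sub>R One"]]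
      by (rule Bochner_Integration.integrable_cong[THEN iffD1, rotated -1])
        (auto simp: indicator_def dest: subsetD[OF box_subset_cbox])
    show "(\<integral>x. indicator (box a b) x *\<^sub>R indicator ?B x *\<^sub>R f x \<partial>lebesgue) = 0" for a b
    proof -
      obtain a' b' where "box a b \<inter> ?B = box a' b'" using box_Int_box by blast
      then have "indicator (box a b) x *\<^sub>R indicator ?B x *\<^sub>R f x = indicator (box a' b') x *\<^sub>R f x" for x
        by (metis (no_types) indicator_inter_arith scaleR_scaleR)
      then show ?thesis using box[of a' b'] by (simp only:)
    qed
    show "indicator ?B x *\<^sub>R f x = 0" if "x \<notin> ?B" for x
      by (simp only: indicator_simps(2)[OF that] scaleR_zero_left)
  qed
  then have "AE x in lebesgue. \<forall>n::nat. indicator (box (- (real n *\<^sub>R One)) (real n *\<^sub>R One)) x *\<^sub>R f x = 0"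
    unfolding AE_all_countable by blast
  then show ?thesis
  proof eventually_elim
    case (elim x)
    have "x \<in> (\<Union>n::nat. box (- (real n *\<^sub>R One)) (real n *\<^sub>R One))"
      by (simp add: UN_box_eq_UNIV)
    then obtain n :: nat where "x \<in> box (- (real n *\<^sub>R One)) (real n *\<^sub>R One)" by blast
    with elim[rule_format, of n] show "f x = 0"
      by (simp only: indicator_simps(1) scaleR_one)
  qed
qed

lemma has_weak_grad_locally_integrable:
  "has_weak_grad u g \<Longrightarrow> locally_integrable u" "has_weak_grad u g \<Longrightarrow> locally_integrable g"
  by (auto simp: has_weak_grad_def locally_integrable_def)

lemma has_weak_grad_unique:
  assumes "has_weak_grad u g" "has_weak_grad u g'"
  shows "AE x in lebesgue. g x = g' x"
proof -
  note loc = has_weak_grad_locally_integrable(2)[OF assms(1)] has_weak_grad_locally_integrable(2)[OF assms(2)]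
  have "AE x in lebesgue. g x - g' x = 0"
  proof (rule fundamental_lemma)
    show "locally_integrable (\<lambda>x. g x - g' x)"
      using loc unfolding locally_integrable_def set_integrable_def by (simp add: scaleR_diff_right)
    fix \<eta> assume \<eta>: "\<eta> \<in> test_functions"
    then have "(\<integral>x. \<eta> x *\<^sub>R g x \<partial>lebesgue) = (\<integral>x. \<eta> x *\<^sub>R g' x \<partial>lebesgue)"
      using assms unfolding has_weak_grad_def by (metis (no_types, lifting) neg_equal_iff_equal)
    then show "(\<integral>x. \<eta> x *\<^sub>R (g x - g' x) \<partial>lebesgue) = 0"
      using test_mult_integrable[OF loc(1) \<eta>] test_mult_integrable[OF loc(2) \<eta>]
      by (simp add: scaleR_diff_right)
  qed
  then show ?thesis by eventually_elim simp
qed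

text \<open>Allows any explicit weak gradient to replace the arbitrary choice made in
  \<open>weak_grad\<close>, in integrals and almost-everywhere statements.\<close>

lemma weak_grad_AE_eq: "has_weak_grad u g \<Longrightarrow> AE x in lebesgue. weak_grad u x = g x"
  unfolding weak_grad_def by (rule has_weak_grad_unique[OF someI[of "has_weak_grad u"]])

section \<open>Integral norms and completeness of \<open>L\<^sup>2\<close>\<close>

text \<open>The p-th power of the L^p norm. Values in \<open>ennreal\<close> avoid integrability
  side conditions; without the root, Minkowski's inequality is replaced by a triangle inequality
  with the factor 2^p.\<close>

definition Lp_int :: "nat \<Rightarrow> ('a::euclidean_space \<Rightarrow> 'b::real_normed_vector) \<Rightarrow> ennreal" where
  "Lp_int p f = (\<integral>\<^sup>+x. ennreal (norm (f x) ^ p) \<partial>lebesgue)"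

lemma power_add_le:
  fixes a b :: real
  assumes "a \<ge> 0" "b \<ge> 0"
  shows "(a + b) ^ p \<le> 2 ^ p * (a ^ p + b ^ p)"
proof -
  have "(a + b) ^ p \<le> (2 * max a b) ^ p" using assms by (intro power_mono) auto
  also have "\<dots> = 2 ^ p * max a b ^ p" by (rule power_mult_distrib)
  also have "max a b ^ p \<le> a ^ p + b ^ p" using assms by (auto simp: max_def)
  finally show ?thesis by simp
qed

lemma Lp_int_add:
  fixes f g :: "'a::euclidean_space \<Rightarrow> 'b::{real_normed_vector, second_countable_topology}"
  assumes [measurable]: "f \<in> borel_measurable lebesgue" "g \<in> borel_measurable lebesgue"
  shows "Lp_int p (\<lambda>x. f x + g x) \<le> 2 ^ p * (Lp_int p f + Lp_int p g)"
proof -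
  have "Lp_int p (\<lambda>x. f x + g x) \<le> (\<integral>\<^sup>+x. 2 ^ p * (ennreal (norm (f x) ^ p) + ennreal (norm (g x) ^ p)) \<partial>lebesgue)"
    unfolding Lp_int_def
  proof (rule nn_integral_mono)
    fix x
    have "norm (f x + g x) ^ p \<le> (norm (f x) + norm (g x)) ^ p"
      by (intro power_mono norm_triangle_ineq) auto
    also have "\<dots> \<le> 2 ^ p * (norm (f x) ^ p + norm (g x) ^ p)" by (rule power_add_le) auto
    finally have "ennreal (norm (f x + g x) ^ p) \<le> ennreal (2 ^ p * (norm (f x) ^ p + norm (g x) ^ p))"
      by (rule ennreal_leI)
    also have "\<dots> = 2 ^ p * (ennreal (norm (f x) ^ p) + ennreal (norm (g x) ^ p))"
      by (simp add: ennreal_mult ennreal_plus flip: ennreal_power)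
    finally show "ennreal (norm (f x + g x) ^ p) \<le> \<dots>" .
  qed
  also have "\<dots> = 2 ^ p * (Lp_int p f + Lp_int p g)"
    unfolding Lp_int_def by (subst nn_integral_cmult, measurable, subst nn_integral_add, measurable)
  finally show ?thesis .
qed

lemma Lp_int_scaleR:
  fixes f :: "'a::euclidean_space \<Rightarrow> 'b::{real_normed_vector, second_countable_topology}"
  assumes [measurable]: "f \<in> borel_measurable lebesgue"
  shows "Lp_int p (\<lambda>x. c *\<^sub>R f x) = ennreal (\<bar>c\<bar> ^ p) * Lp_int p f"
  unfolding Lp_int_def
  by (subst nn_integral_cmult[symmetric]) (auto simp: power_mult_distrib ennreal_mult intro!: nn_integral_cong)

lemma Lp_int_cong_AE: "AE x in lebesgue. f x = g x \<Longrightarrow> Lp_int p f = Lp_int p g"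
  unfolding Lp_int_def by (rule nn_integral_cong_AE) auto

lemma Lp_int_minus_commute: "Lp_int p (\<lambda>x. f x - g x) = Lp_int p (\<lambda>x. g x - f x)"
  unfolding Lp_int_def by (simp add: norm_minus_commute)

text \<open>If t exceeds \<delta>, then t^p is at least t times \<delta>^(p-1). This elementary
  bound takes the place of Hoelder's inequality when local L^1 integrals are estimated by L^p
  ones.\<close>

lemma le_delta_plus_power:
  fixes t \<delta> :: real
  assumes "\<delta> > 0" "t \<ge> 0" "p \<ge> 1"
  shows "t \<le> \<delta> + t ^ p / \<delta> ^ (p - 1)"
proof (cases "t \<le> \<delta>")
  case False
  have "t * \<delta> ^ (p - 1) \<le> t * t ^ (p - 1)"
    using assms False by (intro mult_left_mono power_mono) auto
  also have "\<dots> = t ^ p" using assms by (simp add: power_eq_if)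
  finally have "t \<le> t ^ p / \<delta> ^ (p - 1)" using assms by (simp add: field_simps)
  then show ?thesis using assms by simp
qed (use assms in \<open>simp add: add_increasing2\<close>)

text \<open>The free parameter \<delta> is fixed small first, relative to the measure of
  \<open>K\<close>; the second term is then made small through \<open>Lp_int p h\<close>.\<close>

lemma Lp_int_local_bound:
  fixes h :: "'a::euclidean_space \<Rightarrow> 'b::{real_normed_vector, second_countable_topology}"
  assumes [measurable]: "h \<in> borel_measurable lebesgue" "K \<in> sets lebesgue"
    and "\<delta> > 0" "p \<ge> 1"
  shows "(\<integral>\<^sup>+x. ennreal (norm (h x)) * indicator K x \<partial>lebesgue)
    \<le> ennreal \<delta> * emeasure lebesgue K + ennreal (1 / \<delta> ^ (p - 1)) * Lp_int p h"
proof -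
  have "(\<integral>\<^sup>+x. ennreal (norm (h x)) * indicator K x \<partial>lebesgue) \<le>
      (\<integral>\<^sup>+x. ennreal \<delta> * indicator K x + ennreal (1 / \<delta> ^ (p - 1)) * ennreal (norm (h x) ^ p) \<partial>lebesgue)"
  proof (rule nn_integral_mono)
    fix x
    have "ennreal (norm (h x)) \<le> ennreal (\<delta> + norm (h x) ^ p / \<delta> ^ (p - 1))"
      using le_delta_plus_power[of \<delta> "norm (h x)" p] assms by (intro ennreal_leI) auto
    also have "\<dots> = ennreal \<delta> + ennreal (1 / \<delta> ^ (p - 1)) * ennreal (norm (h x) ^ p)"
      using assms by (simp add: ennreal_plus flip: ennreal_mult)
    finally show "ennreal (norm (h x)) * indicator K x \<le> ennreal \<delta> * indicator K x + ennreal (1 / \<delta> ^ (p - 1)) * ennreal (norm (h x) ^ p)"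
      by (cases "x \<in> K") auto
  qed
  also have "\<dots> = ennreal \<delta> * emeasure lebesgue K + ennreal (1 / \<delta> ^ (p - 1)) * Lp_int p h"
    unfolding Lp_int_def
    by (subst nn_integral_add, measurable, subst nn_integral_cmult, measurable, subst nn_integral_cmult_indicator, auto)
  finally show ?thesis .
qed

lemma Lp_int_finite_locally_integrable:
  fixes f :: "real^3 \<Rightarrow> 'b::{banach, second_countable_topology}"
  assumes m [measurable]: "f \<in> borel_measurable lebesgue" and fin: "Lp_int p f < \<infinity>" and p: "p \<ge> 1"
  shows "locally_integrable f"
  unfolding locally_integrable_def set_integrable_def
proof (intro allI impI)
  fix K :: "(real^3) set" assume K: "compact K"
  then have [measurable]: "K \<in> sets lebesgue" by (simp add: compact_imp_closed)
  have "emeasure lebesgue K < \<infinity>"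
    using K emeasure_bounded_finite[OF compact_imp_bounded[OF K]] by (simp add: compact_imp_closed)
  then have "(\<integral>\<^sup>+x. ennreal (norm (f x)) * indicator K x \<partial>lebesgue) < \<infinity>"
    using Lp_int_local_bound[of f K 1 p] fin p
    by (auto simp: le_less_trans)
  moreover have "ennreal (norm (indicator K x *\<^sub>R f x)) = ennreal (norm (f x)) * indicator K x" for x
    by (simp add: indicator_def)
  ultimately have "(\<integral>\<^sup>+x. ennreal (norm (indicator K x *\<^sub>R f x)) \<partial>lebesgue) < \<infinity>"
    by simp
  then show "integrable lebesgue (\<lambda>x. indicator K x *\<^sub>R f x)"
    by (intro integrableI_bounded) auto
qed

text \<open>Made for the limit in the definition of a weak gradient: \<open>F n\<close> will be
  \<open>h n\<close> times a test function or the gradient of one, hence dominated by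
  \<open>h n\<close> and supported in a fixed ball.\<close>

lemma Lp_int_tendsto_local:
  fixes h :: "nat \<Rightarrow> real^3 \<Rightarrow> 'b::{real_normed_vector, second_countable_topology}"
    and F :: "nat \<Rightarrow> real^3 \<Rightarrow> 'c::{banach, second_countable_topology}"
  assumes m [measurable]: "\<And>n. h n \<in> borel_measurable lebesgue"
    and lim: "(\<lambda>n. Lp_int p (h n)) \<longlonglongrightarrow> 0" and p: "p \<ge> 1"
    and F: "\<And>n. integrable lebesgue (F n)" "\<And>n x. norm (F n x) \<le> M * norm (h n x)" "\<And>n x. norm x > r \<Longrightarrow> F n x = 0"
    and M: "M \<ge> 0"
  shows "(\<lambda>n. \<integral>x. F n x \<partial>lebesgue) \<longlonglongrightarrow> 0"
proof (rule LIMSEQ_I)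
  fix e :: real assume e: "e > 0"
  let ?K = "cball (0::real^3) r"
  have [measurable]: "?K \<in> sets lebesgue" by simp
  define k where "k = measure lebesgue ?K"
  have "emeasure lebesgue ?K < \<infinity>"
    using emeasure_bounded_finite[of ?K] by simp
  then have k: "emeasure lebesgue ?K = ennreal k" "k \<ge> 0"
    unfolding k_def by (simp_all add: emeasure_eq_ennreal_measure)
  \<comment> \<open>Chosen so that \<open>M * (\<delta> * k)\<close> is at most e/2; the added ones
    keep the denominator positive when \<open>M\<close> or \<open>k\<close> is 0.\<close>
  define \<delta> where "\<delta> = e / (2 * (M + 1) * (k + 1))"
  have \<delta>: "\<delta> > 0" using e k M by (simp add: \<delta>_def)
  let ?b = "\<lambda>n. ennreal M * (ennreal \<delta> * ennreal k + ennreal (1 / \<delta> ^ (p - 1)) * Lp_int p (h n))"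
  have "?b \<longlonglongrightarrow> ennreal M * (ennreal \<delta> * ennreal k + ennreal (1 / \<delta> ^ (p - 1)) * 0)"
    by (intro ennreal_tendsto_cmult tendsto_add tendsto_const lim) auto
  moreover have "ennreal M * (ennreal \<delta> * ennreal k + ennreal (1 / \<delta> ^ (p - 1)) * 0) < ennreal e"
  proof -
    have "M * (\<delta> * k) < e"
    proof -
      have "M * (\<delta> * k) \<le> (M + 1) * (\<delta> * (k + 1))"
        using M k \<delta> by (intro mult_mono) auto
      also have "\<dots> = e / 2"
      proof -
        have "M + 1 \<noteq> 0" "k + 1 \<noteq> 0" using M k by auto
        then show ?thesis unfolding \<delta>_def by (simp add: divide_simps)
      qed
      finally show ?thesis using e by simp
    qed
    then show ?thesis using M k \<delta> e by (simp add: ennreal_lessI flip: ennreal_mult)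
  qed
  ultimately have "eventually (\<lambda>n. ?b n < ennreal e) sequentially" by (rule order_tendstoD)
  then obtain N where N: "\<And>n. n \<ge> N \<Longrightarrow> ?b n < ennreal e" by (auto simp: eventually_sequentially)
  have "norm (\<integral>x. F n x \<partial>lebesgue) < e" if "n \<ge> N" for n
  proof -
    have "ennreal (norm (\<integral>x. F n x \<partial>lebesgue)) \<le> (\<integral>\<^sup>+x. ennreal (norm (F n x)) \<partial>lebesgue)"
      by (rule integral_norm_bound_ennreal[OF F(1)])
    also have "\<dots> \<le> (\<integral>\<^sup>+x. ennreal M * (ennreal (norm (h n x)) * indicator ?K x) \<partial>lebesgue)"
    proof (rule nn_integral_mono)
      fix x :: "real^3"
      show "ennreal (norm (F n x)) \<le> ennreal M * (ennreal (norm (h n x)) * indicator ?K x)"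
        using F(2)[of n x] F(3)[of x n] M
        by (cases "norm x \<le> r") (auto simp: ennreal_mult[symmetric] intro!: ennreal_leI)
    qed
    also have "\<dots> = ennreal M * (\<integral>\<^sup>+x. ennreal (norm (h n x)) * indicator ?K x \<partial>lebesgue)"
      by (rule nn_integral_cmult) measurable
    also have "\<dots> \<le> ?b n"
      using Lp_int_local_bound[OF m, of ?K \<delta> p n] p \<delta> k by (intro mult_left_mono) auto
    also have "\<dots> < ennreal e" using N that by simp
    finally show ?thesis by (simp add: ennreal_less_iff)
  qed
  then show "\<exists>N. \<forall>n\<ge>N. norm ((\<integral>x. F n x \<partial>lebesgue) - 0) < e" by auto
qed

section \<open>Fatou's lemma and completeness of L^2\<close>

lemma nn_integral_Fatou_le:
  assumes [measurable]: "\<And>k::nat. f k \<in> borel_measurable M"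
    and lim: "AE x in M. (\<lambda>k. f k x) \<longlonglongrightarrow> (g x :: real)"
    and le: "eventually (\<lambda>k. (\<integral>\<^sup>+x. ennreal (f k x) \<partial>M) \<le> c k) sequentially" and c: "c \<longlonglongrightarrow> C"
  shows "(\<integral>\<^sup>+x. ennreal (g x) \<partial>M) \<le> C"
proof -
  have "(\<integral>\<^sup>+x. ennreal (g x) \<partial>M) = (\<integral>\<^sup>+x. liminf (\<lambda>k. ennreal (f k x)) \<partial>M)"
  proof (rule nn_integral_cong_AE)
    show "AE x in M. ennreal (g x) = liminf (\<lambda>k. ennreal (f k x))"
      using lim
    proof eventually_elim
      case (elim x)
      then have "(\<lambda>k. ennreal (f k x)) \<longlonglongrightarrow> ennreal (g x)" by (rule tendsto_ennrealI)
      then show ?case by (simp add: lim_imp_Liminf)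
    qed
  qed
  also have "\<dots> \<le> liminf (\<lambda>k. \<integral>\<^sup>+x. ennreal (f k x) \<partial>M)"
    by (rule nn_integral_liminf) measurable
  also have "\<dots> \<le> liminf c"
    using le by (rule Liminf_mono)
  also have "\<dots> = C" using c by (simp add: lim_imp_Liminf)
  finally show ?thesis .
qed

definition L2_Cauchy :: "(nat \<Rightarrow> 'a::euclidean_space \<Rightarrow> 'b::real_normed_vector) \<Rightarrow> bool" where
  "L2_Cauchy g \<longleftrightarrow> (\<forall>e>0. \<exists>N. \<forall>m\<ge>N. \<forall>n\<ge>N. Lp_int 2 (\<lambda>x. g m x - g n x) < ennreal e)"

lemma sum_half_powers: "(\<Sum>k. ennreal ((1/2) ^ k)) = 2"
proof -
  have "(\<lambda>k. (1/2::real) ^ k) sums 2" using geometric_sums[of "1/2::real"] by simp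
  then have "(\<Sum>k. ennreal ((1/2) ^ k)) = ennreal 2"
    by (subst suminf_ennreal_eq[of _ 2]) auto
  then show ?thesis by simp
qed

text \<open>A subsequence with \<open>\<integral>\<bar>g\<^bsub>s(k+1)\<^esub> - g\<^bsub>s(k)\<^esub>\<bar>\<^sup>2 < 4\<^sup>-\<^sup>k\<close> makes
  \<open>\<Sum>\<^sub>k 2\<^sup>k \<bar>g\<^bsub>s(k+1)\<^esub> - g\<^bsub>s(k)\<^esub>\<bar>\<^sup>2\<close> integrable, so that the increments decay geometrically almost everywhere.\<close>

lemma L2_complete:
  fixes g :: "nat \<Rightarrow> 'a::euclidean_space \<Rightarrow> 'b::{banach, second_countable_topology}"
  assumes m [measurable]: "\<And>n. g n \<in> borel_measurable lebesgue" and cau: "L2_Cauchy g"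
  obtains G s where "G \<in> borel_measurable lebesgue" "strict_mono s"
    "AE x in lebesgue. (\<lambda>k. g (s k) x) \<longlonglongrightarrow> G x"
    "(\<lambda>n. Lp_int 2 (\<lambda>x. g n x - G x)) \<longlonglongrightarrow> 0"
proof -
  have "\<forall>k::nat. \<exists>N. \<forall>m\<ge>N. \<forall>n\<ge>N. Lp_int 2 (\<lambda>x. g m x - g n x) < ennreal ((1/4) ^ k)"
    using cau unfolding L2_Cauchy_def by simp
  then obtain N where N: "\<And>k m n. m \<ge> N k \<Longrightarrow> n \<ge> N k \<Longrightarrow> Lp_int 2 (\<lambda>x. g m x - g n x) < ennreal ((1/4) ^ k)"
    by metis
  \<comment> \<open>The sum makes \<open>s\<close> strictly increasing while keeping
    \<open>s k\<close> at least \<open>N k\<close>.\<close>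
  define s where "s k = k + (\<Sum>i\<le>k. N i)" for k
  have s: "strict_mono s" unfolding s_def by (rule strict_mono_Suc_iff[THEN iffD2]) simp
  have sN: "s k \<ge> N k" for k
    unfolding s_def using member_le_sum[of k "{..k}" N] by simp
  define d where "d k x = norm (g (s (Suc k)) x - g (s k) x)" for k x
  have d [measurable]: "d k \<in> borel_measurable lebesgue" for k unfolding d_def by measurable
  have step: "(\<integral>\<^sup>+x. ennreal (2 ^ k * d k x ^ 2) \<partial>lebesgue) \<le> ennreal ((1/2) ^ k)" for k
  proof -
    have "s (Suc k) \<ge> N k" using sN[of k] strict_monoD[OF s, of k "Suc k"] by simp
    then have "Lp_int 2 (\<lambda>x. g (s (Suc k)) x - g (s k) x) \<le> ennreal ((1/4) ^ k)"
      using N[of k "s (Suc k)" "s k"] sN[of k] by simp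
    then have "ennreal (2 ^ k) * (\<integral>\<^sup>+x. ennreal (d k x ^ 2) \<partial>lebesgue) \<le> ennreal (2 ^ k) * ennreal ((1/4) ^ k)"
      unfolding Lp_int_def d_def by (intro mult_left_mono) auto
    also have "\<dots> = ennreal ((1/2) ^ k)" by (simp add: ennreal_mult[symmetric] power_mult_distrib[symmetric])
    finally show ?thesis by (simp add: nn_integral_cmult[symmetric] ennreal_mult)
  qed
  have "(\<integral>\<^sup>+x. (\<Sum>k. ennreal (2 ^ k * d k x ^ 2)) \<partial>lebesgue) = (\<Sum>k. \<integral>\<^sup>+x. ennreal (2 ^ k * d k x ^ 2) \<partial>lebesgue)"
    by (rule nn_integral_suminf) measurable
  also have "\<dots> \<le> (\<Sum>k. ennreal ((1/2) ^ k))" by (intro suminf_le step) auto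
  also have "\<dots> < \<infinity>" by (simp add: sum_half_powers)
  finally have "AE x in lebesgue. (\<Sum>k. ennreal (2 ^ k * d k x ^ 2)) \<noteq> \<infinity>"
    by (intro nn_integral_PInf_AE) auto
  then have conv: "AE x in lebesgue. convergent (\<lambda>k. g (s k) x)"
  proof eventually_elim
    case (elim x)
    define F where "F k = ennreal (2 ^ k * d k x ^ 2)" for k
    define S where "S = enn2real (suminf F)"
    have F: "suminf F = ennreal S"
      using elim unfolding S_def F_def by (simp add: less_top)
    have S: "2 ^ k * d k x ^ 2 \<le> S" for k
    proof -
      have "sum F {k} \<le> suminf F" by (rule sum_le_suminf) auto
      then have "ennreal (2 ^ k * d k x ^ 2) \<le> ennreal S" unfolding F by (simp add: F_def)
      then show ?thesis by (subst (asm) ennreal_le_iff) (auto simp: S_def)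
    qed
    have "d k x \<le> sqrt S * sqrt (1/2) ^ k" for k
    proof -
      have "d k x ^ 2 \<le> S * (1/2) ^ k" using S[of k] by (simp add: field_simps power_one_over)
      then have "sqrt (d k x ^ 2) \<le> sqrt (S * (1/2) ^ k)" by (rule real_sqrt_le_mono)
      then show ?thesis by (simp add: d_def real_sqrt_mult real_sqrt_power)
    qed
    then have "norm (norm (g (s (Suc k)) x - g (s k) x)) \<le> sqrt S * sqrt (1/2) ^ k" for k
      by (simp add: d_def)
    moreover have "summable (\<lambda>k. sqrt S * sqrt (1/2) ^ k)"
      by (intro summable_mult summable_geometric) simp
    ultimately have "summable (\<lambda>k. norm (g (s (Suc k)) x - g (s k) x))"
      by (rule summable_comparison_test'[rotated])
    then have "summable (\<lambda>k. g (s (Suc k)) x - g (s k) x)" by (rule summable_norm_cancel)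
    then have "convergent (\<lambda>n. \<Sum>k<n. g (s (Suc k)) x - g (s k) x)" by (simp add: summable_iff_convergent)
    then have "convergent (\<lambda>n. g (s n) x - g (s 0) x)"
      by (simp add: sum_lessThan_telescope[of "\<lambda>k. g (s k) x"])
    from convergent_add[OF this convergent_const[of "g (s 0) x"]] show ?case by simp
  qed
  define G where "G x = lim (\<lambda>k. g (s k) x)" for x
  have G [measurable]: "G \<in> borel_measurable lebesgue" unfolding G_def by measurable
  have lim: "AE x in lebesgue. (\<lambda>k. g (s k) x) \<longlonglongrightarrow> G x"
    using conv by eventually_elim (simp add: G_def convergent_LIMSEQ_iff)
  have "(\<lambda>n. Lp_int 2 (\<lambda>x. g n x - G x)) \<longlonglongrightarrow> 0"
  proof (rule order_tendstoI)
    fix a :: ennreal assume "0 < a"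
    then obtain e where e: "0 < e" "ennreal e < a"
      by (metis ennreal_less_zero_iff ennreal_cases dense infinity_ennreal_def less_top_ennreal order_less_trans)
    then obtain N where N: "\<And>m n. m \<ge> N \<Longrightarrow> n \<ge> N \<Longrightarrow> Lp_int 2 (\<lambda>x. g m x - g n x) < ennreal e"
      using cau unfolding L2_Cauchy_def by blast
    have "Lp_int 2 (\<lambda>x. g n x - G x) \<le> ennreal e" if "n \<ge> N" for n
      unfolding Lp_int_def
    proof (rule nn_integral_Fatou_le)
      show "AE x in lebesgue. (\<lambda>k. norm (g n x - g (s k) x) ^ 2) \<longlonglongrightarrow> norm (g n x - G x) ^ 2"
        using lim by eventually_elim (intro tendsto_intros)
      show "eventually (\<lambda>k. (\<integral>\<^sup>+x. ennreal ((norm (g n x - g (s k) x))\<^sup>2) \<partial>lebesgue) \<le> ennreal e) sequentially"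
        unfolding eventually_sequentially
      proof (intro exI allI impI)
        fix k assume "k \<ge> N"
        then have "s k \<ge> N" using seq_suble[OF s, of k] by simp
        then show "(\<integral>\<^sup>+x. ennreal ((norm (g n x - g (s k) x))\<^sup>2) \<partial>lebesgue) \<le> ennreal e"
          using N[OF that, of "s k"] by (simp add: Lp_int_def)
      qed
    qed auto
    then show "eventually (\<lambda>n. Lp_int 2 (\<lambda>x. g n x - G x) < a) sequentially"
      unfolding eventually_sequentially using e(2) by (meson order_le_less_trans)
  qed simp
  then show ?thesis using that G s lim by blast
qed

section \<open>Approximation by test functions\<close>

lemma Lp_int_finite_bounded_support:
  fixes f :: "real^3 \<Rightarrow> 'b::{banach, second_countable_topology}"
  assumes "f \<in> borel_measurable borel" "\<And>x. norm (f x) \<le> M" "\<And>x. norm x > r \<Longrightarrow> f x = 0" "p \<ge> 1"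
  shows "integrable lborel (\<lambda>x. norm (f x) ^ p)" "Lp_int p f = ennreal (\<integral>x. norm (f x) ^ p \<partial>lborel)"
    "Lp_int p f < \<infinity>"
proof -
  note [measurable] = assms(1)
  show i: "integrable lborel (\<lambda>x. norm (f x) ^ p)"
    by (rule integrable_bounded_cball[where r = r and M = "M ^ p"]) (use assms in \<open>auto intro: power_mono\<close>)
  show e: "Lp_int p f = ennreal (\<integral>x. norm (f x) ^ p \<partial>lborel)"
    unfolding Lp_int_def nn_integral_completion using i by (intro nn_integral_eq_integral) auto
  then show "Lp_int p f < \<infinity>" by simp
qed

lemma C1c_Lp_int_finite:
  assumes "C1c f" "p \<ge> 1"
  shows "Lp_int p f < \<infinity>" "Lp_int p (classical_grad f) < \<infinity>"
proof -
  obtain r M where M: "\<And>x. \<bar>f x\<bar> \<le> M" "\<And>x. norm (classical_grad f x) \<le> M"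
    "\<And>x. norm x > r \<Longrightarrow> f x = 0" "\<And>x. norm x > r \<Longrightarrow> classical_grad f x = 0"
    using C1c_bounds[OF assms(1)] by metis
  show "Lp_int p f < \<infinity>"
    by (rule Lp_int_finite_bounded_support(3)[OF C1c_measurable[OF assms(1)], where M = M and r = r])
      (use M assms in auto)
  show "Lp_int p (classical_grad f) < \<infinity>"
    by (rule Lp_int_finite_bounded_support(3)[OF C1c_grad_measurable[OF assms(1)], where M = M and r = r])
      (use M assms in auto)
qed

lemma C1c_locally_integrable:
  assumes "C1c f"
  shows "locally_integrable f" "locally_integrable (classical_grad f)"
  using C1c_Lp_int_finite[OF assms, of 1] C1c_measurable_lebesgue[OF assms] C1c_grad_measurable_lebesgue[OF assms]
  by (auto intro: Lp_int_finite_locally_integrable[where p = 1])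

lemma dirichlet_norm_Lp_int:
  assumes "C1c f"
  shows "Lp_int 2 (classical_grad f) = ennreal (dirichlet_norm f ^ 2)"
proof -
  obtain r M where M: "\<And>x. norm (classical_grad f x) \<le> M" "\<And>x. norm x > r \<Longrightarrow> classical_grad f x = 0"
    using C1c_bounds[OF assms] by metis
  note [measurable] = C1c_grad_measurable[OF assms]
  have "Lp_int 2 (classical_grad f) = ennreal (\<integral>x. norm (classical_grad f x) ^ 2 \<partial>lborel)"
    by (rule Lp_int_finite_bounded_support(2)[OF C1c_grad_measurable[OF assms], where M = M and r = r])
      (use M in auto)
  also have "(\<integral>x. norm (classical_grad f x) ^ 2 \<partial>lborel) = dirichlet_norm f ^ 2"
    unfolding dirichlet_norm_def by (subst integral_completion) (auto simp: real_sqrt_pow2)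
  finally show ?thesis .
qed

text \<open>\<open>D12\<close> with the gradient made explicit: one sequence of test functions
  approximates \<open>u\<close> in L^6 and has gradients tending to \<open>g\<close> in L^2. Sums
  and limits of such pairs can be formed without touching the choice in \<open>weak_grad\<close>;
  \<open>D12_imp_D12g\<close> and \<open>D12g_imp_D12\<close> link the two notions.\<close>

definition D12g :: "(real^3 \<Rightarrow> real) \<Rightarrow> (real^3 \<Rightarrow> real^3) \<Rightarrow> bool" where
  "D12g u g \<longleftrightarrow> u \<in> borel_measurable lebesgue \<and> g \<in> borel_measurable lebesgue \<and> Lp_int 2 g < \<infinity> \<and>
     (\<exists>f. (\<forall>n. f n \<in> test_functions) \<and>
        (\<lambda>n. Lp_int 6 (\<lambda>x. f n x - u x)) \<longlonglongrightarrow> 0 \<and>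
        (\<lambda>n. Lp_int 2 (\<lambda>x. classical_grad (f n) x - g x)) \<longlonglongrightarrow> 0)"

lemma Lp_int_add_finite:
  fixes f g :: "'a::euclidean_space \<Rightarrow> 'b::{real_normed_vector, second_countable_topology}"
  assumes "f \<in> borel_measurable lebesgue" "g \<in> borel_measurable lebesgue" "Lp_int p f < \<infinity>" "Lp_int p g < \<infinity>"
  shows "Lp_int p (\<lambda>x. f x + g x) < \<infinity>"
proof -
  have "(2 ^ p :: ennreal) * (Lp_int p f + Lp_int p g) < \<infinity>"
    using assms(3,4) by (simp add: ennreal_mult_less_top power_less_top_ennreal)
  then show ?thesis using Lp_int_add[OF assms(1,2)] by (rule le_less_trans[rotated])
qed

lemma tendsto_0_finite:
  fixes X :: "nat \<Rightarrow> ennreal"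
  assumes "X \<longlonglongrightarrow> 0"
  obtains n where "X n < \<infinity>"
proof -
  have "eventually (\<lambda>n. X n < \<infinity>) sequentially" using assms by (rule order_tendstoD) simp
  then show ?thesis using that by (auto simp: eventually_sequentially)
qed

lemma D12g_measurable:
  assumes "D12g u g"
  shows "u \<in> borel_measurable lebesgue" "g \<in> borel_measurable lebesgue" "Lp_int 2 g < \<infinity>"
  using assms by (auto simp: D12g_def)

lemma D12g_Lp_int_6_finite:
  assumes "D12g u g"
  shows "Lp_int 6 u < \<infinity>"
proof -
  obtain f where f: "\<And>n. f n \<in> test_functions" and lim: "(\<lambda>n. Lp_int 6 (\<lambda>x. f n x - u x)) \<longlonglongrightarrow> 0"
    using assms unfolding D12g_def by blast
  obtain n where n: "Lp_int 6 (\<lambda>x. f n x - u x) < \<infinity>" using tendsto_0_finite[OF lim] .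
  note C = test_functions_C1c[OF f]
  have "Lp_int 6 (\<lambda>x. f n x + (u x - f n x)) < \<infinity>"
    by (rule Lp_int_add_finite)
      (use n C1c_Lp_int_finite(1)[OF C, of 6] C1c_measurable_lebesgue[OF C] D12g_measurable[OF assms] in
        \<open>auto simp: Lp_int_minus_commute[of 6 u]\<close>)
  then show ?thesis by simp
qed

lemma D12g_locally_integrable:
  assumes "D12g u g"
  shows "locally_integrable u" "locally_integrable g"
  using D12g_measurable[OF assms] D12g_Lp_int_6_finite[OF assms]
  by (auto intro: Lp_int_finite_locally_integrable[where p = 6] Lp_int_finite_locally_integrable[where p = 2])

lemma locally_integrable_diff:
  "locally_integrable f \<Longrightarrow> locally_integrable g \<Longrightarrow> locally_integrable (\<lambda>x. f x - g x)"
  unfolding locally_integrable_def set_integrable_def by (simp add: scaleR_diff_right)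

text \<open>Integration by parts holds for each approximating test function, and both of its sides
  converge because test functions and their gradients are bounded with bounded support.\<close>

lemma D12g_has_weak_grad:
  assumes "D12g u g"
  shows "has_weak_grad u g"
proof -
  note loc = D12g_locally_integrable[OF assms] and meas = D12g_measurable[OF assms]
  obtain f where f: "\<And>n. f n \<in> test_functions" and lim6: "(\<lambda>n. Lp_int 6 (\<lambda>x. f n x - u x)) \<longlonglongrightarrow> 0"
    and lim2: "(\<lambda>n. Lp_int 2 (\<lambda>x. classical_grad (f n) x - g x)) \<longlonglongrightarrow> 0"
    using assms unfolding D12g_def by blast
  note C = test_functions_C1c[OF f]
  have "(\<integral>x. u x *\<^sub>R classical_grad \<eta> x \<partial>lebesgue) = - (\<integral>x. \<eta> x *\<^sub>R g x \<partial>lebesgue)"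
    if \<eta>: "\<eta> \<in> test_functions" for \<eta>
  proof -
    note C\<eta> = test_functions_C1c[OF \<eta>]
    obtain r M where M: "M \<ge> 0" "\<And>x. \<bar>\<eta> x\<bar> \<le> M" "\<And>x. norm (classical_grad \<eta> x) \<le> M"
      "\<And>x. norm x > r \<Longrightarrow> \<eta> x = 0" "\<And>x. norm x > r \<Longrightarrow> classical_grad \<eta> x = 0"
      using C1c_bounds[OF C\<eta>] by metis
    have "(\<lambda>n. \<integral>x. (f n x - u x) *\<^sub>R classical_grad \<eta> x \<partial>lebesgue) \<longlonglongrightarrow> 0"
    proof (rule Lp_int_tendsto_local[OF _ lim6])
      show "(\<lambda>x. f n x - u x) \<in> borel_measurable lebesgue" for n
        using C1c_measurable_lebesgue[OF C] meas by (intro borel_measurable_diff)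
      show "integrable lebesgue (\<lambda>x. (f n x - u x) *\<^sub>R classical_grad \<eta> x)" for n
        by (intro test_grad_integrable \<eta> locally_integrable_diff C1c_locally_integrable C loc)
      show "norm ((f n x - u x) *\<^sub>R classical_grad \<eta> x) \<le> M * norm (f n x - u x)" for n x
        using mult_left_mono[OF M(3)[of x], of "\<bar>f n x - u x\<bar>"] by (simp add: mult.commute)
    qed (use M in auto)
    moreover have "(\<integral>x. (f n x - u x) *\<^sub>R classical_grad \<eta> x \<partial>lebesgue) =
        - (\<integral>x. \<eta> x *\<^sub>R classical_grad (f n) x \<partial>lebesgue) - (\<integral>x. u x *\<^sub>R classical_grad \<eta> x \<partial>lebesgue)" for n
    proof -
      note [measurable] = C1c_measurable[OF C] C1c_measurable[OF C\<eta>] C1c_grad_measurable[OF C] C1c_grad_measurable[OF C\<eta>]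
      have "(\<integral>x. (f n x - u x) *\<^sub>R classical_grad \<eta> x \<partial>lebesgue) =
          (\<integral>x. f n x *\<^sub>R classical_grad \<eta> x \<partial>lebesgue) - (\<integral>x. u x *\<^sub>R classical_grad \<eta> x \<partial>lebesgue)"
        unfolding scaleR_diff_left
        by (intro Bochner_Integration.integral_diff test_grad_integrable \<eta> C1c_locally_integrable C loc)
      also have "(\<integral>x. f n x *\<^sub>R classical_grad \<eta> x \<partial>lebesgue) = (\<integral>x. f n x *\<^sub>R classical_grad \<eta> x \<partial>lborel)"
        by (rule integral_completion) measurable
      also have "\<dots> = - (\<integral>x. \<eta> x *\<^sub>R classical_grad (f n) x \<partial>lborel)"
        by (rule C1c_integration_by_parts[OF C C\<eta>])
      also have "(\<integral>x. \<eta> x *\<^sub>R classical_grad (f n) x \<partial>lborel) = (\<integral>x. \<eta> x *\<^sub>R classical_grad (f n) x \<partial>lebesgue)"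
        by (rule integral_completion[symmetric]) measurable
      finally show ?thesis .
    qed
    ultimately have 1: "(\<lambda>n. - (\<integral>x. \<eta> x *\<^sub>R classical_grad (f n) x \<partial>lebesgue) - (\<integral>x. u x *\<^sub>R classical_grad \<eta> x \<partial>lebesgue)) \<longlonglongrightarrow> 0"
      by (simp only:)
    have "(\<lambda>n. \<integral>x. \<eta> x *\<^sub>R (classical_grad (f n) x - g x) \<partial>lebesgue) \<longlonglongrightarrow> 0"
    proof (rule Lp_int_tendsto_local[OF _ lim2])
      show "(\<lambda>x. classical_grad (f n) x - g x) \<in> borel_measurable lebesgue" for n
        using C1c_grad_measurable_lebesgue[OF C] meas by (intro borel_measurable_diff)
      show "integrable lebesgue (\<lambda>x. \<eta> x *\<^sub>R (classical_grad (f n) x - g x))" for n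
        by (intro test_mult_integrable \<eta> locally_integrable_diff C1c_locally_integrable C loc)
      show "norm (\<eta> x *\<^sub>R (classical_grad (f n) x - g x)) \<le> M * norm (classical_grad (f n) x - g x)" for n x
        using M(2)[of x] by (auto intro: mult_right_mono)
    qed (use M in auto)
    moreover have "(\<integral>x. \<eta> x *\<^sub>R (classical_grad (f n) x - g x) \<partial>lebesgue) =
        (\<integral>x. \<eta> x *\<^sub>R classical_grad (f n) x \<partial>lebesgue) - (\<integral>x. \<eta> x *\<^sub>R g x \<partial>lebesgue)" for n
      unfolding scaleR_diff_right
      by (intro Bochner_Integration.integral_diff test_mult_integrable \<eta> C1c_locally_integrable C loc)
    ultimately have 2: "(\<lambda>n. (\<integral>x. \<eta> x *\<^sub>R classical_grad (f n) x \<partial>lebesgue) - (\<integral>x. \<eta> x *\<^sub>R g x \<partial>lebesgue)) \<longlonglongrightarrow> 0"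
      by (simp only:)
    \<comment> \<open>Adding the two limits cancels the only terms that depend on \<open>n\<close>;
      a constant sequence tending to 0 is 0.\<close>
    have "(\<lambda>n::nat. - (\<integral>x. u x *\<^sub>R classical_grad \<eta> x \<partial>lebesgue) - (\<integral>x. \<eta> x *\<^sub>R g x \<partial>lebesgue)) \<longlonglongrightarrow> 0"
      using tendsto_add[OF 1 2] by simp
    then have "- (\<integral>x. u x *\<^sub>R classical_grad \<eta> x \<partial>lebesgue) - (\<integral>x. \<eta> x *\<^sub>R g x \<partial>lebesgue) = 0"
      by (simp only: LIMSEQ_const_iff)
    then have "- (\<integral>x. u x *\<^sub>R classical_grad \<eta> x \<partial>lebesgue) = (\<integral>x. \<eta> x *\<^sub>R g x \<partial>lebesgue)"
      by (simp only: right_minus_eq)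
    then show ?thesis by (rule minus_equation_iff[THEN iffD1, THEN sym])
  qed
  then show ?thesis using loc unfolding has_weak_grad_def locally_integrable_def by blast
qed

lemma D12g_weak_grad: "D12g u g \<Longrightarrow> AE x in lebesgue. weak_grad u x = g x"
  by (rule weak_grad_AE_eq[OF D12g_has_weak_grad])

lemma has_weak_grad_weak_grad: "has_weak_grad u g \<Longrightarrow> has_weak_grad u (weak_grad u)"
  unfolding weak_grad_def by (rule someI[of "has_weak_grad u"])

lemma Lp_int_tendsto_0_add:
  fixes f g :: "nat \<Rightarrow> 'a::euclidean_space \<Rightarrow> 'b::{real_normed_vector, second_countable_topology}"
  assumes "\<And>n. f n \<in> borel_measurable lebesgue" "\<And>n. g n \<in> borel_measurable lebesgue"
    and "(\<lambda>n. Lp_int p (f n)) \<longlonglongrightarrow> 0" "(\<lambda>n. Lp_int p (g n)) \<longlonglongrightarrow> 0"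
  shows "(\<lambda>n. Lp_int p (\<lambda>x. a *\<^sub>R f n x + b *\<^sub>R g n x)) \<longlonglongrightarrow> 0"
proof (rule tendsto_sandwich[OF _ _ tendsto_const])
  let ?B = "\<lambda>n. 2 ^ p * (ennreal (\<bar>a\<bar> ^ p) * Lp_int p (f n) + ennreal (\<bar>b\<bar> ^ p) * Lp_int p (g n))"
  have "?B \<longlonglongrightarrow> 2 ^ p * (ennreal (\<bar>a\<bar> ^ p) * 0 + ennreal (\<bar>b\<bar> ^ p) * 0)"
    by (intro ennreal_tendsto_cmult tendsto_add assms) (auto simp: power_less_top_ennreal)
  then show "?B \<longlonglongrightarrow> 0" by simp
  show "eventually (\<lambda>n. Lp_int p (\<lambda>x. a *\<^sub>R f n x + b *\<^sub>R g n x) \<le> ?B n) sequentially"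
    using Lp_int_add[of "\<lambda>x. a *\<^sub>R f _ x" "\<lambda>x. b *\<^sub>R g _ x" p] assms(1,2)
    by (intro always_eventually allI) (simp flip: Lp_int_scaleR)
qed auto

lemma D12g_lincomb:
  assumes "D12g u g" "D12g v h"
  shows "D12g (\<lambda>x. a * u x + b * v x) (\<lambda>x. a *\<^sub>R g x + b *\<^sub>R h x)"
proof -
  note m = D12g_measurable[OF assms(1)] D12g_measurable[OF assms(2)]
  obtain f where f: "\<And>n. f n \<in> test_functions" "(\<lambda>n. Lp_int 6 (\<lambda>x. f n x - u x)) \<longlonglongrightarrow> 0"
    "(\<lambda>n. Lp_int 2 (\<lambda>x. classical_grad (f n) x - g x)) \<longlonglongrightarrow> 0"
    using assms(1) unfolding D12g_def by blast
  obtain k where k: "\<And>n. k n \<in> test_functions" "(\<lambda>n. Lp_int 6 (\<lambda>x. k n x - v x)) \<longlonglongrightarrow> 0"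
    "(\<lambda>n. Lp_int 2 (\<lambda>x. classical_grad (k n) x - h x)) \<longlonglongrightarrow> 0"
    using assms(2) unfolding D12g_def by blast
  note Cf = test_functions_C1c[OF f(1)] and Ck = test_functions_C1c[OF k(1)]
  note [measurable] = C1c_measurable_lebesgue[OF Cf] C1c_measurable_lebesgue[OF Ck]
    C1c_grad_measurable_lebesgue[OF Cf] C1c_grad_measurable_lebesgue[OF Ck] m(1,2,4,5)
  let ?w = "\<lambda>n x. a * f n x + b * k n x"
  have g: "classical_grad (?w n) x = a *\<^sub>R classical_grad (f n) x + b *\<^sub>R classical_grad (k n) x" for n x
    using Cf[of n] Ck[of n] by (intro classical_grad_lincomb) (auto simp: C1c_def)
  have "(\<lambda>n. Lp_int 6 (\<lambda>x. a *\<^sub>R (f n x - u x) + b *\<^sub>R (k n x - v x))) \<longlonglongrightarrow> 0"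
    by (rule Lp_int_tendsto_0_add[OF _ _ f(2) k(2)]) measurable
  then have 1: "(\<lambda>n. Lp_int 6 (\<lambda>x. ?w n x - (a * u x + b * v x))) \<longlonglongrightarrow> 0"
    by (simp add: algebra_simps)
  have "(\<lambda>n. Lp_int 2 (\<lambda>x. a *\<^sub>R (classical_grad (f n) x - g x) + b *\<^sub>R (classical_grad (k n) x - h x))) \<longlonglongrightarrow> 0"
    by (rule Lp_int_tendsto_0_add[OF _ _ f(3) k(3)]) measurable
  then have 2: "(\<lambda>n. Lp_int 2 (\<lambda>x. classical_grad (?w n) x - (a *\<^sub>R g x + b *\<^sub>R h x))) \<longlonglongrightarrow> 0"
    unfolding g by (simp add: algebra_simps)
  have 3: "Lp_int 2 (\<lambda>x. a *\<^sub>R g x + b *\<^sub>R h x) < \<infinity>"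
    using m by (intro Lp_int_add_finite) (auto simp: Lp_int_scaleR ennreal_mult_less_top)
  show ?thesis
    unfolding D12g_def
  proof (intro conjI exI[of _ ?w] allI 1 2 3)
    show "?w n \<in> test_functions" for n by (rule test_functions_lincomb[OF f(1) k(1)])
  qed measurable
qed

lemma D12g_cong_AE:
  assumes "D12g u g" "AE x in lebesgue. g x = g' x" "g' \<in> borel_measurable lebesgue"
  shows "D12g u g'"
proof -
  have "Lp_int 2 g' = Lp_int 2 g"
    by (rule Lp_int_cong_AE) (use assms(2) in auto)
  moreover have "Lp_int 2 (\<lambda>x. w x - g' x) = Lp_int 2 (\<lambda>x. w x - g x)" for w
    by (rule Lp_int_cong_AE) (use assms(2) in auto)
  ultimately show ?thesis using assms(1,3) unfolding D12g_def by simp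
qed

lemma D12g_weak_grad_self:
  assumes "D12g u g"
  shows "D12g u (weak_grad u)"
proof (rule D12g_cong_AE[OF assms])
  show "AE x in lebesgue. g x = weak_grad u x" using D12g_weak_grad[OF assms] by eventually_elim simp
  show "weak_grad u \<in> borel_measurable lebesgue"
    using has_weak_grad_weak_grad[OF D12g_has_weak_grad[OF assms]]
    by (intro locally_integrable_measurable has_weak_grad_locally_integrable(2))
qed

lemma classical_grad_diff:
  "C1c f \<Longrightarrow> C1c g \<Longrightarrow> classical_grad (\<lambda>x. f x - g x) = (\<lambda>x. classical_grad f x - classical_grad g x)"
  using classical_grad_lincomb[of f _ g 1 "-1"] by (auto simp: C1c_def)

lemma test_functions_diff: "f \<in> test_functions \<Longrightarrow> g \<in> test_functions \<Longrightarrow> (\<lambda>x. f x - g x) \<in> test_functions"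
  using test_functions_lincomb[of f g 1 "-1"] by simp

lemma dirichlet_norm_diff:
  assumes "f \<in> test_functions" "g \<in> test_functions"
  shows "Lp_int 2 (\<lambda>x. classical_grad f x - classical_grad g x) = ennreal (dirichlet_norm (\<lambda>x. f x - g x) ^ 2)"
  using dirichlet_norm_Lp_int[OF test_functions_C1c[OF test_functions_diff[OF assms]]]
  by (simp add: classical_grad_diff test_functions_C1c assms)

lemma dirichlet_norm_nonneg: "dirichlet_norm f \<ge> 0"
  by (simp add: dirichlet_norm_def)

section \<open>Equivalence of the two descriptions of the completion\<close>

lemma L2_Cauchy_grad_iff:
  assumes "\<And>n. f n \<in> test_functions"
  shows "L2_Cauchy (\<lambda>n. classical_grad (f n)) \<longleftrightarrow>
    (\<forall>e>0. \<exists>N. \<forall>m\<ge>N. \<forall>n\<ge>N. dirichlet_norm (\<lambda>x. f m x - f n x) < e)" (is "?L \<longleftrightarrow> ?R")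
proof -
  have iff: "Lp_int 2 (\<lambda>x. classical_grad (f m) x - classical_grad (f n) x) < ennreal (e ^ 2) \<longleftrightarrow>
      dirichlet_norm (\<lambda>x. f m x - f n x) < e" if "e > 0" for e m n
    using that dirichlet_norm_nonneg[of "\<lambda>x. f m x - f n x"]
    by (auto simp: dirichlet_norm_diff assms ennreal_less_iff intro: power_strict_mono dest: power_less_imp_less_base)
  show ?thesis
  proof
    assume ?L
    then have L: "\<exists>N. \<forall>m\<ge>N. \<forall>n\<ge>N. Lp_int 2 (\<lambda>x. classical_grad (f m) x - classical_grad (f n) x) < ennreal e"
      if "e > 0" for e unfolding L2_Cauchy_def using that by blast
    show ?R
    proof (intro allI impI)
      fix e :: real assume "e > 0"
      then show "\<exists>N. \<forall>m\<ge>N. \<forall>n\<ge>N. dirichlet_norm (\<lambda>x. f m x - f n x) < e"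
        using L[of "e ^ 2"] unfolding iff[OF \<open>e > 0\<close>] by simp
    qed
  next
    assume R: ?R
    show ?L
      unfolding L2_Cauchy_def
    proof (intro allI impI)
      fix e :: real assume "e > 0"
      then have "sqrt e > 0" by simp
      with R obtain N where "\<forall>m\<ge>N. \<forall>n\<ge>N. dirichlet_norm (\<lambda>x. f m x - f n x) < sqrt e" by blast
      then show "\<exists>N. \<forall>m\<ge>N. \<forall>n\<ge>N. Lp_int 2 (\<lambda>x. classical_grad (f m) x - classical_grad (f n) x) < ennreal e"
        using iff[OF \<open>sqrt e > 0\<close>] \<open>e > 0\<close> by (intro exI[of _ N]) simp
    qed
  qed
qed

text \<open>The L^6 limit is part of the definition of \<open>D12\<close>; the gradient limit is
  supplied by completeness of L^2.\<close>

lemma D12_imp_D12g: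
  assumes "u \<in> D12"
  obtains g where "D12g u g"
proof -
  obtain f where f: "\<And>n. f n \<in> test_functions"
    and cau: "\<forall>e>0. \<exists>N. \<forall>m\<ge>N. \<forall>n\<ge>N. dirichlet_norm (\<lambda>x. f m x - f n x) < e"
    and lim: "(\<lambda>n. \<integral>\<^sup>+x. ennreal (\<bar>f n x - u x\<bar> ^ 6) \<partial>lebesgue) \<longlonglongrightarrow> 0"
    and u: "u \<in> borel_measurable lebesgue"
    using assms unfolding D12_def mem_Collect_eq by (elim conjE exE) (rule that, erule spec, assumption+)
  note C = test_functions_C1c[OF f]
  note [measurable] = C1c_grad_measurable_lebesgue[OF C]
  have L2: "L2_Cauchy (\<lambda>n. classical_grad (f n))" using L2_Cauchy_grad_iff[of f, OF f] cau by (rule iffD2)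
  obtain g where g [measurable]: "g \<in> borel_measurable lebesgue"
    and lim2: "(\<lambda>n. Lp_int 2 (\<lambda>x. classical_grad (f n) x - g x)) \<longlonglongrightarrow> 0"
    using L2_complete[of "\<lambda>n. classical_grad (f n)", OF C1c_grad_measurable_lebesgue[OF C] L2] .
  obtain n where n: "Lp_int 2 (\<lambda>x. classical_grad (f n) x - g x) < \<infinity>" using tendsto_0_finite[OF lim2] .
  have "Lp_int 2 (\<lambda>x. classical_grad (f n) x + (g x - classical_grad (f n) x)) < \<infinity>"
    by (rule Lp_int_add_finite)
      (use n C1c_Lp_int_finite(2)[OF C, of 2] in \<open>auto simp: Lp_int_minus_commute[of 2 g]\<close>)
  then have "D12g u g"
    unfolding D12g_def using f lim lim2 u g by (auto simp: Lp_int_def)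
  then show ?thesis by (rule that)
qed

lemma D12g_imp_D12:
  assumes "D12g u g"
  shows "u \<in> D12"
proof -
  obtain f where f: "\<And>n. f n \<in> test_functions" "(\<lambda>n. Lp_int 6 (\<lambda>x. f n x - u x)) \<longlonglongrightarrow> 0"
    "(\<lambda>n. Lp_int 2 (\<lambda>x. classical_grad (f n) x - g x)) \<longlonglongrightarrow> 0"
    using assms unfolding D12g_def by blast
  note C = test_functions_C1c[OF f(1)]
  note [measurable] = C1c_grad_measurable_lebesgue[OF C] D12g_measurable(2)[OF assms]
  have "L2_Cauchy (\<lambda>n. classical_grad (f n))"
    unfolding L2_Cauchy_def
  proof (intro allI impI)
    fix e :: real assume e: "e > 0"
    \<comment> \<open>The squared triangle inequality costs a factor 4, and 4 (e/16 + e/16) = e/2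
      leaves room for strictness.\<close>
    then have "eventually (\<lambda>n. Lp_int 2 (\<lambda>x. classical_grad (f n) x - g x) < ennreal (e / 16)) sequentially"
      by (intro order_tendstoD[OF f(3)]) auto
    then obtain N where N: "\<And>n. n \<ge> N \<Longrightarrow> Lp_int 2 (\<lambda>x. classical_grad (f n) x - g x) < ennreal (e / 16)"
      by (auto simp: eventually_sequentially)
    have "Lp_int 2 (\<lambda>x. classical_grad (f m) x - classical_grad (f n) x) < ennreal e" if "m \<ge> N" "n \<ge> N" for m n
    proof -
      have "Lp_int 2 (\<lambda>x. (classical_grad (f m) x - g x) + (g x - classical_grad (f n) x)) \<le>
          2 ^ 2 * (Lp_int 2 (\<lambda>x. classical_grad (f m) x - g x) + Lp_int 2 (\<lambda>x. g x - classical_grad (f n) x))"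
        by (rule Lp_int_add) measurable
      also have "\<dots> \<le> 2 ^ 2 * (ennreal (e / 16) + ennreal (e / 16))"
        using N[OF that(1)] N[OF that(2)] Lp_int_minus_commute[of 2 g]
        by (intro mult_left_mono add_mono) auto
      also have "\<dots> = ennreal 4 * ennreal (e / 16 + e / 16)"
        using e by (subst ennreal_plus) auto
      also have "\<dots> = ennreal (e / 2)" using e by (subst ennreal_mult[symmetric]) auto
      also have "\<dots> < ennreal e" using e by (simp add: ennreal_lessI)
      finally show ?thesis by simp
    qed
    then show "\<exists>N. \<forall>m\<ge>N. \<forall>n\<ge>N. Lp_int 2 (\<lambda>x. classical_grad (f m) x - classical_grad (f n) x) < ennreal e"
      by blast
  qed
  then show ?thesis
    unfolding D12_def using L2_Cauchy_grad_iff[of f] f D12g_measurable(1)[OF assms] by (auto simp: Lp_int_def)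
qed

lemma D12_weak_grad: "u \<in> D12 \<Longrightarrow> D12g u (weak_grad u)"
  by (rule D12_imp_D12g, assumption, rule D12g_weak_grad_self)

lemma Lp_int_2_eq_integral:
  fixes g :: "'a::euclidean_space \<Rightarrow> 'b::{banach, second_countable_topology}"
  assumes [measurable]: "g \<in> borel_measurable lebesgue" and "Lp_int 2 g < \<infinity>"
  shows "integrable lebesgue (\<lambda>x. norm (g x) ^ 2)" "Lp_int 2 g = ennreal (\<integral>x. norm (g x) ^ 2 \<partial>lebesgue)"
proof -
  show i: "integrable lebesgue (\<lambda>x. norm (g x) ^ 2)"
    using assms by (intro integrableI_bounded) (auto simp: Lp_int_def)
  show "Lp_int 2 g = ennreal (\<integral>x. norm (g x) ^ 2 \<partial>lebesgue)"
    unfolding Lp_int_def using i by (intro nn_integral_eq_integral) auto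
qed

lemma D12_norm_Lp_int:
  assumes "D12g u g"
  shows "Lp_int 2 g = ennreal (D12_norm u ^ 2)"
proof -
  note w = D12g_weak_grad_self[OF assms]
  have "Lp_int 2 g = Lp_int 2 (weak_grad u)"
    by (rule Lp_int_cong_AE) (use D12g_weak_grad[OF assms] in auto)
  also have "\<dots> = ennreal (D12_norm u ^ 2)"
    using Lp_int_2_eq_integral(2)[OF D12g_measurable(2,3)[OF w]] by (simp add: D12_norm_def real_sqrt_pow2)
  finally show ?thesis .
qed

section \<open>The Sobolev inequality\<close>

text \<open>Coordinates as nested pairs: product measures on pairs then give Tonelli's theorem on
  \<open>real^3\<close>, once Lebesgue measure is recognised as the image measure by its values on
  boxes.\<close>

definition triple_vec :: "real \<times> real \<times> real \<Rightarrow> real^3" where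
  "triple_vec = (\<lambda>(a, b, c). a *\<^sub>R axis 1 1 + b *\<^sub>R axis 2 1 + c *\<^sub>R axis 3 1)"

lemma triple_vec_nth:
  "triple_vec (a, b, c) $ 1 = a" "triple_vec (a, b, c) $ 2 = b" "triple_vec (a, b, c) $ 3 = c"
  by (simp_all add: triple_vec_def axis_def)

lemma triple_vec_measurable [measurable]: "triple_vec \<in> borel \<rightarrow>\<^sub>M borel"
  unfolding triple_vec_def split_beta by (intro borel_measurable_continuous_onI continuous_intros)

lemma triple_vec_measurable_pair [measurable]: "triple_vec \<in> borel \<Otimes>\<^sub>M (borel \<Otimes>\<^sub>M borel) \<rightarrow>\<^sub>M borel"
  unfolding borel_prod by (rule triple_vec_measurable)

lemma prod_Basis_vec3: "(\<Prod>b\<in>Basis. (x::real^3) \<bullet> b) = x $ 1 * x $ 2 * x $ 3"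
proof -
  have B: "(Basis :: (real^3) set) = range (\<lambda>i. axis i 1)"
    by (auto simp: Basis_vec_def)
  have "inj (\<lambda>i::3. axis i (1::real))" by (auto simp: inj_on_def axis_eq_axis)
  then have "(\<Prod>b\<in>Basis. x \<bullet> b) = (\<Prod>i\<in>UNIV. x \<bullet> axis i 1)"
    unfolding B by (simp add: prod.reindex)
  also have "\<dots> = x $ 1 * x $ 2 * x $ 3"
    unfolding UNIV_3 by (simp add: inner_axis mult.assoc)
  finally show ?thesis .
qed

lemma lborel_triple_vec: "lborel = distr lborel borel triple_vec"
proof (rule lborel_eqI)
  fix l u :: "real^3"
  assume le: "\<And>b. b \<in> Basis \<Longrightarrow> l \<bullet> b \<le> u \<bullet> b"
  have le': "l $ i \<le> u $ i" for i using le[of "axis i 1"] by (simp add: inner_axis)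
  have "triple_vec -` box l u = {l $ 1 <..< u $ 1} \<times> {l $ 2 <..< u $ 2} \<times> {l $ 3 <..< u $ 3}"
    by (auto simp: mem_box_cart forall_3 triple_vec_nth)
  then have "emeasure (distr lborel borel triple_vec) (box l u) =
      emeasure (lborel \<Otimes>\<^sub>M (lborel \<Otimes>\<^sub>M lborel)) ({l $ 1 <..< u $ 1} \<times> ({l $ 2 <..< u $ 2} \<times> {l $ 3 <..< u $ 3}))"
    by (subst emeasure_distr) (auto simp: lborel_prod)
  also have "\<dots> = ennreal (u $ 1 - l $ 1) * (ennreal (u $ 2 - l $ 2) * ennreal (u $ 3 - l $ 3))"
    using le' by (subst sigma_finite_measure.emeasure_pair_measure_Times, simp add: lborel_prod sigma_finite_lborel, simp, simp,
        subst lborel.emeasure_pair_measure_Times) auto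
  also have "\<dots> = ennreal (\<Prod>b\<in>Basis. (u - l) \<bullet> b)"
    using le' by (simp add: prod_Basis_vec3 ennreal_mult mult.assoc)
  finally show "emeasure (distr lborel borel triple_vec) (box l u) = ennreal (\<Prod>b\<in>Basis. (u - l) \<bullet> b)" .
qed simp

section \<open>Iterated integrals and the Loomis-Whitney inequality\<close>

lemma nn_integral_lborel_pair:
  fixes f :: "'a::euclidean_space \<times> 'b::euclidean_space \<Rightarrow> ennreal"
  assumes "f \<in> borel_measurable borel"
  shows "(\<integral>\<^sup>+y. f y \<partial>lborel) = (\<integral>\<^sup>+b. \<integral>\<^sup>+c. f (b, c) \<partial>lborel \<partial>lborel)"
proof -
  have "f \<in> borel_measurable (lborel \<Otimes>\<^sub>M lborel)" using assms by (simp add: lborel_prod)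
  from lborel.nn_integral_fst[OF this] show ?thesis by (simp add: lborel_prod)
qed

lemma nn_integral_triple_vec:
  assumes [measurable]: "F \<in> borel_measurable borel"
  shows "(\<integral>\<^sup>+x. F x \<partial>lborel) = (\<integral>\<^sup>+a. \<integral>\<^sup>+b. \<integral>\<^sup>+c. F (triple_vec (a, b, c)) \<partial>lborel \<partial>lborel \<partial>lborel)"
proof -
  have "(\<integral>\<^sup>+x. F x \<partial>lborel) = (\<integral>\<^sup>+y. F (triple_vec y) \<partial>lborel)"
    by (subst lborel_triple_vec, subst nn_integral_distr) auto
  also have "\<dots> = (\<integral>\<^sup>+a. \<integral>\<^sup>+y. F (triple_vec (a, y)) \<partial>lborel \<partial>lborel)"
    by (rule nn_integral_lborel_pair) measurable
  also have "\<dots> = (\<integral>\<^sup>+a. \<integral>\<^sup>+b. \<integral>\<^sup>+c. F (triple_vec (a, b, c)) \<partial>lborel \<partial>lborel \<partial>lborel)"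
    by (subst nn_integral_lborel_pair) auto
  finally show ?thesis .
qed

lemma nn_integral_swap:
  fixes f :: "real \<Rightarrow> real \<Rightarrow> ennreal"
  assumes "(\<lambda>(a, b). f a b) \<in> borel_measurable (borel \<Otimes>\<^sub>M (borel :: real measure))"
  shows "(\<integral>\<^sup>+a. \<integral>\<^sup>+b. f a b \<partial>lborel \<partial>lborel) = (\<integral>\<^sup>+b. \<integral>\<^sup>+a. f a b \<partial>lborel \<partial>lborel)"
  using lborel_pair.Fubini'[of f] assms by (simp add: lborel_prod borel_prod)

text \<open>Two applications of Cauchy-Schwarz. The variable \<open>a\<close> occurs only in
  \<open>Q\<close> and \<open>R\<close> and is integrated out first, giving a kernel
  \<open>K\<close> on the (b, c) plane whose square is bounded by a product of one-variable
  integrals; then \<open>P\<close> is paired with \<open>K\<close>.\<close>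

lemma Loomis_Whitney:
  fixes P Q R :: "real \<times> real \<Rightarrow> ennreal"
  assumes m: "P \<in> borel_measurable borel" "Q \<in> borel_measurable borel" "R \<in> borel_measurable borel"
  shows "(\<integral>\<^sup>+a. \<integral>\<^sup>+b. \<integral>\<^sup>+c. P (b, c) * Q (a, c) * R (a, b) \<partial>lborel \<partial>lborel \<partial>lborel)\<^sup>2 \<le>
    (\<integral>\<^sup>+b. \<integral>\<^sup>+c. P (b, c) ^ 2 \<partial>lborel \<partial>lborel) * (\<integral>\<^sup>+c. \<integral>\<^sup>+a. Q (a, c) ^ 2 \<partial>lborel \<partial>lborel) *
    (\<integral>\<^sup>+b. \<integral>\<^sup>+a. R (a, b) ^ 2 \<partial>lborel \<partial>lborel)"
proof -
  note [measurable] = m m[folded borel_prod]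
  define K where "K y = (\<integral>\<^sup>+a. Q (a, snd y) * R (a, fst y) \<partial>lborel)" for y
  have K_meas: "K \<in> borel_measurable (borel \<Otimes>\<^sub>M borel)" unfolding K_def by measurable
  note [measurable] = K_meas K_meas[unfolded borel_prod]
  have "(\<integral>\<^sup>+a. \<integral>\<^sup>+b. \<integral>\<^sup>+c. P (b, c) * Q (a, c) * R (a, b) \<partial>lborel \<partial>lborel \<partial>lborel) =
      (\<integral>\<^sup>+b. \<integral>\<^sup>+a. \<integral>\<^sup>+c. P (b, c) * Q (a, c) * R (a, b) \<partial>lborel \<partial>lborel \<partial>lborel)"
    by (rule nn_integral_swap) measurable
  also have "\<dots> = (\<integral>\<^sup>+b. \<integral>\<^sup>+c. \<integral>\<^sup>+a. P (b, c) * Q (a, c) * R (a, b) \<partial>lborel \<partial>lborel \<partial>lborel)"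
    by (intro nn_integral_cong nn_integral_swap) measurable
  also have "\<dots> = (\<integral>\<^sup>+b. \<integral>\<^sup>+c. P (b, c) * K (b, c) \<partial>lborel \<partial>lborel)"
    unfolding K_def by (intro nn_integral_cong) (simp add: mult.assoc nn_integral_cmult)
  also have "\<dots> = (\<integral>\<^sup>+y. P y * K y \<partial>lborel)"
    by (subst nn_integral_lborel_pair) auto
  finally have J: "(\<integral>\<^sup>+a. \<integral>\<^sup>+b. \<integral>\<^sup>+c. P (b, c) * Q (a, c) * R (a, b) \<partial>lborel \<partial>lborel \<partial>lborel) = (\<integral>\<^sup>+y. P y * K y \<partial>lborel)" .
  have "(\<integral>\<^sup>+y. K y ^ 2 \<partial>lborel) = (\<integral>\<^sup>+b. \<integral>\<^sup>+c. K (b, c) ^ 2 \<partial>lborel \<partial>lborel)"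
    by (rule nn_integral_lborel_pair) measurable
  also have "\<dots> \<le> (\<integral>\<^sup>+b. \<integral>\<^sup>+c. (\<integral>\<^sup>+a. Q (a, c) ^ 2 \<partial>lborel) * (\<integral>\<^sup>+a. R (a, b) ^ 2 \<partial>lborel) \<partial>lborel \<partial>lborel)"
    unfolding K_def fst_conv snd_conv by (intro nn_integral_mono Cauchy_Schwarz_nn_integral) measurable
  also have "\<dots> = (\<integral>\<^sup>+c. \<integral>\<^sup>+a. Q (a, c) ^ 2 \<partial>lborel \<partial>lborel) * (\<integral>\<^sup>+b. \<integral>\<^sup>+a. R (a, b) ^ 2 \<partial>lborel \<partial>lborel)"
    by (subst nn_integral_multc, measurable, subst nn_integral_cmult, measurable)
  finally have K: "(\<integral>\<^sup>+y. K y ^ 2 \<partial>lborel) \<le> (\<integral>\<^sup>+c. \<integral>\<^sup>+a. Q (a, c) ^ 2 \<partial>lborel \<partial>lborel) * (\<integral>\<^sup>+b. \<integral>\<^sup>+a. R (a, b) ^ 2 \<partial>lborel \<partial>lborel)" .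
  have "(\<integral>\<^sup>+y. P y * K y \<partial>lborel)\<^sup>2 \<le> (\<integral>\<^sup>+y. P y ^ 2 \<partial>lborel) * (\<integral>\<^sup>+y. K y ^ 2 \<partial>lborel)"
    by (rule Cauchy_Schwarz_nn_integral) measurable
  also have "(\<integral>\<^sup>+y. P y ^ 2 \<partial>lborel) = (\<integral>\<^sup>+b. \<integral>\<^sup>+c. P (b, c) ^ 2 \<partial>lborel \<partial>lborel)"
    by (rule nn_integral_lborel_pair) measurable
  also have "\<dots> * (\<integral>\<^sup>+y. K y ^ 2 \<partial>lborel) \<le> \<dots> * ((\<integral>\<^sup>+c. \<integral>\<^sup>+a. Q (a, c) ^ 2 \<partial>lborel \<partial>lborel) * (\<integral>\<^sup>+b. \<integral>\<^sup>+a. R (a, b) ^ 2 \<partial>lborel \<partial>lborel))"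
    by (rule mult_left_mono[OF K]) simp
  finally show ?thesis
    unfolding J[symmetric] by (simp only: mult.assoc)
qed

lemma abs_le_nn_integral_derivative:
  fixes \<phi> :: "real \<Rightarrow> real"
  assumes d: "\<And>t. (\<phi> has_real_derivative \<phi>' t) (at t)" and c: "continuous_on UNIV \<phi>'"
    and supp: "\<And>t. \<bar>t\<bar> > r \<Longrightarrow> \<phi> t = 0"
  shows "ennreal \<bar>\<phi> s\<bar> \<le> (\<integral>\<^sup>+t. ennreal \<bar>\<phi>' t\<bar> \<partial>lborel)"
proof -
  \<comment> \<open>A point to the left of both \<open>s\<close> and the support, so that the
    fundamental theorem of calculus on \<open>{a..s}\<close> has no contribution at
    \<open>a\<close>.\<close>
  define a where "a = - (\<bar>r\<bar> + \<bar>s\<bar> + 1)"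
  have a: "a \<le> s" "\<phi> a = 0" using supp[of a] by (auto simp: a_def)
  have "has_bochner_integral lborel (\<lambda>t. \<phi>' t * indicator {a..s} t) (\<phi> s - \<phi> a)"
    using a d c by (intro has_bochner_integral_FTC_Icc_real) (auto simp: continuous_on_eq_continuous_at)
  then have i: "integrable lborel (\<lambda>t. \<phi>' t * indicator {a..s} t)"
    and e: "(\<integral>t. \<phi>' t * indicator {a..s} t \<partial>lborel) = \<phi> s"
    using a by (auto simp: has_bochner_integral_iff)
  have "ennreal (norm (\<integral>t. \<phi>' t * indicator {a..s} t \<partial>lborel)) \<le> (\<integral>\<^sup>+t. ennreal (norm (\<phi>' t * indicator {a..s} t)) \<partial>lborel)"
    by (rule integral_norm_bound_ennreal[OF i])
  also have "\<dots> \<le> (\<integral>\<^sup>+t. ennreal \<bar>\<phi>' t\<bar> \<partial>lborel)"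
    by (intro nn_integral_mono ennreal_leI) (auto simp: indicator_def)
  finally show ?thesis using e by simp
qed

lemma C1c_slice_bound:
  assumes w: "C1c w" and v: "norm v = 1"
  shows "ennreal \<bar>w (p + s *\<^sub>R v)\<bar> \<le> (\<integral>\<^sup>+t. ennreal (norm (classical_grad w (p + t *\<^sub>R v))) \<partial>lborel)"
proof -
  obtain r where r: "\<And>x. norm x > r \<Longrightarrow> w x = 0" using C1c_bounds[OF w] by metis
  have "ennreal \<bar>w (p + s *\<^sub>R v)\<bar> \<le> (\<integral>\<^sup>+t. ennreal \<bar>classical_grad w (p + t *\<^sub>R v) \<bullet> v\<bar> \<partial>lborel)"
  proof (rule abs_le_nn_integral_derivative[where \<phi> = "\<lambda>t. w (p + t *\<^sub>R v)" and r = "r + norm p"])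
    fix t
    have "((\<lambda>t. p + t *\<^sub>R v) has_derivative (\<lambda>t. t *\<^sub>R v)) (at t)"
      by (auto intro!: derivative_eq_intros)
    from has_derivative_compose[OF this C1c_derivative[OF w]]
    show "((\<lambda>t. w (p + t *\<^sub>R v)) has_real_derivative classical_grad w (p + t *\<^sub>R v) \<bullet> v) (at t)"
      by (simp add: has_field_derivative_def mult_commute_abs)
    show "w (p + t *\<^sub>R v) = 0" if "\<bar>t\<bar> > r + norm p"
      by (rule r) (use that v norm_triangle_ineq2[of "t *\<^sub>R v" "- p"] in \<open>simp add: add.commute\<close>)
  next
    show "continuous_on UNIV (\<lambda>t. classical_grad w (p + t *\<^sub>R v) \<bullet> v)"
      by (intro continuous_intros continuous_on_compose2[OF C1c_grad_continuous[OF w, of UNIV]]) auto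
  qed
  also have "\<dots> \<le> (\<integral>\<^sup>+t. ennreal (norm (classical_grad w (p + t *\<^sub>R v))) \<partial>lborel)"
  proof (intro nn_integral_mono ennreal_leI)
    fix t show "\<bar>classical_grad w (p + t *\<^sub>R v) \<bullet> v\<bar> \<le> norm (classical_grad w (p + t *\<^sub>R v))"
      using Cauchy_Schwarz_ineq2[of "classical_grad w (p + t *\<^sub>R v)" v] v by simp
  qed
  finally show ?thesis .
qed

text \<open>A square root that also accepts infinity, because line integrals of a gradient enter
  here as extended numbers.\<close>

definition ennsqrt :: "ennreal \<Rightarrow> ennreal" where
  "ennsqrt A = (if A = top then top else ennreal (sqrt (enn2real A)))"

lemma ennsqrt_measurable [measurable]: "ennsqrt \<in> borel_measurable borel"
  unfolding ennsqrt_def by measurable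

lemma ennsqrt_power2: "ennsqrt A ^ 2 = A"
  by (cases A) (auto simp: ennsqrt_def ennreal_power)

lemma le_ennsqrt:
  assumes "ennreal (t ^ 2) \<le> A" "t \<ge> 0"
  shows "ennreal t \<le> ennsqrt A"
  using assms by (cases A) (auto simp: ennsqrt_def ennreal_le_iff intro: real_le_rsqrt)

text \<open>At each point w = f^4 is bounded by the integrals \<open>A1\<close>, \<open>A2\<close>,
  \<open>A3\<close> of |grad w| along the three coordinate lines, so f^2 is below each of their
  roots and f^6 below the product. Loomis-Whitney gives X^2 <= Y^3 with X the integral of f^6 and Y
  that of |grad w| = 4 |f|^3 |grad f|. Cauchy-Schwarz gives Y^2 <= 16 X G, so X^4 <= (16 X G)^3, and
  4096 = 16^3.\<close>

lemma Gagliardo_Nirenberg_Sobolev: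
  assumes f: "C1c f"
  shows "Lp_int 6 f \<le> 4096 * Lp_int 2 (classical_grad f) ^ 3"
proof -
  \<comment> \<open>The exponent 4 is the one for which |w|^(3/2), the quantity that Loomis-Whitney
    controls in dimension three, equals f^6. The nested product fits
    \<open>C1c_mult\<close>.\<close>
  define w where "w x = (f x * f x) * (f x * f x)" for x
  have w: "C1c w" unfolding w_def by (intro C1c_mult f)
  have d: "f differentiable (at x)" for x using f by (simp add: C1c_def)
  have gw: "classical_grad w x = (4 * f x ^ 3) *\<^sub>R classical_grad f x" for x
    unfolding w_def
    by (rule classical_grad_eqI)
       (auto intro!: derivative_eq_intros classical_grad_derivative d simp: inner_simps power3_eq_cube)
  note [measurable] = C1c_measurable[OF f] C1c_grad_measurable[OF f] C1c_measurable[OF w] C1c_grad_measurable[OF w]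
  define \<Phi> where "\<Phi> x = ennreal (norm (classical_grad w x))" for x
  have [measurable]: "\<Phi> \<in> borel_measurable borel" unfolding \<Phi>_def by measurable
  define X G Y where "X = Lp_int 6 f" and "G = Lp_int 2 (classical_grad f)" and "Y = (\<integral>\<^sup>+x. \<Phi> x \<partial>lborel)"
  define A1 where "A1 y = (\<integral>\<^sup>+t. \<Phi> (triple_vec (t, fst y, snd y)) \<partial>lborel)" for y
  define A2 where "A2 y = (\<integral>\<^sup>+t. \<Phi> (triple_vec (fst y, t, snd y)) \<partial>lborel)" for y
  define A3 where "A3 y = (\<integral>\<^sup>+t. \<Phi> (triple_vec (fst y, snd y, t)) \<partial>lborel)" for y
  have A_meas: "A1 \<in> borel_measurable (borel \<Otimes>\<^sub>M borel)" "A2 \<in> borel_measurable (borel \<Otimes>\<^sub>M borel)"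
      "A3 \<in> borel_measurable (borel \<Otimes>\<^sub>M borel)"
    unfolding A1_def A2_def A3_def by measurable
  note [measurable] = A_meas A_meas[unfolded borel_prod]
  have w_pow: "w x = (f x ^ 2) ^ 2" for x by (simp add: w_def power2_eq_square)
  have b: "ennreal (f (triple_vec (a, b, c)) ^ 2) \<le> ennsqrt (A1 (b, c))"
       "ennreal (f (triple_vec (a, b, c)) ^ 2) \<le> ennsqrt (A2 (a, c))"
       "ennreal (f (triple_vec (a, b, c)) ^ 2) \<le> ennsqrt (A3 (a, b))" for a b c
  proof -
    have e: "triple_vec (t, b, c) = triple_vec (0, b, c) + t *\<^sub>R axis 1 1"
      "triple_vec (a, t, c) = triple_vec (a, 0, c) + t *\<^sub>R axis 2 1"
      "triple_vec (a, b, t) = triple_vec (a, b, 0) + t *\<^sub>R axis 3 1" for t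
      by (simp_all add: triple_vec_def algebra_simps)
    have "ennreal \<bar>w (triple_vec (a, b, c))\<bar> \<le> A1 (b, c)"
      using C1c_slice_bound[OF w, of "axis 1 1" "triple_vec (0, b, c)" a]
      by (simp add: A1_def \<Phi>_def norm_axis_1 flip: e)
    moreover have "ennreal \<bar>w (triple_vec (a, b, c))\<bar> \<le> A2 (a, c)"
      using C1c_slice_bound[OF w, of "axis 2 1" "triple_vec (a, 0, c)" b]
      by (simp add: A2_def \<Phi>_def norm_axis_1 flip: e)
    moreover have "ennreal \<bar>w (triple_vec (a, b, c))\<bar> \<le> A3 (a, b)"
      using C1c_slice_bound[OF w, of "axis 3 1" "triple_vec (a, b, 0)" c]
      by (simp add: A3_def \<Phi>_def norm_axis_1 flip: e)
    ultimately show "ennreal (f (triple_vec (a, b, c)) ^ 2) \<le> ennsqrt (A1 (b, c))"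
       "ennreal (f (triple_vec (a, b, c)) ^ 2) \<le> ennsqrt (A2 (a, c))"
       "ennreal (f (triple_vec (a, b, c)) ^ 2) \<le> ennsqrt (A3 (a, b))"
      unfolding w_pow by (auto intro!: le_ennsqrt)
  qed
  have "X = (\<integral>\<^sup>+x. ennreal (f x ^ 6) \<partial>lborel)"
    unfolding X_def Lp_int_def nn_integral_completion by simp
  also have "\<dots> = (\<integral>\<^sup>+a. \<integral>\<^sup>+b. \<integral>\<^sup>+c. ennreal (f (triple_vec (a, b, c)) ^ 6) \<partial>lborel \<partial>lborel \<partial>lborel)"
    by (rule nn_integral_triple_vec) measurable
  also have "\<dots> \<le> (\<integral>\<^sup>+a. \<integral>\<^sup>+b. \<integral>\<^sup>+c. ennsqrt (A1 (b, c)) * ennsqrt (A2 (a, c)) * ennsqrt (A3 (a, b)) \<partial>lborel \<partial>lborel \<partial>lborel)"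
  proof (intro nn_integral_mono)
    fix a b c
    let ?t = "f (triple_vec (a, b, c))"
    have "?t ^ 6 = (?t ^ 2 * ?t ^ 2) * ?t ^ 2" by (simp flip: power_add)
    then have "ennreal (?t ^ 6) = ennreal (?t ^ 2) * ennreal (?t ^ 2) * ennreal (?t ^ 2)"
      by (simp only: ennreal_mult zero_le_power2 mult_nonneg_nonneg)
    also have "\<dots> \<le> ennsqrt (A1 (b, c)) * ennsqrt (A2 (a, c)) * ennsqrt (A3 (a, b))"
      by (intro mult_mono b) auto
    finally show "ennreal (?t ^ 6) \<le> \<dots>" .
  qed
  finally have "X ^ 2 \<le> (\<integral>\<^sup>+a. \<integral>\<^sup>+b. \<integral>\<^sup>+c. ennsqrt (A1 (b, c)) * ennsqrt (A2 (a, c)) * ennsqrt (A3 (a, b)) \<partial>lborel \<partial>lborel \<partial>lborel) ^ 2"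
    by (rule power_mono) simp
  also have "\<dots> \<le> (\<integral>\<^sup>+b. \<integral>\<^sup>+c. ennsqrt (A1 (b, c)) ^ 2 \<partial>lborel \<partial>lborel) * (\<integral>\<^sup>+c. \<integral>\<^sup>+a. ennsqrt (A2 (a, c)) ^ 2 \<partial>lborel \<partial>lborel) *
      (\<integral>\<^sup>+b. \<integral>\<^sup>+a. ennsqrt (A3 (a, b)) ^ 2 \<partial>lborel \<partial>lborel)"
    by (rule Loomis_Whitney[of "\<lambda>y. ennsqrt (A1 y)" "\<lambda>y. ennsqrt (A2 y)" "\<lambda>y. ennsqrt (A3 y)"]) measurable
  also have "\<dots> = Y * Y * Y"
  proof -
    have "Y = (\<integral>\<^sup>+a. \<integral>\<^sup>+b. A3 (a, b) \<partial>lborel \<partial>lborel)"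
      unfolding Y_def A3_def fst_conv snd_conv by (rule nn_integral_triple_vec) measurable
    also have "\<dots> = (\<integral>\<^sup>+b. \<integral>\<^sup>+a. A3 (a, b) \<partial>lborel \<partial>lborel)" by (rule nn_integral_swap) measurable
    finally have 3: "(\<integral>\<^sup>+b. \<integral>\<^sup>+a. A3 (a, b) \<partial>lborel \<partial>lborel) = Y" by simp
    have "Y = (\<integral>\<^sup>+a. \<integral>\<^sup>+b. \<integral>\<^sup>+c. \<Phi> (triple_vec (a, b, c)) \<partial>lborel \<partial>lborel \<partial>lborel)"
      unfolding Y_def by (rule nn_integral_triple_vec) measurable
    also have "\<dots> = (\<integral>\<^sup>+a. \<integral>\<^sup>+c. A2 (a, c) \<partial>lborel \<partial>lborel)"
      unfolding A2_def fst_conv snd_conv by (intro nn_integral_cong nn_integral_swap) measurable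
    also have "\<dots> = (\<integral>\<^sup>+c. \<integral>\<^sup>+a. A2 (a, c) \<partial>lborel \<partial>lborel)" by (rule nn_integral_swap) measurable
    finally have 2: "(\<integral>\<^sup>+c. \<integral>\<^sup>+a. A2 (a, c) \<partial>lborel \<partial>lborel) = Y" by simp
    have "Y = (\<integral>\<^sup>+a. \<integral>\<^sup>+b. \<integral>\<^sup>+c. \<Phi> (triple_vec (a, b, c)) \<partial>lborel \<partial>lborel \<partial>lborel)"
      unfolding Y_def by (rule nn_integral_triple_vec) measurable
    also have "\<dots> = (\<integral>\<^sup>+b. \<integral>\<^sup>+a. \<integral>\<^sup>+c. \<Phi> (triple_vec (a, b, c)) \<partial>lborel \<partial>lborel \<partial>lborel)"
      by (rule nn_integral_swap) measurable
    also have "\<dots> = (\<integral>\<^sup>+b. \<integral>\<^sup>+c. A1 (b, c) \<partial>lborel \<partial>lborel)"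
      unfolding A1_def fst_conv snd_conv by (intro nn_integral_cong nn_integral_swap) measurable
    finally have 1: "(\<integral>\<^sup>+b. \<integral>\<^sup>+c. A1 (b, c) \<partial>lborel \<partial>lborel) = Y" by simp
    show ?thesis unfolding ennsqrt_power2 1 2 3 ..
  qed
  finally have XY: "X ^ 2 \<le> Y ^ 3" by (simp add: power3_eq_cube)
  have "Y = (\<integral>\<^sup>+x. ennreal (4 * \<bar>f x\<bar> ^ 3) * ennreal (norm (classical_grad f x)) \<partial>lborel)"
    unfolding Y_def \<Phi>_def gw by (simp add: ennreal_mult power_abs abs_mult)
  then have "Y ^ 2 \<le> (\<integral>\<^sup>+x. ennreal (4 * \<bar>f x\<bar> ^ 3) ^ 2 \<partial>lborel) * (\<integral>\<^sup>+x. ennreal (norm (classical_grad f x)) ^ 2 \<partial>lborel)"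
    by (simp only:, intro Cauchy_Schwarz_nn_integral) measurable
  also have "(\<integral>\<^sup>+x. ennreal (norm (classical_grad f x)) ^ 2 \<partial>lborel) = G"
    unfolding G_def Lp_int_def nn_integral_completion by (simp add: ennreal_power)
  also have "(\<integral>\<^sup>+x. ennreal (4 * \<bar>f x\<bar> ^ 3) ^ 2 \<partial>lborel) = (\<integral>\<^sup>+x. 16 * ennreal (norm (f x) ^ 6) \<partial>lborel)"
    by (intro nn_integral_cong)
       (simp add: ennreal_power power_mult_distrib ennreal_mult power_mult[symmetric] del: power_even_abs_numeral)
  also have "\<dots> = 16 * X"
    unfolding X_def Lp_int_def nn_integral_completion by (rule nn_integral_cmult) measurable
  finally have YX: "Y ^ 2 \<le> 16 * X * G" .
  \<comment> \<open>Finiteness, due to compact support, is what permits dividing X^4 <= (16 X G)^3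
    by X^3; the cancellation is done on real numbers.\<close>
  have "X < \<infinity>" "G < \<infinity>" unfolding X_def G_def using C1c_Lp_int_finite[OF f] by auto
  then obtain x g where xg: "X = ennreal x" "x \<ge> 0" "G = ennreal g" "g \<ge> 0"
    by (metis ennreal_cases infinity_ennreal_def less_irrefl)
  have "X ^ 4 = (X ^ 2) ^ 2" by (simp flip: power_mult)
  also have "\<dots> \<le> (Y ^ 3) ^ 2" by (rule power_mono[OF XY]) simp
  also have "\<dots> = (Y ^ 2) ^ 3" by (simp flip: power_mult)
  also have "\<dots> \<le> (16 * X * G) ^ 3" by (rule power_mono[OF YX]) simp
  also have "16 * X * G = ennreal (16 * x * g)" unfolding xg using xg by (simp add: ennreal_mult)
  finally have "ennreal (x ^ 4) \<le> ennreal ((16 * x * g) ^ 3)" using xg by (simp add: ennreal_power)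
  then have "x ^ 4 \<le> (16 * x * g) ^ 3" using xg by (subst (asm) ennreal_le_iff) auto
  then have "x ^ 3 * x \<le> x ^ 3 * (4096 * g ^ 3)" by (simp add: power_mult_distrib eval_nat_numeral algebra_simps)
  then have "x \<le> 4096 * g ^ 3" using xg by (cases "x = 0") auto
  then have "ennreal x \<le> ennreal (4096 * g ^ 3)" by (rule ennreal_leI)
  also have "\<dots> = 4096 * G ^ 3" using xg by (simp add: ennreal_mult ennreal_power)
  finally show ?thesis using xg unfolding X_def G_def by simp
qed

lemma tendsto_power_ennreal:
  fixes X :: "'a \<Rightarrow> ennreal"
  assumes "(X \<longlongrightarrow> l) F" "l < \<infinity>"
  shows "((\<lambda>n. X n ^ k) \<longlongrightarrow> l ^ k) F"
proof (induction k)
  case (Suc k)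
  have "l ^ k < \<infinity>" using assms(2) by (simp add: power_less_top_ennreal)
  then have "\<not> ((l = 0 \<and> l ^ k = \<infinity>) \<or> (l = \<infinity> \<and> l ^ k = 0))"
    using assms(2) by (metis less_irrefl)
  from tendsto_mult_ennreal[OF assms(1) Suc this] show ?case by simp
qed simp

text \<open>The inequality for test functions passes to the limit. The constant is 2^6 * 4096 * 4^3
  = 2^24, the outer factors coming from the triangle inequalities for sixth powers and for
  squares.\<close>

lemma D12g_Sobolev:
  assumes "D12g u g"
  shows "Lp_int 6 u \<le> 16777216 * Lp_int 2 g ^ 3"
proof -
  note m [measurable] = D12g_measurable(1,2)[OF assms]
  obtain f where f: "\<And>n. f n \<in> test_functions" "(\<lambda>n. Lp_int 6 (\<lambda>x. f n x - u x)) \<longlonglongrightarrow> 0"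
    "(\<lambda>n. Lp_int 2 (\<lambda>x. classical_grad (f n) x - g x)) \<longlonglongrightarrow> 0"
    using assms unfolding D12g_def by blast
  note C = test_functions_C1c[OF f(1)]
  note [measurable] = C1c_measurable_lebesgue[OF C] C1c_grad_measurable_lebesgue[OF C]
  let ?a = "\<lambda>n. Lp_int 6 (\<lambda>x. f n x - u x)" and ?b = "\<lambda>n. Lp_int 2 (\<lambda>x. classical_grad (f n) x - g x)"
  let ?B = "\<lambda>n. 2 ^ 6 * (4096 * (2 ^ 2 * (?b n + Lp_int 2 g)) ^ 3 + ?a n)"
  have le: "Lp_int 6 u \<le> ?B n" for n
  proof -
    have "Lp_int 2 (\<lambda>x. (classical_grad (f n) x - g x) + g x) \<le> 2 ^ 2 * (?b n + Lp_int 2 g)"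
      by (rule Lp_int_add) measurable
    then have G: "Lp_int 2 (classical_grad (f n)) \<le> 2 ^ 2 * (?b n + Lp_int 2 g)" by simp
    have "Lp_int 6 (\<lambda>x. f n x + (u x - f n x)) \<le> 2 ^ 6 * (Lp_int 6 (f n) + Lp_int 6 (\<lambda>x. u x - f n x))"
      by (rule Lp_int_add) measurable
    also have "\<dots> = 2 ^ 6 * (Lp_int 6 (f n) + ?a n)" by (simp only: Lp_int_minus_commute[of 6 u])
    also have "\<dots> \<le> ?B n"
      using Gagliardo_Nirenberg_Sobolev[OF C, of n] mult_left_mono[OF power_mono[OF G, of 3], of 4096]
      by (intro mult_left_mono add_right_mono) auto
    finally show ?thesis by simp
  qed
  have "Lp_int 2 g < \<infinity>" by (rule D12g_measurable[OF assms])
  then obtain c where c: "Lp_int 2 g = ennreal c" "c \<ge> 0"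
    by (metis ennreal_cases infinity_ennreal_def less_irrefl)
  have "(\<lambda>n. 2 ^ 2 * (?b n + Lp_int 2 g)) \<longlonglongrightarrow> 2 ^ 2 * (0 + Lp_int 2 g)"
    by (intro ennreal_tendsto_cmult tendsto_add f tendsto_const) auto
  moreover have "2 ^ 2 * (0 + Lp_int 2 g) < \<infinity>"
    by (simp add: c ennreal_mult_less_top)
  ultimately have "(\<lambda>n. (2 ^ 2 * (?b n + Lp_int 2 g)) ^ 3) \<longlonglongrightarrow> (2 ^ 2 * (0 + Lp_int 2 g)) ^ 3"
    by (rule tendsto_power_ennreal)
  then have "?B \<longlonglongrightarrow> 2 ^ 6 * (4096 * (2 ^ 2 * (0 + Lp_int 2 g)) ^ 3 + 0)"
    by (intro ennreal_tendsto_cmult tendsto_add f) auto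
  then have "Lp_int 6 u \<le> 2 ^ 6 * (4096 * (2 ^ 2 * (0 + Lp_int 2 g)) ^ 3 + 0)"
    by (rule LIMSEQ_le_const) (use le in auto)
  also have "\<dots> = 16777216 * Lp_int 2 g ^ 3" by (simp add: power_mult_distrib flip: mult.assoc)
  finally show ?thesis .
qed

section \<open>Lipschitz bounds and completeness of the constraint set\<close>

lemma C1c_integrable:
  assumes "C1c f"
  shows "integrable lborel f"
proof -
  obtain r M where "\<And>x. \<bar>f x\<bar> \<le> M" "\<And>x. norm x > r \<Longrightarrow> f x = 0"
    using C1c_bounds[OF assms] by metis
  with C1c_measurable[OF assms] show ?thesis by (intro integrable_bounded_cball[of _ r M]) auto
qed

text \<open>The Lipschitz estimate averaged against \<open>\<eta>\<close>. The derivative in the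
  translation parameter is, by the weak gradient, minus the integral of a translate of
  \<open>\<eta>\<close> times \<open>g\<close>, paired with \<open>h\<close>; the mean value theorem
  on [0, 1] concludes.\<close>

lemma test_functions_shift_integral_bound:
  assumes u: "continuous_on UNIV u" and wg: "has_weak_grad u g"
    and K: "AE x in lebesgue. norm (g x) \<le> K"
    and \<eta>: "\<eta> \<in> test_functions" "\<And>x. \<eta> x \<ge> 0"
  shows "\<bar>(\<integral>z. u z * \<eta> (z + h) \<partial>lborel) - (\<integral>z. u z * \<eta> z \<partial>lborel)\<bar> \<le> K * norm h * (\<integral>z. \<eta> z \<partial>lborel)"
proof -
  note C = test_functions_C1c[OF \<eta>(1)]
  define D where "D t = (\<integral>z. u z * (classical_grad \<eta> (z + t *\<^sub>R h) \<bullet> h) \<partial>lborel)" for t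
  have D: "\<bar>D t\<bar> \<le> K * norm h * (\<integral>z. \<eta> z \<partial>lborel)" for t
  proof -
    define \<theta> where "\<theta> z = \<eta> (z + t *\<^sub>R h)" for z
    have \<theta>: "\<theta> \<in> test_functions" unfolding \<theta>_def by (rule test_functions_shift[OF \<eta>(1)])
    note C\<theta> = test_functions_C1c[OF \<theta>]
    have grad: "classical_grad \<theta> z = classical_grad \<eta> (z + t *\<^sub>R h)" for z
      unfolding \<theta>_def using C by (intro classical_grad_shift) (simp add: C1c_def)
    have [measurable]: "u \<in> borel_measurable borel" using u by (rule borel_measurable_continuous_onI)
    note [measurable] = C1c_measurable[OF C\<theta>] C1c_grad_measurable[OF C\<theta>]
    have i1: "integrable lebesgue (\<lambda>z. u z *\<^sub>R classical_grad \<theta> z)"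
      by (rule test_grad_integrable[OF has_weak_grad_locally_integrable(1)[OF wg] \<theta>])
    have i2: "integrable lebesgue (\<lambda>z. \<theta> z *\<^sub>R g z)"
      by (rule test_mult_integrable[OF has_weak_grad_locally_integrable(2)[OF wg] \<theta>])
    have i3: "integrable lebesgue \<theta>"
      using C1c_integrable[OF C\<theta>] by (subst integrable_completion) auto
    have "D t = (\<integral>z. (u z *\<^sub>R classical_grad \<theta> z) \<bullet> h \<partial>lebesgue)"
      unfolding D_def grad[symmetric] by (subst integral_completion) auto
    also have "\<dots> = (\<integral>z. u z *\<^sub>R classical_grad \<theta> z \<partial>lebesgue) \<bullet> h"
      using i1 by (rule integral_inner_left)
    also have "\<dots> = - ((\<integral>z. \<theta> z *\<^sub>R g z \<partial>lebesgue) \<bullet> h)"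
      using wg \<theta> by (simp add: has_weak_grad_def)
    finally have Dt: "\<bar>D t\<bar> \<le> norm (\<integral>z. \<theta> z *\<^sub>R g z \<partial>lebesgue) * norm h"
      using Cauchy_Schwarz_ineq2[of "\<integral>z. \<theta> z *\<^sub>R g z \<partial>lebesgue" h] by simp
    have "norm (\<integral>z. \<theta> z *\<^sub>R g z \<partial>lebesgue) \<le> (\<integral>z. norm (\<theta> z *\<^sub>R g z) \<partial>lebesgue)"
      by (rule integral_norm_bound)
    also have "\<dots> \<le> (\<integral>z. K * \<theta> z \<partial>lebesgue)"
    proof (rule integral_mono_AE)
      show "AE z in lebesgue. norm (\<theta> z *\<^sub>R g z) \<le> K * \<theta> z"
        using K
      proof eventually_elim
        case (elim z)
        then show ?case using mult_left_mono[OF elim, of "\<theta> z"] \<eta>(2)[of "z + t *\<^sub>R h"]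
          by (simp add: \<theta>_def mult.commute)
      qed
    qed (use integrable_norm[OF i2] i3 in auto)
    also have "\<dots> = K * (\<integral>z. \<theta> z \<partial>lborel)"
      by (subst integral_completion) auto
    also have "(\<integral>z. \<theta> z \<partial>lborel) = (\<integral>z. \<eta> z \<partial>lborel)"
      unfolding \<theta>_def by (rule integral_shift_lborel[OF C1c_measurable[OF C]])
    finally show ?thesis
      using Dt mult_right_mono[of _ "K * (\<integral>z. \<eta> z \<partial>lborel)" "norm h"]
      by (fastforce simp: mult.commute mult.left_commute)
  qed
  have "((\<lambda>t. \<integral>z. u z * \<eta> (z + t *\<^sub>R h) \<partial>lborel) has_real_derivative D t) (at t)" for t
    unfolding D_def by (rule translation_integral_derivative[OF u C])
  then obtain z where "(\<integral>z. u z * \<eta> (z + 1 *\<^sub>R h) \<partial>lborel) - (\<integral>z. u z * \<eta> (z + 0 *\<^sub>R h) \<partial>lborel) = (1 - 0) * D z"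
    using MVT2[of 0 1 "\<lambda>t. \<integral>z. u z * \<eta> (z + t *\<^sub>R h) \<partial>lborel" D] by auto
  then show ?thesis using D[of z] by simp
qed

text \<open>If the pointwise estimate failed at \<open>x\<close>, continuity would make the excess
  \<open>v\<close> positive on a whole box around \<open>x\<close>. A bump supported there then
  contradicts the averaged estimate.\<close>

lemma weak_grad_bound_lipschitz:
  assumes u: "continuous_on UNIV u" and wg: "has_weak_grad u g"
    and K: "AE x in lebesgue. norm (g x) \<le> K" "K \<ge> 0"
  shows "K-lipschitz_on UNIV u"
proof -
  have main: "u (x - h) - u x \<le> K * norm h" for x h
  proof (rule ccontr)
    assume neg: "\<not> u (x - h) - u x \<le> K * norm h"
    define v where "v z = u (z - h) - u z - K * norm h" for z
    have v: "continuous_on UNIV v"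
      unfolding v_def by (intro continuous_intros u continuous_on_compose2[OF u]) auto
    have "open {z. v z > 0}"
      by (rule open_Collect_less[OF continuous_on_const v])
    moreover have "x \<in> {z. v z > 0}" using neg by (simp add: v_def)
    ultimately obtain a b where ab: "box a b \<subseteq> {z. v z > 0}" "x \<in> box a b"
      by (metis open_contains_box)
    define \<eta> where "\<eta> = box_bump a b 0"
    have \<eta>: "\<eta> \<in> test_functions" "\<And>z. \<eta> z \<ge> 0"
      unfolding \<eta>_def by (auto simp: box_bump_test box_bump_nonneg)
    note C = test_functions_C1c[OF \<eta>(1)]
    have [measurable]: "u \<in> borel_measurable borel" "v \<in> borel_measurable borel"
      using u v by (auto intro: borel_measurable_continuous_onI)
    note [measurable] = C1c_measurable[OF C]
    have int: "integrable lborel (\<lambda>z. f z * \<eta> z)" if f: "continuous_on UNIV f" for f :: "real^3 \<Rightarrow> real"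
    proof -
      obtain r M where M: "M \<ge> 0" "\<And>x. \<bar>\<eta> x\<bar> \<le> M" "\<And>x. norm x > r \<Longrightarrow> \<eta> x = 0" using C1c_bounds[OF C] by metis
      obtain U where U: "U \<ge> 0" "\<And>x. x \<in> cball 0 r \<Longrightarrow> \<bar>f x\<bar> \<le> U"
        using continuous_bounded_cball[OF f] by blast
      show ?thesis
      proof (rule integrable_bounded_cball)
        show "(\<lambda>z. f z * \<eta> z) \<in> borel_measurable lborel"
          using borel_measurable_continuous_onI[OF f] by measurable
        show "norm (f z * \<eta> z) \<le> U * M" if "norm z \<le> r" for z
          unfolding norm_mult using U M that by (intro mult_mono) auto
        show "f z * \<eta> z = 0" if "norm z > r" for z using M(3)[OF that] by simp
      qed
    qed
    have int1: "integrable lborel (\<lambda>z. u (z - h) * \<eta> z)"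
      by (intro int continuous_on_compose2[OF u] continuous_intros) auto
    have int3: "integrable lborel \<eta>" using int[of "\<lambda>_. 1"] by simp
    have "(\<integral>z. u z * \<eta> (z + h) \<partial>lborel) = (\<integral>z. u (z - h) * \<eta> z \<partial>lborel)"
      using integral_shift_lborel[of "\<lambda>z. u (z - h) * \<eta> z" h] by simp
    then have "(\<integral>z. u (z - h) * \<eta> z \<partial>lborel) - (\<integral>z. u z * \<eta> z \<partial>lborel) \<le> K * norm h * (\<integral>z. \<eta> z \<partial>lborel)"
      using test_functions_shift_integral_bound[OF u wg K(1) \<eta>, of h] by simp
    moreover have "(\<integral>z. v z * \<eta> z \<partial>lborel) = (\<integral>z. u (z - h) * \<eta> z \<partial>lborel) - (\<integral>z. u z * \<eta> z \<partial>lborel) - K * norm h * (\<integral>z. \<eta> z \<partial>lborel)"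
      unfolding v_def left_diff_distrib using int1 int[OF u] int3
      by (subst Bochner_Integration.integral_diff; (simp add: mult.assoc)?)
    ultimately have le: "(\<integral>z. v z * \<eta> z \<partial>lborel) \<le> 0" by simp
    have nonneg: "v z * \<eta> z \<ge> 0" for z
    proof (cases "z \<in> box a b")
      case True
      then have "v z > 0" using ab by blast
      then show ?thesis using \<eta>(2)[of z] by simp
    next
      case False
      then show ?thesis by (simp add: \<eta>_def box_bump_eq_0)
    qed
    have "(\<integral>z. v z * \<eta> z \<partial>lborel) = 0"
      using le Bochner_Integration.integral_nonneg[of lborel "\<lambda>z. v z * \<eta> z"] nonneg by (intro antisym) auto
    then have "AE z in lborel. v z * \<eta> z = 0"
      using integral_nonneg_eq_0_iff_AE[OF int[OF v]] nonneg by simp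
    then have "AE z in lborel. z \<notin> box a b"
    proof eventually_elim
      case (elim z)
      show ?case
      proof
        assume z: "z \<in> box a b"
        then have "v z > 0" "\<eta> z > 0" using ab box_bump_pos unfolding \<eta>_def by auto
        then show False using elim by simp
      qed
    qed
    then have "emeasure lborel (box a b) = 0"
      by (subst (asm) AE_iff_null) (auto simp: null_setsD1)
    then have "negligible (box a b)"
      by (simp add: negligible_iff_null_sets null_sets_def)
    then show False using ab(2) open_not_negligible[OF open_box, of a b] by auto
  qed
  have "\<bar>u x - u y\<bar> \<le> K * dist x y" for x y
    using main[of x "x - y"] main[of y "y - x"] by (auto simp: dist_norm norm_minus_commute abs_le_iff)
  then show ?thesis using K(2) by (auto intro!: lipschitz_onI simp: dist_real_def)
qed

text \<open>A Lipschitz function that reaches \<delta> at a point stays above \<delta>/2 on a ball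
  of fixed radius, which forces a definite amount of integral. The threshold \<open>c\<close> is
  uniform in the function and the point.\<close>

lemma lipschitz_Lp_int_pointwise:
  fixes L \<delta> :: real
  assumes "L \<ge> 0" "\<delta> > 0"
  obtains c :: real where "c > 0"
    "\<And>(w :: 'a::euclidean_space \<Rightarrow> real) x. L-lipschitz_on UNIV w \<Longrightarrow> Lp_int p w < ennreal c \<Longrightarrow> \<bar>w x\<bar> < \<delta>"
proof -
  \<comment> \<open>Ensures \<open>L * r \<le> \<delta> / 2\<close>; the added one covers
    \<open>L = 0\<close>.\<close>
  define r where "r = \<delta> / (2 * (L + 1))"
  have r: "r > 0" "L * r \<le> \<delta> / 2" using assms by (auto simp: r_def field_simps)
  define m where "m = unit_ball_vol (real DIM('a)) * r ^ DIM('a)"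
  have m: "m > 0" using r by (simp add: m_def)
  show ?thesis
  proof (rule that)
    show "(\<delta> / 2) ^ p * m > 0" using assms m by simp
    fix w :: "'a \<Rightarrow> real" and x
    assume w: "L-lipschitz_on UNIV w" and small: "Lp_int p w < ennreal ((\<delta> / 2) ^ p * m)"
    show "\<bar>w x\<bar> < \<delta>"
    proof (rule ccontr)
      assume "\<not> \<bar>w x\<bar> < \<delta>"
      then have wx: "\<bar>w x\<bar> \<ge> \<delta>" by simp
      have "\<bar>w y\<bar> \<ge> \<delta> / 2" if "y \<in> ball x r" for y
      proof -
        have "\<bar>w x - w y\<bar> \<le> L * dist x y" using lipschitz_onD[OF w, of x y] by (simp add: dist_real_def)
        also have "\<dots> \<le> L * r" using that assms by (intro mult_left_mono) auto
        finally show ?thesis using r(2) wx by linarith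
      qed
      then have "(\<integral>\<^sup>+y. ennreal ((\<delta> / 2) ^ p) * indicator (ball x r) y \<partial>lebesgue) \<le> Lp_int p w"
        unfolding Lp_int_def using assms
        by (intro nn_integral_mono) (auto simp: indicator_def intro!: ennreal_leI power_mono)
      also have "(\<integral>\<^sup>+y. ennreal ((\<delta> / 2) ^ p) * indicator (ball x r) y \<partial>lebesgue) = ennreal ((\<delta> / 2) ^ p * m)"
        using assms r m by (subst nn_integral_cmult_indicator) (auto simp: emeasure_ball m_def ennreal_mult)
      finally show False using small by simp
    qed
  qed
qed

lemma L2_Cauchy_imp_Lp6_Cauchy:
  assumes D: "\<And>n. D12g (u n) (g n)" and cau: "L2_Cauchy g" and "e > 0"
  obtains N where "\<And>m n. m \<ge> N \<Longrightarrow> n \<ge> N \<Longrightarrow> Lp_int 6 (\<lambda>x. u m x - u n x) < ennreal e"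
proof -
  \<comment> \<open>The cap at 1 lets \<open>d ^ 3\<close> be replaced by \<open>d\<close>, and the
    other entry absorbs the Sobolev constant.\<close>
  define d where "d = min 1 (e / (2 * 16777216))"
  have d: "d > 0" "d \<le> 1" "16777216 * d < e" using \<open>e > 0\<close> by (auto simp: d_def)
  obtain N where N: "\<And>m n. m \<ge> N \<Longrightarrow> n \<ge> N \<Longrightarrow> Lp_int 2 (\<lambda>x. g m x - g n x) < ennreal d"
    using cau d unfolding L2_Cauchy_def by blast
  have "Lp_int 6 (\<lambda>x. u m x - u n x) < ennreal e" if "m \<ge> N" "n \<ge> N" for m n
  proof -
    have "D12g (\<lambda>x. u m x - u n x) (\<lambda>x. g m x - g n x)"
      using D12g_lincomb[OF D D, of 1 m "-1" n] by simp
    then have "Lp_int 6 (\<lambda>x. u m x - u n x) \<le> 16777216 * Lp_int 2 (\<lambda>x. g m x - g n x) ^ 3"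
      by (rule D12g_Sobolev)
    also have "\<dots> \<le> 16777216 * ennreal d ^ 3"
      using N[OF that] by (intro mult_left_mono power_mono) auto
    also have "\<dots> = ennreal (16777216 * d ^ 3)" using d by (simp add: ennreal_power ennreal_mult)
    also have "\<dots> < ennreal e"
    proof (rule ennreal_lessI)
      have "d ^ 3 \<le> d ^ 1" using d by (intro power_decreasing) auto
      then show "16777216 * d ^ 3 < e" using d by simp
    qed fact
    finally show ?thesis .
  qed
  then show ?thesis by (rule that)
qed

text \<open>A diagonal choice: for each \<open>n\<close> a single test function within 1/(n+1) of
  \<open>u n\<close> in both senses; the triangle inequality then compares it with the
  limit.\<close>

lemma D12g_closed:
  assumes D: "\<And>n. D12g (u n) (g n)" and u: "(\<lambda>n. Lp_int 6 (\<lambda>x. u n x - v x)) \<longlonglongrightarrow> 0"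
    and g: "(\<lambda>n. Lp_int 2 (\<lambda>x. g n x - G x)) \<longlonglongrightarrow> 0"
    and v [measurable]: "v \<in> borel_measurable lebesgue" and G [measurable]: "G \<in> borel_measurable lebesgue"
  shows "D12g v G"
proof -
  note mD [measurable] = D12g_measurable(1,2)[OF D]
  have "\<exists>f\<in>test_functions. Lp_int 6 (\<lambda>x. f x - u n x) < ennreal (1 / Suc n) \<and>
      Lp_int 2 (\<lambda>x. classical_grad f x - g n x) < ennreal (1 / Suc n)" for n
  proof -
    obtain f where f: "\<And>k. f k \<in> test_functions" "(\<lambda>k. Lp_int 6 (\<lambda>x. f k x - u n x)) \<longlonglongrightarrow> 0"
      "(\<lambda>k. Lp_int 2 (\<lambda>x. classical_grad (f k) x - g n x)) \<longlonglongrightarrow> 0"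
      using D[of n] unfolding D12g_def by blast
    have "eventually (\<lambda>k. Lp_int 6 (\<lambda>x. f k x - u n x) < ennreal (1 / Suc n)) sequentially"
      "eventually (\<lambda>k. Lp_int 2 (\<lambda>x. classical_grad (f k) x - g n x) < ennreal (1 / Suc n)) sequentially"
      by (rule order_tendstoD(2)[OF f(2)], simp, rule order_tendstoD(2)[OF f(3)], simp)
    then have "eventually (\<lambda>k. Lp_int 6 (\<lambda>x. f k x - u n x) < ennreal (1 / Suc n) \<and>
        Lp_int 2 (\<lambda>x. classical_grad (f k) x - g n x) < ennreal (1 / Suc n)) sequentially"
      by (rule eventually_conj)
    then show ?thesis using f(1) eventually_happens' sequentially_bot by blast
  qed
  then have "\<forall>n. \<exists>f. f \<in> test_functions \<and> Lp_int 6 (\<lambda>x. f x - u n x) < ennreal (1 / Suc n) \<and>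
      Lp_int 2 (\<lambda>x. classical_grad f x - g n x) < ennreal (1 / Suc n)" by blast
  from choice[OF this] obtain f where "\<forall>n. f n \<in> test_functions \<and>
      Lp_int 6 (\<lambda>x. f n x - u n x) < ennreal (1 / Suc n) \<and>
      Lp_int 2 (\<lambda>x. classical_grad (f n) x - g n x) < ennreal (1 / Suc n)" ..
  then have f: "f n \<in> test_functions" "Lp_int 6 (\<lambda>x. f n x - u n x) < ennreal (1 / Suc n)"
    "Lp_int 2 (\<lambda>x. classical_grad (f n) x - g n x) < ennreal (1 / Suc n)" for n by blast+
  note C = test_functions_C1c[OF f(1)]
  note [measurable] = C1c_measurable_lebesgue[OF C] C1c_grad_measurable_lebesgue[OF C]
  have inv: "(\<lambda>n. ennreal (1 / Suc n)) \<longlonglongrightarrow> 0"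
    using LIMSEQ_inverse_real_of_nat by (simp add: ennreal_tendsto_0_iff inverse_eq_divide)
  have 6: "(\<lambda>n. Lp_int 6 (\<lambda>x. f n x - u n x)) \<longlonglongrightarrow> 0"
    by (rule tendsto_sandwich[OF _ _ tendsto_const inv]) (intro always_eventually allI, (rule zero_le | rule less_imp_le[OF f(2)]))+
  have 2: "(\<lambda>n. Lp_int 2 (\<lambda>x. classical_grad (f n) x - g n x)) \<longlonglongrightarrow> 0"
    by (rule tendsto_sandwich[OF _ _ tendsto_const inv]) (intro always_eventually allI, (rule zero_le | rule less_imp_le[OF f(3)]))+
  have "(\<lambda>n. Lp_int 6 (\<lambda>x. 1 *\<^sub>R (f n x - u n x) + 1 *\<^sub>R (u n x - v x))) \<longlonglongrightarrow> 0"
    by (rule Lp_int_tendsto_0_add[OF _ _ 6 u]) measurable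
  moreover have "(\<lambda>n. Lp_int 2 (\<lambda>x. 1 *\<^sub>R (classical_grad (f n) x - g n x) + 1 *\<^sub>R (g n x - G x))) \<longlonglongrightarrow> 0"
    by (rule Lp_int_tendsto_0_add[OF _ _ 2 g]) measurable
  moreover have "Lp_int 2 G < \<infinity>"
  proof -
    obtain n where n: "Lp_int 2 (\<lambda>x. g n x - G x) < \<infinity>" using tendsto_0_finite[OF g] .
    have "Lp_int 2 (\<lambda>x. g n x + (G x - g n x)) < \<infinity>"
      by (rule Lp_int_add_finite) (use n D12g_measurable(3)[OF D] in \<open>auto simp: Lp_int_minus_commute[of 2 G]\<close>)
    then show ?thesis by simp
  qed
  ultimately show ?thesis using f(1) v G unfolding D12g_def by auto
qed

section \<open>The constraint set: uniform Lipschitz bound and completeness\<close>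

lemma XB_grad_bound:
  assumes "u \<in> XB B" "AE x in lebesgue. norm (B x) \<le> M"
  shows "AE x in lebesgue. norm (weak_grad u x) \<le> sqrt (1 + M\<^sup>2)"
proof -
  have "AE x in lebesgue. (norm (weak_grad u x))\<^sup>2 + (weak_grad u x \<bullet> B x)\<^sup>2 \<le> 1 + (norm (B x))\<^sup>2"
    using assms(1) by (simp add: XB_def)
  then show ?thesis using assms(2)
  proof eventually_elim
    case (elim x)
    have "(norm (B x))\<^sup>2 \<le> M\<^sup>2" using elim(2) by (intro power_mono) auto
    then have "(norm (weak_grad u x))\<^sup>2 \<le> 1 + M\<^sup>2" using elim(1) by (smt (verit) zero_le_power2)
    then show ?case by (rule real_le_rsqrt)
  qed
qed

lemma XB_D12g: "u \<in> XB B \<Longrightarrow> D12g u (weak_grad u)"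
  by (simp add: XB_def D12_weak_grad)

text \<open>Replaces the unspecified constant of \<open>C01\<close> by one depending only on the
  bound for \<open>B\<close>, so that it survives pointwise limits.\<close>

lemma XB_lipschitz:
  assumes "u \<in> XB B" "AE x in lebesgue. norm (B x) \<le> M"
  shows "(sqrt (1 + M\<^sup>2))-lipschitz_on UNIV u"
proof (rule weak_grad_bound_lipschitz[OF _ D12g_has_weak_grad[OF XB_D12g] XB_grad_bound])
  show "continuous_on UNIV u"
    using assms(1) by (auto simp: XB_def C01_def intro: lipschitz_on_continuous_on)
qed (use assms in auto)

text \<open>The limit \<open>v\<close> is built as a limit at every point, so it is literally
  Lipschitz and not merely equal almost everywhere to a Lipschitz function. The subsequence is part
  of the conclusion because convergence of gradients almost everywhere is needed again for lower
  semicontinuity.\<close>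

lemma XB_complete:
  assumes u: "\<And>n. u n \<in> XB B" and cau: "L2_Cauchy (\<lambda>n. weak_grad (u n))"
    and M: "AE x in lebesgue. norm (B x) \<le> M"
  obtains v s where "v \<in> XB B" "strict_mono s"
    "AE x in lebesgue. (\<lambda>k. weak_grad (u (s k)) x) \<longlonglongrightarrow> weak_grad v x"
    "(\<lambda>n. D12_norm (\<lambda>x. u n x - v x)) \<longlonglongrightarrow> 0"
proof -
  define g where "g n = weak_grad (u n)" for n
  define K where "K = sqrt (1 + M\<^sup>2)"
  have K: "K \<ge> 0" by (simp add: K_def)
  have D: "D12g (u n) (g n)" for n unfolding g_def by (rule XB_D12g[OF u])
  note mD [measurable] = D12g_measurable(1,2)[OF D]
  have L: "K-lipschitz_on UNIV (u n)" for n unfolding K_def by (rule XB_lipschitz[OF u M])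
  have cau': "L2_Cauchy g" using cau by (simp add: g_def[abs_def])
  obtain G s where G [measurable]: "G \<in> borel_measurable lebesgue" and s: "strict_mono s"
    and AE: "AE x in lebesgue. (\<lambda>k. g (s k) x) \<longlonglongrightarrow> G x"
    and lim: "(\<lambda>n. Lp_int 2 (\<lambda>x. g n x - G x)) \<longlonglongrightarrow> 0"
    using L2_complete[OF mD(2) cau'] .
  have "Cauchy (\<lambda>n. u n x)" for x
  proof (rule metric_CauchyI)
    fix e :: real assume "e > 0"
    \<comment> \<open>Differences of two members have Lipschitz constant \<open>K + K\<close>, so
      smallness in L^6 makes them uniformly small at every point.\<close>
    then obtain c where c: "c > 0" "\<And>(w :: real^3 \<Rightarrow> real) x. (K + K)-lipschitz_on UNIV w \<Longrightarrow> Lp_int 6 w < ennreal c \<Longrightarrow> \<bar>w x\<bar> < e"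
      using lipschitz_Lp_int_pointwise[of "K + K" e 6] K by auto
    obtain N where N: "\<And>m n. m \<ge> N \<Longrightarrow> n \<ge> N \<Longrightarrow> Lp_int 6 (\<lambda>x. u m x - u n x) < ennreal c"
      using L2_Cauchy_imp_Lp6_Cauchy[OF D cau' c(1)] by blast
    have "dist (u m x) (u n x) < e" if "m \<ge> N" "n \<ge> N" for m n
      using c(2)[OF lipschitz_on_diff[OF L L] N[OF that], of x] by (simp add: dist_real_def)
    then show "\<exists>N. \<forall>m\<ge>N. \<forall>n\<ge>N. dist (u m x) (u n x) < e" by blast
  qed
  then have "\<exists>l. (\<lambda>n. u n x) \<longlonglongrightarrow> l" for x
    by (simp add: Cauchy_convergent_iff convergent_def)
  then obtain v where v: "\<And>x. (\<lambda>n. u n x) \<longlonglongrightarrow> v x" by metis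
  have Lv: "K-lipschitz_on UNIV v"
  proof (rule lipschitz_onI[OF _ K])
    fix x y
    have "(\<lambda>n. dist (u n x) (u n y)) \<longlonglongrightarrow> dist (v x) (v y)" by (intro tendsto_dist v)
    then show "dist (v x) (v y) \<le> K * dist x y"
      by (rule LIMSEQ_le_const2) (use lipschitz_onD[OF L] in auto)
  qed
  have vm [measurable]: "v \<in> borel_measurable lebesgue"
    by (rule borel_measurable_LIMSEQ_real[OF v mD(1)])
  have lim6: "(\<lambda>n. Lp_int 6 (\<lambda>x. u n x - v x)) \<longlonglongrightarrow> 0"
  proof (rule order_tendstoI)
    fix a :: ennreal assume "0 < a"
    then obtain e where e: "0 < e" "ennreal e < a"
      by (metis ennreal_less_zero_iff ennreal_cases dense infinity_ennreal_def less_top_ennreal order_less_trans)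
    then obtain N where N: "\<And>m n. m \<ge> N \<Longrightarrow> n \<ge> N \<Longrightarrow> Lp_int 6 (\<lambda>x. u m x - u n x) < ennreal e"
      using L2_Cauchy_imp_Lp6_Cauchy[OF D cau' e(1)] by blast
    \<comment> \<open>Fatou in the second index of the L^6 Cauchy condition, with \<open>n\<close>
      fixed.\<close>
    have "Lp_int 6 (\<lambda>x. u n x - v x) \<le> ennreal e" if "n \<ge> N" for n
      unfolding Lp_int_def
    proof (rule nn_integral_Fatou_le)
      show "AE x in lebesgue. (\<lambda>k. norm (u n x - u k x) ^ 6) \<longlonglongrightarrow> norm (u n x - v x) ^ 6"
        by (intro AE_I2 tendsto_intros v)
      show "eventually (\<lambda>k. (\<integral>\<^sup>+x. ennreal (norm (u n x - u k x) ^ 6) \<partial>lebesgue) \<le> ennreal e) sequentially"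
        unfolding eventually_sequentially using N[OF that] by (auto simp: Lp_int_def intro!: exI[of _ N] less_imp_le)
    qed auto
    then show "eventually (\<lambda>n. Lp_int 6 (\<lambda>x. u n x - v x) < a) sequentially"
      unfolding eventually_sequentially using e(2) by (meson order_le_less_trans)
  qed simp
  have Dv: "D12g v G" by (rule D12g_closed[OF D lim6 lim vm G])
  have wv: "AE x in lebesgue. weak_grad v x = G x" by (rule D12g_weak_grad[OF Dv])
  have lim_wv: "AE x in lebesgue. (\<lambda>k. weak_grad (u (s k)) x) \<longlonglongrightarrow> weak_grad v x"
    using AE wv by eventually_elim (simp add: g_def)
  have "AE x in lebesgue. \<forall>n. (norm (weak_grad (u n) x))\<^sup>2 + (weak_grad (u n) x \<bullet> B x)\<^sup>2 \<le> 1 + (norm (B x))\<^sup>2"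
    unfolding AE_all_countable using u by (simp add: XB_def)
  then have "AE x in lebesgue. (norm (weak_grad v x))\<^sup>2 + (weak_grad v x \<bullet> B x)\<^sup>2 \<le> 1 + (norm (B x))\<^sup>2"
    using lim_wv
  proof eventually_elim
    case (elim x)
    have "(\<lambda>k. (norm (weak_grad (u (s k)) x))\<^sup>2 + (weak_grad (u (s k)) x \<bullet> B x)\<^sup>2) \<longlonglongrightarrow>
        (norm (weak_grad v x))\<^sup>2 + (weak_grad v x \<bullet> B x)\<^sup>2"
      by (intro tendsto_intros elim(2))
    then show ?case by (rule LIMSEQ_le_const2) (use elim(1) in auto)
  qed
  then have vXB: "v \<in> XB B"
    using D12g_imp_D12[OF Dv] Lv by (auto simp: XB_def C01_def)
  have "(\<lambda>n. D12_norm (\<lambda>x. u n x - v x)) \<longlonglongrightarrow> 0"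
  proof -
    have "D12g (\<lambda>x. u n x - v x) (\<lambda>x. g n x - G x)" for n
      using D12g_lincomb[OF D Dv, of 1 n "-1"] by simp
    note D12_norm_Lp_int[OF this]
    with lim have "(\<lambda>n. ennreal (D12_norm (\<lambda>x. u n x - v x) ^ 2)) \<longlonglongrightarrow> 0"
      by (simp only:)
    then have "(\<lambda>n. D12_norm (\<lambda>x. u n x - v x) ^ 2) \<longlonglongrightarrow> 0"
      by (subst (asm) ennreal_tendsto_0_iff) auto
    then have "(\<lambda>n. sqrt (D12_norm (\<lambda>x. u n x - v x) ^ 2)) \<longlonglongrightarrow> sqrt 0" by (rule tendsto_real_sqrt)
    then show ?thesis by (simp add: D12_norm_def)
  qed
  then show ?thesis by (rule that[OF vXB s lim_wv])
qed

section \<open>The energy density\<close>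

text \<open>Bernoulli's inequality for exponents below 1, read off from Young's inequality with one
  factor equal to 1, and rescaled from the point 1 to the point \<open>z\<close>.\<close>

lemma powr_tangent:
  fixes y z p :: real
  assumes "y \<ge> 0" "z > 0" "0 < p" "p < 1"
  shows "y powr p \<le> z powr p + p * z powr (p - 1) * (y - z)"
proof -
  have bern: "x powr p \<le> 1 + p * (x - 1)" if "x \<ge> 0" for x
  proof (cases "x = 0")
    case False
    then show ?thesis
      using Youngs_inequality_0[of p "1 - p" x 1] that assms by (simp add: algebra_simps)
  qed (use assms in simp)
  have "y powr p = z powr p * (y / z) powr p"
    using assms by (simp add: powr_divide)
  also have "\<dots> \<le> z powr p * (1 + p * (y / z - 1))"
    using bern[of "y / z"] assms by (intro mult_left_mono) auto
  also have "\<dots> = z powr p + p * z powr (p - 1) * (y - z)"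
    using assms by (simp add: powr_diff field_simps)
  finally show ?thesis .
qed

text \<open>Average the tangent inequalities at z = (\<alpha> + \<beta>)/2 + d for the two points:
  both together lie 2d below 2z, which yields the gain with slope \<open>p * z powr (p - 1)\<close>.
  Since z <= c and p < 1, this slope is at least the one at \<open>c\<close>.\<close>

lemma powr_uniformly_concave:
  fixes \<alpha> \<beta> d c p :: real
  assumes "\<alpha> \<ge> 0" "\<beta> \<ge> 0" "d \<ge> 0" "(\<alpha> + \<beta>) / 2 + d \<le> c" "0 < p" "p < 1"
  shows "(\<alpha> powr p + \<beta> powr p) / 2 + p * c powr (p - 1) * d \<le> ((\<alpha> + \<beta>) / 2 + d) powr p"
proof (cases "(\<alpha> + \<beta>) / 2 + d = 0")
  \<comment> \<open>There is no tangent at 0, but then \<alpha>, \<beta> and d all vanish.\<close>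
  case True
  then have sum: "\<alpha> + \<beta> + 2 * d = 0" by (simp add: field_simps)
  have "\<alpha> = 0" using sum assms(1-3) by linarith
  moreover have "\<beta> = 0" using sum assms(1-3) by linarith
  moreover have "d = 0" using sum assms(1-3) by linarith
  ultimately show ?thesis by simp
next
  case False
  define z where "z = (\<alpha> + \<beta>) / 2 + d"
  have z: "z > 0" using False assms by (auto simp: z_def less_le)
  define X Y where "X = p * z powr (p - 1) * (\<alpha> - z)" and "Y = p * z powr (p - 1) * (\<beta> - z)"
  have "\<alpha> powr p \<le> z powr p + X" "\<beta> powr p \<le> z powr p + Y"
    unfolding X_def Y_def using assms z by (intro powr_tangent; simp)+
  moreover have "X + Y = - (2 * (p * z powr (p - 1) * d))"
  proof -
    have "X + Y = p * z powr (p - 1) * ((\<alpha> - z) + (\<beta> - z))"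
      unfolding X_def Y_def by (rule distrib_left[symmetric])
    also have "(\<alpha> - z) + (\<beta> - z) = - (2 * d)" by (simp add: z_def)
    finally show ?thesis by simp
  qed
  ultimately have 1: "(\<alpha> powr p + \<beta> powr p) / 2 + p * z powr (p - 1) * d \<le> z powr p"
    unfolding add_divide_distrib by linarith
  have "c powr (p - 1) \<le> z powr (p - 1)"
    using assms z by (intro powr_mono2') (auto simp: z_def)
  then have "p * c powr (p - 1) * d \<le> p * z powr (p - 1) * d"
    using assms by (intro mult_right_mono mult_left_mono) auto
  with 1 show ?thesis by (simp add: z_def)
qed

text \<open>The quadratic form of the matrix I + b b^T; the constraint in \<open>XB\<close> says
  that it is at most 1 + |b|^2.\<close>

definition anis :: "'a::real_inner \<Rightarrow> 'a \<Rightarrow> real" where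
  "anis b \<xi> = (norm \<xi>)\<^sup>2 + (\<xi> \<bullet> b)\<^sup>2"

text \<open>The exponent \<open>p\<close> stands for \<open>q / 2\<close>. The body follows the
  integrand of \<open>I_B\<close>; \<open>energy_density_alt\<close> rewrites it through
  \<open>anis\<close>.\<close>

definition energy_density :: "real \<Rightarrow> 'a::real_inner \<Rightarrow> 'a \<Rightarrow> real" where
  "energy_density p b \<xi> = 1 - (1 + (norm b)\<^sup>2 - (norm \<xi>)\<^sup>2 - (\<xi> \<bullet> b)\<^sup>2) powr p"

lemma anis_nonneg: "0 \<le> anis b \<xi>"
  by (simp add: anis_def)

lemma norm_le_anis: "(norm \<xi>)\<^sup>2 \<le> anis b \<xi>"
  by (simp add: anis_def)

lemma anis_scaleR: "anis b (t *\<^sub>R \<xi>) = t\<^sup>2 * anis b \<xi>"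
  by (simp add: anis_def power_mult_distrib distrib_left)

lemma anis_le: "anis b \<xi> \<le> (1 + (norm b)\<^sup>2) * (norm \<xi>)\<^sup>2"
proof -
  have "(\<xi> \<bullet> b)\<^sup>2 \<le> (norm \<xi> * norm b)\<^sup>2"
    using Cauchy_Schwarz_ineq2[of \<xi> b] by (metis abs_ge_zero power2_abs power_mono)
  then show ?thesis by (simp add: anis_def power_mult_distrib algebra_simps)
qed

text \<open>Convexity of the square with the missing weight 1 - a - b placed at 0.\<close>

lemma square_convex_combination_le:
  fixes a b x y :: real
  assumes "a \<ge> 0" "b \<ge> 0" "a + b \<le> 1"
  shows "(a * x + b * y)\<^sup>2 \<le> a * x\<^sup>2 + b * y\<^sup>2"
proof -
  have "a * b * x\<^sup>2 \<le> a * (1 - a) * x\<^sup>2" "a * b * y\<^sup>2 \<le> b * (1 - b) * y\<^sup>2"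
    using assms mult_left_mono[of b "1 - a" a] mult_left_mono[of a "1 - b" b]
    by (auto intro!: mult_right_mono simp: mult.commute)
  moreover have "a * b * (x - y)\<^sup>2 \<ge> 0" using assms by simp
  ultimately show ?thesis by (simp add: power2_eq_square algebra_simps)
qed

lemma anis_lincomb_le:
  assumes "\<bar>s\<bar> + \<bar>t\<bar> \<le> 1"
  shows "anis b (s *\<^sub>R \<xi> + t *\<^sub>R \<eta>) \<le> \<bar>s\<bar> * anis b \<xi> + \<bar>t\<bar> * anis b \<eta>"
proof -
  have 1: "(norm (s *\<^sub>R \<xi> + t *\<^sub>R \<eta>))\<^sup>2 \<le> \<bar>s\<bar> * (norm \<xi>)\<^sup>2 + \<bar>t\<bar> * (norm \<eta>)\<^sup>2"
  proof -
    have "(norm (s *\<^sub>R \<xi> + t *\<^sub>R \<eta>))\<^sup>2 \<le> (\<bar>s\<bar> * norm \<xi> + \<bar>t\<bar> * norm \<eta>)\<^sup>2"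
      using norm_triangle_ineq[of "s *\<^sub>R \<xi>" "t *\<^sub>R \<eta>"] by (intro power_mono) auto
    then show ?thesis using square_convex_combination_le[of "\<bar>s\<bar>" "\<bar>t\<bar>"] assms by (meson abs_ge_zero order_trans)
  qed
  have "((s *\<^sub>R \<xi> + t *\<^sub>R \<eta>) \<bullet> b)\<^sup>2 = \<bar>s * (\<xi> \<bullet> b) + t * (\<eta> \<bullet> b)\<bar>\<^sup>2"
    by (simp add: inner_add_left)
  also have "\<dots> \<le> (\<bar>s\<bar> * \<bar>\<xi> \<bullet> b\<bar> + \<bar>t\<bar> * \<bar>\<eta> \<bullet> b\<bar>)\<^sup>2"
    by (intro power_mono order_trans[OF abs_triangle_ineq]) (auto simp: abs_mult)
  also have "\<dots> \<le> \<bar>s\<bar> * \<bar>\<xi> \<bullet> b\<bar>\<^sup>2 + \<bar>t\<bar> * \<bar>\<eta> \<bullet> b\<bar>\<^sup>2"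
    by (rule square_convex_combination_le) (use assms in auto)
  finally show ?thesis using 1 unfolding anis_def by (simp add: algebra_simps)
qed

text \<open>The parallelogram law of the quadratic form; its last term is the source of the
  quadratic gain at midpoints.\<close>

lemma anis_midpoint: "anis b ((1/2) *\<^sub>R \<xi> + (1/2) *\<^sub>R \<eta>) = (anis b \<xi> + anis b \<eta>) / 2 - anis b (\<xi> - \<eta>) / 4"
  unfolding anis_def power2_norm_eq_inner
  by (simp add: inner_simps inner_commute power2_eq_square field_simps)

lemma energy_density_alt: "energy_density p b \<xi> = 1 - (1 + (norm b)\<^sup>2 - anis b \<xi>) powr p"
  by (simp add: energy_density_def anis_def algebra_simps)

text \<open>The tangent inequality at 1. It supplies coercivity, and also the integrable lower bound
  \<open>- p * (norm b)\<^sup>2\<close> that Fatou's lemma requires.\<close>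

lemma energy_density_lower:
  assumes "anis b \<xi> \<le> 1 + (norm b)\<^sup>2" "0 < p" "p < 1"
  shows "p * (anis b \<xi> - (norm b)\<^sup>2) \<le> energy_density p b \<xi>"
  using powr_tangent[of "1 + (norm b)\<^sup>2 - anis b \<xi>" 1 p] assms
  by (simp add: energy_density_alt algebra_simps)

lemma le_powr_01:
  fixes y p :: real
  assumes "0 \<le> y" "y \<le> 1" "0 < p" "p < 1"
  shows "y \<le> y powr p"
  using powr_mono'[of p 1 y] assms by (cases "y = 0") auto

text \<open>If \<open>anis b \<xi>\<close> is at least |b|^2, the base lies in [0, 1], where y <=
  y^p; otherwise the base exceeds 1 and the density is not positive.\<close>

lemma energy_density_upper:
  assumes "anis b \<xi> \<le> 1 + (norm b)\<^sup>2" "0 < p" "p < 1"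
  shows "energy_density p b \<xi> \<le> anis b \<xi>"
proof (cases "(norm b)\<^sup>2 \<le> anis b \<xi>")
  case True
  have "1 + (norm b)\<^sup>2 - anis b \<xi> \<le> (1 + (norm b)\<^sup>2 - anis b \<xi>) powr p"
    using assms True by (intro le_powr_01) auto
  then show ?thesis unfolding energy_density_alt using zero_le_power2[of "norm b"] by linarith
next
  case False
  then have "1 \<le> (1 + (norm b)\<^sup>2 - anis b \<xi>) powr p"
    using assms by (intro ge_one_powr_ge_zero) auto
  then show ?thesis using anis_nonneg[of b \<xi>] by (simp add: energy_density_alt)
qed

lemma energy_density_abs:
  assumes "anis b \<xi> \<le> 1 + (norm b)\<^sup>2" "0 < p" "p < 1"
  shows "\<bar>energy_density p b \<xi>\<bar> \<le> anis b \<xi> + (norm b)\<^sup>2"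
proof -
  have "p * (norm b)\<^sup>2 \<le> 1 * (norm b)\<^sup>2" using assms by (intro mult_right_mono) auto
  moreover have "0 \<le> p * anis b \<xi>" using assms anis_nonneg[of b \<xi>] by simp
  ultimately show ?thesis
    using energy_density_lower[OF assms] energy_density_upper[OF assms] zero_le_power2[of "norm b"] anis_nonneg[of b \<xi>]
    unfolding abs_le_iff right_diff_distrib by linarith
qed

text \<open>Uniform concavity of the power with gain d = \<open>anis b (\<xi> - \<eta>) / 4\<close>
  from the parallelogram law. The bound on |b| turns the slope at 1 + |b|^2 into a constant
  independent of the point.\<close>

lemma energy_density_midpoint:
  assumes "anis b \<xi> \<le> 1 + (norm b)\<^sup>2" "anis b \<eta> \<le> 1 + (norm b)\<^sup>2" "0 < p" "p < 1" "norm b \<le> M"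
  shows "energy_density p b ((1/2) *\<^sub>R \<xi> + (1/2) *\<^sub>R \<eta>) \<le> (energy_density p b \<xi> + energy_density p b \<eta>) / 2
     - p * (1 + M\<^sup>2) powr (p - 1) * ((norm (\<xi> - \<eta>))\<^sup>2 / 4)"
proof -
  let ?c = "1 + (norm b)\<^sup>2" and ?d = "anis b (\<xi> - \<eta>) / 4"
  have mid: "?c - anis b ((1/2) *\<^sub>R \<xi> + (1/2) *\<^sub>R \<eta>) = ((?c - anis b \<xi>) + (?c - anis b \<eta>)) / 2 + ?d"
    unfolding anis_midpoint by (simp add: field_simps)
  have "((?c - anis b \<xi>) powr p + (?c - anis b \<eta>) powr p) / 2 + p * ?c powr (p - 1) * ?d
      \<le> (((?c - anis b \<xi>) + (?c - anis b \<eta>)) / 2 + ?d) powr p"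
  proof (rule powr_uniformly_concave)
    show "((?c - anis b \<xi>) + (?c - anis b \<eta>)) / 2 + ?d \<le> ?c"
      unfolding mid[symmetric] using anis_nonneg[of b "(1/2) *\<^sub>R \<xi> + (1/2) *\<^sub>R \<eta>"] by simp
  qed (use assms anis_nonneg[of b "\<xi> - \<eta>"] in auto)
  moreover have "p * (1 + M\<^sup>2) powr (p - 1) * ((norm (\<xi> - \<eta>))\<^sup>2 / 4) \<le> p * ?c powr (p - 1) * ?d"
  proof (intro mult_mono mult_left_mono)
    have "(norm b)\<^sup>2 \<le> M\<^sup>2" using assms(5) by (intro power_mono) auto
    then show "(1 + M\<^sup>2) powr (p - 1) \<le> ?c powr (p - 1)"
      using assms zero_le_power2[of "norm b"] by (intro powr_mono2') (auto simp: add_pos_nonneg)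
    show "(norm (\<xi> - \<eta>))\<^sup>2 / 4 \<le> ?d" using norm_le_anis[of "\<xi> - \<eta>" b] by simp
  qed (use assms in auto)
  ultimately show ?thesis 
    unfolding energy_density_alt mid add_divide_distrib diff_divide_distrib by linarith
qed

text \<open>Normalise by c = 1 + |b|^2: the ratio (c - s)/c lies in [0, 1] and so is at most its
  p-th power, whence c^p - c^(p-1) s <= (c - s)^p; and c^(p-1) <= 1. The increment is quadratic in
  \<open>t\<close>, so a linear term dominates it for small \<open>t\<close>.\<close>

lemma energy_density_scaled:
  assumes "anis b \<xi> \<le> 1 + (norm b)\<^sup>2" "0 < p" "p < 1" "\<bar>t\<bar> \<le> 1"
  shows "energy_density p b (t *\<^sub>R \<xi>) \<le> energy_density p b 0 + t\<^sup>2 * anis b \<xi>"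
proof -
  let ?c = "1 + (norm b)\<^sup>2" and ?s = "t\<^sup>2 * anis b \<xi>"
  have c: "?c \<ge> 1" by simp
  then have cpos: "?c > 0" by linarith
  have "t\<^sup>2 \<le> 1" using assms(4) by (simp add: abs_square_le_1)
  then have "?s \<le> 1 * anis b \<xi>" using anis_nonneg by (intro mult_right_mono) auto
  then have s: "0 \<le> ?s" "?s \<le> ?c" using assms anis_nonneg[of b \<xi>] by auto
  have "(?c - ?s) / ?c \<le> ((?c - ?s) / ?c) powr p"
  proof (intro le_powr_01)
    show "0 \<le> (?c - ?s) / ?c" using s cpos by (intro divide_nonneg_pos) auto
    show "(?c - ?s) / ?c \<le> 1" using s cpos by (subst divide_le_eq_1_pos) linarith+
  qed fact+
  then have "?c powr p * ((?c - ?s) / ?c) \<le> ?c powr p * ((?c - ?s) / ?c) powr p"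
    by (intro mult_left_mono) auto
  also have "\<dots> = (?c - ?s) powr p"
  proof -
    have "x powr p * (y / x) powr p = y powr p" if "x > 0" "y \<ge> 0" for x y :: real
      using that by (simp add: powr_divide)
    from this[OF cpos] s(2) show ?thesis by simp
  qed
  also have "?c powr p * ((?c - ?s) / ?c) = ?c powr p - ?c powr (p - 1) * ?s"
  proof -
    have "x powr p * ((x - y) / x) = x powr p - x powr (p - 1) * y" if "x > 0" for x y :: real
      using that by (simp add: powr_diff field_simps)
    from this[OF cpos] show ?thesis .
  qed
  finally have "?c powr p - ?c powr (p - 1) * ?s \<le> (?c - ?s) powr p" .
  moreover have "?c powr (p - 1) * ?s \<le> 1 * ?s"
  proof (rule mult_right_mono[OF _ s(1)])
    show "?c powr (p - 1) \<le> 1" using powr_mono[of "p - 1" 0 ?c] c assms by simp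
  qed
  ultimately have "?c powr p - ?s \<le> (?c - ?s) powr p" by linarith
  then show ?thesis unfolding energy_density_alt anis_scaleR by (simp add: anis_def)
qed

section \<open>The variational problem\<close>

lemma continuous_AE_eq_imp_eq:
  fixes f g :: "'a::euclidean_space \<Rightarrow> real"
  assumes "continuous_on UNIV f" "continuous_on UNIV g" "AE x in lebesgue. f x = g x"
  shows "f = g"
proof (rule ccontr)
  assume "f \<noteq> g"
  then obtain x where x: "f x \<noteq> g x" by auto
  have "open {x. f x \<noteq> g x}" by (rule open_Collect_neq[OF assms(1,2)])
  moreover have "negligible {x. f x \<noteq> g x}"
    using assms(3) unfolding negligible_iff_null_sets eventually_ae_filter
    by (auto intro: completion.complete2)
  ultimately show False using open_not_negligible x by blast
qed

lemma D12_norm_power2: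
  assumes "D12g u g"
  shows "integrable lebesgue (\<lambda>x. (norm (g x))\<^sup>2)" "(D12_norm u)\<^sup>2 = (\<integral>x. (norm (g x))\<^sup>2 \<partial>lebesgue)"
proof -
  show "integrable lebesgue (\<lambda>x. (norm (g x))\<^sup>2)"
    using Lp_int_2_eq_integral(1)[OF D12g_measurable(2,3)[OF assms]] .
  have "ennreal ((D12_norm u)\<^sup>2) = ennreal (\<integral>x. (norm (g x))\<^sup>2 \<partial>lebesgue)"
    using Lp_int_2_eq_integral(2)[OF D12g_measurable(2,3)[OF assms]] D12_norm_Lp_int[OF assms] by simp
  then show "(D12_norm u)\<^sup>2 = (\<integral>x. (norm (g x))\<^sup>2 \<partial>lebesgue)"
    by (simp add: ennreal_inj)
qed

lemma D12_norm_nonneg: "D12_norm u \<ge> 0"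
  by (simp add: D12_norm_def)

locale born_infeld =
  fixes q :: real and B :: "real^3 \<Rightarrow> real^3" and \<rho> :: "(real^3 \<Rightarrow> real) \<Rightarrow> real"
  assumes q: "1 \<le> q" "q < 2" and B: "B \<in> L2 \<inter> Linf" and \<rho>: "\<rho> \<in> XB_dual B"
begin

text \<open>Some essential bound for |B|; it need not be the essential supremum.\<close>

definition M :: real where "M = (SOME M. AE x in lebesgue. norm (B x) \<le> M)"

lemma AE_B: "AE x in lebesgue. norm (B x) \<le> M"
  using B someI_ex[of "\<lambda>M. AE x in lebesgue. norm (B x) \<le> M"] unfolding Linf_def M_def by blast

lemma B_measurable [measurable]: "B \<in> borel_measurable lebesgue"
  using B by (simp add: L2_def)

lemma B_integrable: "integrable lebesgue (\<lambda>x. (norm (B x))\<^sup>2)"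
  using B by (simp add: L2_def)

definition F :: "(real^3 \<Rightarrow> real) \<Rightarrow> real" where
  "F u = (\<integral>x. energy_density (q / 2) (B x) (weak_grad u x) \<partial>lebesgue)"

lemma I_B_eq: "I_B q B \<rho> u = F u / q - \<rho> u"
  by (simp add: I_B_def F_def energy_density_def)

lemma p: "0 < q / 2" "q / 2 < 1"
  using q by auto

lemma XB_AE: "u \<in> XB B \<Longrightarrow> AE x in lebesgue. anis (B x) (weak_grad u x) \<le> 1 + (norm (B x))\<^sup>2"
  by (simp add: XB_def anis_def)

lemma XB_measurable: "u \<in> XB B \<Longrightarrow> weak_grad u \<in> borel_measurable lebesgue"
  by (rule D12g_measurable(2)[OF XB_D12g])

lemma XB_continuous: "u \<in> XB B \<Longrightarrow> continuous_on UNIV u"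
  by (rule lipschitz_on_continuous_on[OF XB_lipschitz[OF _ AE_B]])

lemma anis_integrable:
  assumes "u \<in> XB B"
  shows "integrable lebesgue (\<lambda>x. anis (B x) (weak_grad u x))"
proof (rule Bochner_Integration.integrable_bound)
  note [measurable] = XB_measurable[OF assms]
  show "integrable lebesgue (\<lambda>x. (1 + M\<^sup>2) * (norm (weak_grad u x))\<^sup>2)"
    by (intro integrable_mult_right D12_norm_power2(1)[OF XB_D12g[OF assms]])
  show "(\<lambda>x. anis (B x) (weak_grad u x)) \<in> borel_measurable lebesgue"
    unfolding anis_def by measurable
  show "AE x in lebesgue. norm (anis (B x) (weak_grad u x)) \<le> norm ((1 + M\<^sup>2) * (norm (weak_grad u x))\<^sup>2)"
    using AE_B
  proof eventually_elim
    case (elim x)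
    have "(norm (B x))\<^sup>2 \<le> M\<^sup>2" using elim by (intro power_mono) auto
    then have "(1 + (norm (B x))\<^sup>2) * (norm (weak_grad u x))\<^sup>2 \<le> (1 + M\<^sup>2) * (norm (weak_grad u x))\<^sup>2"
      by (intro mult_right_mono) auto
    with anis_le[of "B x" "weak_grad u x"] anis_nonneg[of "B x" "weak_grad u x"] show ?case by simp
  qed
qed

lemma density_measurable:
  assumes [measurable]: "g \<in> borel_measurable lebesgue"
  shows "(\<lambda>x. energy_density (q / 2) (B x) (g x)) \<in> borel_measurable lebesgue"
  unfolding energy_density_def by measurable

lemma density_integrable:
  assumes "u \<in> XB B"
  shows "integrable lebesgue (\<lambda>x. energy_density (q / 2) (B x) (weak_grad u x))"
proof (rule Bochner_Integration.integrable_bound)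
  show "integrable lebesgue (\<lambda>x. anis (B x) (weak_grad u x) + (norm (B x))\<^sup>2)"
    by (intro Bochner_Integration.integrable_add anis_integrable[OF assms] B_integrable)
  show "AE x in lebesgue. norm (energy_density (q / 2) (B x) (weak_grad u x)) \<le> norm (anis (B x) (weak_grad u x) + (norm (B x))\<^sup>2)"
    using XB_AE[OF assms]
  proof eventually_elim
    case (elim x)
    then show ?case using energy_density_abs[OF elim p] anis_nonneg[of "B x" "weak_grad u x"] by simp
  qed
qed (rule density_measurable[OF XB_measurable[OF assms]])

section \<open>Convexity and symmetry of the constraint set\<close>

lemma weak_grad_lincomb:
  assumes "u \<in> XB B" "v \<in> XB B"
  shows "D12g (\<lambda>x. s * u x + t * v x) (\<lambda>x. s *\<^sub>R weak_grad u x + t *\<^sub>R weak_grad v x)"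
  by (rule D12g_lincomb[OF XB_D12g[OF assms(1)] XB_D12g[OF assms(2)]])

text \<open>The condition on the absolute weights covers midpoints, reflections and shrinking in one
  statement.\<close>

lemma XB_lincomb:
  assumes "u \<in> XB B" "v \<in> XB B" "\<bar>s\<bar> + \<bar>t\<bar> \<le> 1"
  shows "(\<lambda>x. s * u x + t * v x) \<in> XB B"
proof -
  note D = weak_grad_lincomb[OF assms(1,2), of s t]
  have "AE x in lebesgue. anis (B x) (weak_grad (\<lambda>x. s * u x + t * v x) x) \<le> 1 + (norm (B x))\<^sup>2"
    using D12g_weak_grad[OF D] XB_AE[OF assms(1)] XB_AE[OF assms(2)]
  proof eventually_elim
    case (elim x)
    let ?c = "1 + (norm (B x))\<^sup>2"
    have "anis (B x) (s *\<^sub>R weak_grad u x + t *\<^sub>R weak_grad v x) \<le> \<bar>s\<bar> * anis (B x) (weak_grad u x) + \<bar>t\<bar> * anis (B x) (weak_grad v x)"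
      by (rule anis_lincomb_le[OF assms(3)])
    also have "\<dots> \<le> \<bar>s\<bar> * ?c + \<bar>t\<bar> * ?c"
      using elim by (intro add_mono mult_left_mono) auto
    also have "\<dots> = (\<bar>s\<bar> + \<bar>t\<bar>) * ?c" by (simp add: distrib_right)
    also have "\<dots> \<le> 1 * ?c" using assms(3) by (intro mult_right_mono) auto
    finally show ?case using elim(1) by simp
  qed
  moreover have "(\<lambda>x. s * u x + t * v x) \<in> C01"
    using lipschitz_on_add[OF lipschitz_on_cmult_real lipschitz_on_cmult_real] assms(1,2)
    unfolding XB_def C01_def by blast
  ultimately show ?thesis using D12g_imp_D12[OF D] by (simp add: XB_def anis_def)
qed

lemma XB_zero: "(\<lambda>x. 0) \<in> XB B"
proof -
  have D: "D12g (\<lambda>x. 0) (\<lambda>x. 0)"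
    unfolding D12g_def
  proof (intro conjI exI[of _ "\<lambda>n x. 0"] allI zero_test_function)
    have "classical_grad (\<lambda>x. 0) x = 0" for x
      by (rule classical_grad_eqI) simp
    then show "(\<lambda>n::nat. Lp_int 2 (\<lambda>x. classical_grad (\<lambda>x. 0) x - 0)) \<longlonglongrightarrow> 0"
      by (simp add: Lp_int_def)
  qed (auto simp: Lp_int_def)
  have "AE x in lebesgue. (norm (weak_grad (\<lambda>x. 0) x))\<^sup>2 + (weak_grad (\<lambda>x. 0) x \<bullet> B x)\<^sup>2 \<le> 1 + (norm (B x))\<^sup>2"
    using D12g_weak_grad[OF D] by eventually_elim simp
  moreover have "(\<lambda>x. 0) \<in> C01" by (auto simp: C01_def lipschitz_on_def)
  ultimately show ?thesis using D12g_imp_D12[OF D] by (simp add: XB_def)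
qed

lemma XB_scale:
  assumes "u \<in> XB B" "\<bar>t\<bar> \<le> 1"
  shows "(\<lambda>x. t * u x) \<in> XB B" "D12g (\<lambda>x. t * u x) (\<lambda>x. t *\<^sub>R weak_grad u x)"
  using XB_lincomb[OF assms(1,1), of t 0] weak_grad_lincomb[OF assms(1,1), of t 0] assms(2) by simp_all

lemma diff_D12g:
  assumes "u \<in> XB B" "v \<in> XB B"
  shows "D12g (\<lambda>x. u x - v x) (\<lambda>x. weak_grad u x - weak_grad v x)"
  using weak_grad_lincomb[OF assms, of 1 "-1"] by simp

lemma XB_subset_span: "u \<in> XB B \<Longrightarrow> u \<in> XB_span B"
  unfolding XB_span_def by (rule CollectI, rule exI[of _ "{u}"], rule exI[of _ "\<lambda>_. 1"]) auto

section \<open>The functional \<rho> and coercivity\<close>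

lemma \<rho>_add: "u \<in> XB_span B \<Longrightarrow> v \<in> XB_span B \<Longrightarrow> \<rho> (\<lambda>x. u x + v x) = \<rho> u + \<rho> v"
  using \<rho> by (simp add: XB_dual_def)

lemma \<rho>_scale: "u \<in> XB_span B \<Longrightarrow> \<rho> (\<lambda>x. c * u x) = c * \<rho> u"
  using \<rho> by (simp add: XB_dual_def)

lemma \<rho>_continuous: "u \<in> XB B \<Longrightarrow> e > 0 \<Longrightarrow> \<exists>d>0. \<forall>v\<in>XB B. D12_norm (\<lambda>x. v x - u x) < d \<longrightarrow> \<bar>\<rho> v - \<rho> u\<bar> < e"
  using \<rho> by (simp add: XB_dual_def)

lemma \<rho>_zero: "\<rho> (\<lambda>x. 0) = 0"
  using \<rho>_scale[OF XB_subset_span[OF XB_zero], of 0] by simp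

text \<open>Continuity at 0 bounds \<rho> by 1 on the elements of norm below some \<open>d\<close>.
  Larger elements are shrunk to norm d/2, which stays inside \<open>XB B\<close>; small ones cannot
  be enlarged within it, hence the additive 1.\<close>

lemma \<rho>_bound:
  obtains C where "C \<ge> 0" "\<And>u. u \<in> XB B \<Longrightarrow> \<bar>\<rho> u\<bar> \<le> C * D12_norm u + 1"
proof -
  obtain d where d: "d > 0" "\<And>v. v \<in> XB B \<Longrightarrow> D12_norm v < d \<Longrightarrow> \<bar>\<rho> v\<bar> < 1"
    using \<rho>_continuous[OF XB_zero, of 1] by (auto simp: \<rho>_zero)
  have "\<bar>\<rho> u\<bar> \<le> (2 / d) * D12_norm u + 1" if u: "u \<in> XB B" for u
  proof (cases "D12_norm u < d")
    case True
    then have "\<bar>\<rho> u\<bar> < 1" using d(2)[OF u] by simp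
    moreover have "0 \<le> (2 / d) * D12_norm u" using d(1) D12_norm_nonneg by simp
    ultimately show ?thesis by simp
  next
    case False
    define N where "N = D12_norm u"
    have N: "N \<ge> d" "N > 0" using False d(1) by (auto simp: N_def)
    define t where "t = d / (2 * N)"
    have t: "t > 0" "\<bar>t\<bar> \<le> 1" using N d(1) by (auto simp: t_def field_simps)
    have "(D12_norm (\<lambda>x. t * u x))\<^sup>2 = (t * N)\<^sup>2"
      using D12_norm_power2(2)[OF XB_scale(2)[OF u t(2)]] D12_norm_power2(2)[OF XB_D12g[OF u]]
      by (simp add: power_mult_distrib N_def)
    then have "D12_norm (\<lambda>x. t * u x) = t * N"
      using t N D12_norm_nonneg by (subst (asm) power2_eq_iff_nonneg) auto
    also have "\<dots> < d" using N d(1) by (simp add: t_def)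
    finally have "\<bar>\<rho> (\<lambda>x. t * u x)\<bar> < 1" using d(2)[OF XB_scale(1)[OF u t(2)]] by simp
    then have "t * \<bar>\<rho> u\<bar> < 1" using \<rho>_scale[OF XB_subset_span[OF u], of t] t by (simp add: abs_mult)
    then have "\<bar>\<rho> u\<bar> \<le> 2 / d * N" using N d(1) by (simp add: t_def field_simps)
    then show ?thesis by (simp add: N_def)
  qed
  then show ?thesis using d(1) by (intro that[of "2 / d"]) auto
qed

definition b :: real where "b = (\<integral>x. (norm (B x))\<^sup>2 \<partial>lebesgue)"

lemma F_lower:
  assumes "u \<in> XB B"
  shows "q / 2 * ((D12_norm u)\<^sup>2 - b) \<le> F u"
proof -
  note i = D12_norm_power2[OF XB_D12g[OF assms]]
  have "q / 2 * ((D12_norm u)\<^sup>2 - b) = (\<integral>x. q / 2 * ((norm (weak_grad u x))\<^sup>2 - (norm (B x))\<^sup>2) \<partial>lebesgue)"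
    unfolding i(2) b_def using i(1) B_integrable by simp
  also have "\<dots> \<le> F u"
    unfolding F_def
  proof (rule integral_mono_AE)
    show "AE x in lebesgue. q / 2 * ((norm (weak_grad u x))\<^sup>2 - (norm (B x))\<^sup>2) \<le> energy_density (q / 2) (B x) (weak_grad u x)"
      using XB_AE[OF assms]
    proof eventually_elim
      case (elim x)
      have "q / 2 * ((norm (weak_grad u x))\<^sup>2 - (norm (B x))\<^sup>2) \<le> q / 2 * (anis (B x) (weak_grad u x) - (norm (B x))\<^sup>2)"
        using q norm_le_anis[of "weak_grad u x" "B x"] by (intro mult_left_mono) auto
      then show ?case using energy_density_lower[OF elim p] by linarith
    qed
  qed (use i(1) B_integrable density_integrable[OF assms] in auto)
  finally show ?thesis .
qed

lemma I_B_bdd_below: "bdd_below (I_B q B \<rho> ` XB B)"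
proof -
  obtain C where C: "C \<ge> 0" "\<And>u. u \<in> XB B \<Longrightarrow> \<bar>\<rho> u\<bar> \<le> C * D12_norm u + 1"
    using \<rho>_bound by blast
  have "- (C\<^sup>2 / 2) - b / 2 - 1 \<le> I_B q B \<rho> u" if u: "u \<in> XB B" for u
  proof -
    define N where "N = D12_norm u"
    have "(N\<^sup>2 - b) / 2 \<le> F u / q" using F_lower[OF u] q by (simp add: N_def field_simps)
    moreover have "\<rho> u \<le> C * N + 1" using C(2)[OF u] by (simp add: N_def)
    \<comment> \<open>Completing the square absorbs the linear growth of \<rho> into half the
      squared norm.\<close>
    moreover have "0 \<le> (N - C)\<^sup>2" by simp
    then have "- (C\<^sup>2 / 2) \<le> N\<^sup>2 / 2 - C * N" by (simp add: power2_eq_square field_simps)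
    ultimately show ?thesis unfolding I_B_eq diff_divide_distrib by linarith
  qed
  then show ?thesis by (intro bdd_belowI2)
qed

text \<open>The constant of \<open>energy_density_midpoint\<close> with p = q/2: the 4 is the one of
  the parallelogram law, the further q the normalisation 1/q in \<open>I_B\<close>.\<close>

definition \<kappa> :: real where "\<kappa> = q / 2 * (1 + M\<^sup>2) powr (q / 2 - 1) / (4 * q)"

lemma \<kappa>_pos: "\<kappa> > 0"
proof -
  have "1 + M\<^sup>2 \<noteq> 0" using zero_le_power2[of M] by linarith
  then show ?thesis using q by (simp add: \<kappa>_def)
qed

lemma I_B_midpoint:
  assumes u: "u \<in> XB B" and v: "v \<in> XB B"
  shows "I_B q B \<rho> (\<lambda>x. (1/2) * u x + (1/2) * v x) \<le>
    (I_B q B \<rho> u + I_B q B \<rho> v) / 2 - \<kappa> * (D12_norm (\<lambda>x. u x - v x))\<^sup>2"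
proof -
  define k where "k = q / 2 * (1 + M\<^sup>2) powr (q / 2 - 1)"
  let ?w = "\<lambda>x. (1/2) * u x + (1/2) * v x"
  let ?e = "\<lambda>u x. energy_density (q / 2) (B x) (weak_grad u x)"
  have w: "?w \<in> XB B" by (rule XB_lincomb[OF u v]) simp
  note N = D12_norm_power2[OF diff_D12g[OF u v]]
  note i = density_integrable[OF u] density_integrable[OF v]
  have "F ?w \<le> (\<integral>x. (?e u x + ?e v x) / 2 - k * ((norm (weak_grad u x - weak_grad v x))\<^sup>2 / 4) \<partial>lebesgue)"
    unfolding F_def
  proof (rule integral_mono_AE)
    show "AE x in lebesgue. ?e ?w x \<le> (?e u x + ?e v x) / 2 - k * ((norm (weak_grad u x - weak_grad v x))\<^sup>2 / 4)"
      using XB_AE[OF u] XB_AE[OF v] AE_B D12g_weak_grad[OF weak_grad_lincomb[OF u v, of "1/2" "1/2"]]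
    proof eventually_elim
      case (elim x)
      show ?case unfolding elim(4) k_def by (rule energy_density_midpoint[OF elim(1,2) p elim(3)])
    qed
  qed (use i N(1) density_integrable[OF w] in auto)
  also have "\<dots> = (F u + F v) / 2 - k * ((D12_norm (\<lambda>x. u x - v x))\<^sup>2 / 4)"
    unfolding F_def N(2) using i N(1) by simp
  finally have "F ?w / q \<le> ((F u + F v) / 2 - k * ((D12_norm (\<lambda>x. u x - v x))\<^sup>2 / 4)) / q"
    using q by (intro divide_right_mono) auto
  also have "\<dots> = (F u / q + F v / q) / 2 - \<kappa> * (D12_norm (\<lambda>x. u x - v x))\<^sup>2"
  proof -
    have "\<kappa> = k / (4 * q)" by (simp only: \<kappa>_def k_def)
    then show ?thesis using q by (simp add: field_simps)
  qed
  finally have "F ?w / q \<le> (F u / q + F v / q) / 2 - \<kappa> * (D12_norm (\<lambda>x. u x - v x))\<^sup>2" .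
  moreover have "\<rho> ?w = (\<rho> u + \<rho> v) / 2"
  proof -
    have "\<rho> ?w = \<rho> (\<lambda>x. (1/2) * u x) + \<rho> (\<lambda>x. (1/2) * v x)"
      by (rule \<rho>_add; rule XB_subset_span; rule XB_scale) (use u v in auto)
    also have "\<dots> = (1/2) * \<rho> u + (1/2) * \<rho> v"
      using \<rho>_scale[OF XB_subset_span[OF u], of "1/2"] \<rho>_scale[OF XB_subset_span[OF v], of "1/2"] by (simp only:)
    finally show ?thesis by simp
  qed
  ultimately show ?thesis unfolding I_B_eq by (simp add: field_simps)
qed

definition m :: real where "m = (INF u\<in>XB B. I_B q B \<rho> u)"

lemma m_le: "u \<in> XB B \<Longrightarrow> m \<le> I_B q B \<rho> u"
  unfolding m_def by (rule cINF_lower[OF I_B_bdd_below])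

text \<open>The midpoint is admissible, so its value is at least \<open>m\<close>. This one estimate
  gives both uniqueness and the Cauchy property of minimising sequences.\<close>

lemma D12_norm_diff_le:
  assumes "u \<in> XB B" "v \<in> XB B"
  shows "\<kappa> * (D12_norm (\<lambda>x. u x - v x))\<^sup>2 \<le> I_B q B \<rho> u / 2 + I_B q B \<rho> v / 2 - m"
proof -
  have "(\<lambda>x. (1/2) * u x + (1/2) * v x) \<in> XB B" by (rule XB_lincomb[OF assms]) simp
  from m_le[OF this] I_B_midpoint[OF assms] show ?thesis unfolding add_divide_distrib by linarith
qed

text \<open>A vanishing gradient norm gives a vanishing L^6 integral by Sobolev, hence equality
  almost everywhere, hence everywhere by continuity.\<close>

lemma minimiser_unique:
  assumes "u \<in> XB B" "v \<in> XB B" "I_B q B \<rho> u \<le> m" "I_B q B \<rho> v \<le> m"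
  shows "u = v"
proof -
  note D = diff_D12g[OF assms(1,2)]
  have "\<kappa> * (D12_norm (\<lambda>x. u x - v x))\<^sup>2 \<le> 0"
    using D12_norm_diff_le[OF assms(1,2)] assms(3,4) by linarith
  then have "(D12_norm (\<lambda>x. u x - v x))\<^sup>2 = 0"
    using \<kappa>_pos by (simp add: mult_le_0_iff)
  then have "Lp_int 2 (\<lambda>x. weak_grad u x - weak_grad v x) = 0"
    by (simp add: D12_norm_Lp_int[OF D])
  then have "Lp_int 6 (\<lambda>x. u x - v x) = 0" using D12g_Sobolev[OF D] by simp
  then have "AE x in lebesgue. ennreal (norm (u x - v x) ^ 6) = 0"
    unfolding Lp_int_def using D12g_measurable(1)[OF D]
    by (subst (asm) nn_integral_0_iff_AE) auto
  then have "AE x in lebesgue. u x = v x" by eventually_elim (simp add: ennreal_eq_0_iff)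
  then show ?thesis by (rule continuous_AE_eq_imp_eq[OF XB_continuous XB_continuous, OF assms(1,2)])
qed

lemma minimiser_exists: "\<exists>v\<in>XB B. I_B q B \<rho> v \<le> m"
proof -
  have "\<exists>u\<in>XB B. I_B q B \<rho> u < m + 1 / Suc n" for n
  proof -
    have "m < m + 1 / Suc n" by simp
    then show ?thesis
      using cINF_less_iff[OF _ I_B_bdd_below, of "m + 1 / Suc n"] XB_zero unfolding m_def by blast
  qed
  then obtain u where u: "\<And>n. u n \<in> XB B" "\<And>n. I_B q B \<rho> (u n) < m + 1 / Suc n" by metis
  have cau: "L2_Cauchy (\<lambda>n. weak_grad (u n))"
    unfolding L2_Cauchy_def
  proof (intro allI impI)
    fix e :: real assume "e > 0"
    then have "\<kappa> * e > 0" using \<kappa>_pos by simp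
    then obtain N where N: "1 / Suc N < \<kappa> * e" using nat_approx_posE by blast
    have "Lp_int 2 (\<lambda>x. weak_grad (u i) x - weak_grad (u j) x) < ennreal e" if "i \<ge> N" "j \<ge> N" for i j
    proof -
      have "1 / Suc i \<le> 1 / Suc N" "1 / Suc j \<le> 1 / Suc N" using that by (auto intro: frac_le)
      then have "\<kappa> * (D12_norm (\<lambda>x. u i x - u j x))\<^sup>2 < \<kappa> * e"
        using D12_norm_diff_le[OF u(1) u(1), of i j] u(2)[of i] u(2)[of j] N by linarith
      then have "(D12_norm (\<lambda>x. u i x - u j x))\<^sup>2 < e" using \<kappa>_pos by simp
      then show ?thesis
        unfolding D12_norm_Lp_int[OF diff_D12g[OF u(1) u(1)]] using \<open>e > 0\<close> by (rule ennreal_lessI[rotated])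
    qed
    then show "\<exists>N. \<forall>i\<ge>N. \<forall>j\<ge>N. Lp_int 2 (\<lambda>x. weak_grad (u i) x - weak_grad (u j) x) < ennreal e" by blast
  qed
  obtain v s where v: "v \<in> XB B" and s: "strict_mono s"
    and AE: "AE x in lebesgue. (\<lambda>k. weak_grad (u (s k)) x) \<longlonglongrightarrow> weak_grad v x"
    and lim: "(\<lambda>n. D12_norm (\<lambda>x. u n x - v x)) \<longlonglongrightarrow> 0"
    using XB_complete[of u, OF u(1) cau AE_B] .
  have \<rho>_lim: "(\<lambda>n. \<rho> (u n)) \<longlonglongrightarrow> \<rho> v"
  proof (rule LIMSEQ_I)
    fix e :: real assume "e > 0"
    then obtain d where d: "d > 0" "\<forall>w\<in>XB B. D12_norm (\<lambda>x. w x - v x) < d \<longrightarrow> \<bar>\<rho> w - \<rho> v\<bar> < e"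
      using \<rho>_continuous[OF v] by blast
    then show "\<exists>N. \<forall>n\<ge>N. norm (\<rho> (u n) - \<rho> v) < e"
      using LIMSEQ_D[OF lim d(1)] u(1) D12_norm_nonneg by fastforce
  qed
  have I_lim: "(\<lambda>n. I_B q B \<rho> (u n)) \<longlonglongrightarrow> m"
  proof (rule tendsto_sandwich[OF _ _ tendsto_const])
    show "(\<lambda>n. m + 1 / Suc n) \<longlonglongrightarrow> m"
      using tendsto_add[OF tendsto_const LIMSEQ_inverse_real_of_nat, of m] by (simp add: inverse_eq_divide)
    show "\<forall>\<^sub>F n in sequentially. m \<le> I_B q B \<rho> (u n)"
      by (intro always_eventually allI m_le u(1))
    show "\<forall>\<^sub>F n in sequentially. I_B q B \<rho> (u n) \<le> m + 1 / Suc n"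
      by (intro always_eventually allI less_imp_le[OF u(2)])
  qed
  \<comment> \<open>This product is \<open>F (u n)\<close>, so the limit of the nonlinear part is
    known from those of \<open>I_B\<close> and \<rho>.\<close>
  have "(\<lambda>n. q * (I_B q B \<rho> (u n) + \<rho> (u n))) \<longlonglongrightarrow> q * (m + \<rho> v)"
    by (intro tendsto_intros I_lim \<rho>_lim)
  then have "(\<lambda>n. F (u n)) \<longlonglongrightarrow> q * (m + \<rho> v)"
    using q by (simp add: I_B_eq)
  then have F_lim: "(\<lambda>k. F (u (s k)) + q / 2 * b) \<longlonglongrightarrow> q * (m + \<rho> v) + q / 2 * b"
    by (intro tendsto_add tendsto_const LIMSEQ_subseq_LIMSEQ[unfolded o_def, OF _ s])
  \<comment> \<open>The shift by \<open>q / 2 * (norm (B x))\<^sup>2\<close> makes the density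
    nonnegative on the constraint set; it contributes the same finite amount
    \<open>q / 2 * b\<close> to every integral.\<close>
  let ?f = "\<lambda>u x. energy_density (q / 2) (B x) (weak_grad u x) + q / 2 * (norm (B x))\<^sup>2"
  have f_nn: "AE x in lebesgue. ?f w x \<ge> 0" if w: "w \<in> XB B" for w
    using XB_AE[OF w]
  proof eventually_elim
    case (elim x)
    have "0 \<le> q / 2 * anis (B x) (weak_grad w x)" using q anis_nonneg[of "B x" "weak_grad w x"] by simp
    then show ?case using energy_density_lower[OF elim p] by (simp add: right_diff_distrib)
  qed
  have f_int: "integrable lebesgue (?f w)" "(\<integral>x. ?f w x \<partial>lebesgue) = F w + q / 2 * b" if w: "w \<in> XB B" for w
    using density_integrable[OF w] B_integrable by (auto simp: F_def b_def)
  have f_nn_int: "(\<integral>\<^sup>+x. ennreal (?f w x) \<partial>lebesgue) = ennreal (F w + q / 2 * b)" if w: "w \<in> XB B" for w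
    using nn_integral_eq_integral[OF f_int(1)[OF w] f_nn[OF w]] f_int(2)[OF w] by simp
  have f_ge: "F w + q / 2 * b \<ge> 0" if w: "w \<in> XB B" for w
    using integral_nonneg_AE[OF f_nn[OF w]] f_int(2)[OF w] by simp
  have AE_constraint: "AE x in lebesgue. \<forall>k. anis (B x) (weak_grad (u (s k)) x) \<le> 1 + (norm (B x))\<^sup>2"
    unfolding AE_all_countable using XB_AE u(1) by blast
  have "(\<integral>\<^sup>+x. ennreal (?f v x) \<partial>lebesgue) \<le> ennreal (q * (m + \<rho> v) + q / 2 * b)"
  proof (rule nn_integral_Fatou_le)
    show "?f (u (s k)) \<in> borel_measurable lebesgue" for k
      using f_int(1)[OF u(1)] by (rule borel_measurable_integrable)
    show "AE x in lebesgue. (\<lambda>k. ?f (u (s k)) x) \<longlonglongrightarrow> ?f v x"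
      using AE XB_AE[OF v] AE_constraint
    proof eventually_elim
      case (elim x)
      \<comment> \<open>The base may tend to 0, where \<open>powr\<close> is continuous only from
        the nonnegative side and for a positive exponent; the constraint along the whole subsequence
        keeps the base nonnegative.\<close>
      have "(\<lambda>k. (1 + (norm (B x))\<^sup>2 - (norm (weak_grad (u (s k)) x))\<^sup>2 - (weak_grad (u (s k)) x \<bullet> B x)\<^sup>2) powr (q / 2)) \<longlonglongrightarrow>
          (1 + (norm (B x))\<^sup>2 - (norm (weak_grad v x))\<^sup>2 - (weak_grad v x \<bullet> B x)\<^sup>2) powr (q / 2)"
        using p elim(2,3) by (intro tendsto_powr' tendsto_intros elim(1)) (auto simp: anis_def algebra_simps)
      then show ?case unfolding energy_density_def by (intro tendsto_add tendsto_diff tendsto_const)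
    qed
    show "(\<lambda>k. ennreal (F (u (s k)) + q / 2 * b)) \<longlonglongrightarrow> ennreal (q * (m + \<rho> v) + q / 2 * b)"
      by (rule tendsto_ennrealI[OF F_lim])
    show "\<forall>\<^sub>F k in sequentially. (\<integral>\<^sup>+x. ennreal (?f (u (s k)) x) \<partial>lebesgue) \<le> ennreal (F (u (s k)) + q / 2 * b)"
      using f_nn_int[OF u(1)] by simp
  qed
  then have "ennreal (F v + q / 2 * b) \<le> ennreal (q * (m + \<rho> v) + q / 2 * b)"
    unfolding f_nn_int[OF v] .
  \<comment> \<open>\<open>ennreal\<close> cuts negative numbers off at 0, so the comparison of
    reals can be recovered only once the right-hand side is known to be nonnegative.\<close>
  moreover have "q * (m + \<rho> v) + q / 2 * b \<ge> 0"
    by (rule LIMSEQ_le_const[OF F_lim]) (use f_ge[OF u(1)] in auto)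
  ultimately have "F v \<le> q * (m + \<rho> v)" by (simp add: ennreal_le_iff)
  then have "I_B q B \<rho> v \<le> m" using q by (simp add: I_B_eq field_simps)
  then show ?thesis using v by blast
qed

text \<open>Since the infimum is attained, having no strictly better competitor amounts to having a
  value at most \<open>m\<close>.\<close>

lemma is_minimiser_iff: "is_minimiser q B \<rho> u \<longleftrightarrow> u \<in> XB B \<and> I_B q B \<rho> u \<le> m"
proof -
  obtain v where v: "v \<in> XB B" "I_B q B \<rho> v \<le> m" using minimiser_exists by blast
  show ?thesis
    unfolding is_minimiser_def is_arg_min_def
    using v m_le by (metis leD leI order_trans)
qed

lemma ex1_minimiser: "\<exists>!u. is_minimiser q B \<rho> u"
  unfolding is_minimiser_iff using minimiser_exists minimiser_unique by blast

text \<open>Being nonzero is defined on the span, but only elements of \<open>XB B\<close> are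
  competitors. By additivity over finite combinations, vanishing on \<open>XB B\<close> would force
  vanishing on the span.\<close>

lemma \<rho>_nonzero_on_XB:
  assumes "XB_dual_nonzero B \<rho>"
  obtains u where "u \<in> XB B" "\<rho> u \<noteq> 0"
proof (rule ccontr)
  assume "\<not> thesis"
  then have zero: "\<rho> u = 0" if "u \<in> XB B" for u using that \<open>\<And>u. u \<in> XB B \<Longrightarrow> \<rho> u \<noteq> 0 \<Longrightarrow> thesis\<close> by blast
  have "\<rho> (\<lambda>x. \<Sum>v\<in>S. c v * v x) = 0" if "finite S" "S \<subseteq> XB B" for S c
    using that
  proof (induction S rule: finite_induct)
    case empty
    then show ?case by (simp add: \<rho>_zero)
  next
    case (insert v S)
    have "(\<lambda>x. c v * v x) \<in> XB_span B"
      unfolding XB_span_def using insert.prems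
      by (intro CollectI exI[of _ "{v}"] exI[of _ c]) auto
    moreover have "(\<lambda>x. \<Sum>v\<in>S. c v * v x) \<in> XB_span B"
      unfolding XB_span_def using insert by blast
    ultimately have "\<rho> (\<lambda>x. c v * v x + (\<Sum>v\<in>S. c v * v x)) = \<rho> (\<lambda>x. c v * v x) + \<rho> (\<lambda>x. \<Sum>v\<in>S. c v * v x)"
      by (rule \<rho>_add)
    also have "\<rho> (\<lambda>x. c v * v x) = c v * \<rho> v"
      using insert.prems by (intro \<rho>_scale XB_subset_span) auto
    finally show ?case using insert zero[of v] by simp
  qed
  then show False using assms unfolding XB_dual_nonzero_def XB_span_def by blast
qed

lemma zero_not_minimiser:
  assumes "XB_dual_nonzero B \<rho>"
  shows "\<not> is_minimiser q B \<rho> (\<lambda>x. 0)"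
proof
  assume "is_minimiser q B \<rho> (\<lambda>x. 0)"
  then have min0: "I_B q B \<rho> (\<lambda>x. 0) \<le> m" by (simp add: is_minimiser_iff)
  obtain u where u: "u \<in> XB B" "\<rho> u \<noteq> 0" using \<rho>_nonzero_on_XB[OF assms] by blast
  define A where "A = (\<integral>x. anis (B x) (weak_grad u x) \<partial>lebesgue)"
  have A: "A \<ge> 0" unfolding A_def by (intro Bochner_Integration.integral_nonneg anis_nonneg)
  \<comment> \<open>The zero function is taken as 0 times \<open>u\<close>, whose gradient is
    known.\<close>
  have zero: "AE x in lebesgue. weak_grad (\<lambda>x. 0) x = 0"
    using D12g_weak_grad[OF XB_scale(2)[OF u(1), of 0]] by simp
  have key: "t * \<rho> u \<le> t\<^sup>2 * A" if t: "\<bar>t\<bar> \<le> 1" for t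
  proof -
    have tu: "(\<lambda>x. t * u x) \<in> XB B" by (rule XB_scale[OF u(1) t])
    have "F (\<lambda>x. t * u x) \<le> (\<integral>x. energy_density (q / 2) (B x) (weak_grad (\<lambda>x. 0) x) + t\<^sup>2 * anis (B x) (weak_grad u x) \<partial>lebesgue)"
      unfolding F_def
    proof (rule integral_mono_AE)
      show "AE x in lebesgue. energy_density (q / 2) (B x) (weak_grad (\<lambda>x. t * u x) x) \<le>
          energy_density (q / 2) (B x) (weak_grad (\<lambda>x. 0) x) + t\<^sup>2 * anis (B x) (weak_grad u x)"
        using zero D12g_weak_grad[OF XB_scale(2)[OF u(1) t]] XB_AE[OF u(1)]
      proof eventually_elim
        case (elim x)
        show ?case unfolding elim(1,2) by (rule energy_density_scaled[OF elim(3) p t])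
      qed
    qed (use density_integrable[OF tu] density_integrable[OF XB_zero] anis_integrable[OF u(1)] in auto)
    also have "\<dots> = F (\<lambda>x. 0) + t\<^sup>2 * A"
      unfolding F_def A_def using density_integrable[OF XB_zero] anis_integrable[OF u(1)] by simp
    finally have "F (\<lambda>x. t * u x) / q \<le> F (\<lambda>x. 0) / q + t\<^sup>2 * A / q"
      using q by (simp add: divide_right_mono flip: add_divide_distrib)
    \<comment> \<open>Here \<open>q \<ge> 1\<close> enters.\<close>
    moreover have "t\<^sup>2 * A / q \<le> t\<^sup>2 * A" using q A mult_left_mono[of 1 q "t\<^sup>2 * A"] by (simp add: field_simps)
    moreover have "I_B q B \<rho> (\<lambda>x. 0) \<le> I_B q B \<rho> (\<lambda>x. t * u x)" using min0 m_le[OF tu] by linarith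
    moreover have "\<rho> (\<lambda>x. t * u x) = t * \<rho> u" by (rule \<rho>_scale[OF XB_subset_span[OF u(1)]])
    ultimately show ?thesis unfolding I_B_eq \<rho>_zero by linarith
  qed
  define r where "r = \<bar>\<rho> u\<bar>"
  have r: "r > 0" using u(2) by (simp add: r_def)
  \<comment> \<open>The cap at 1 keeps the competitor in \<open>XB B\<close>; the other entry makes
    \<open>\<epsilon> * A\<close> smaller than \<open>r\<close>. The competitor is \<open>u\<close>
    scaled by \<open>\<epsilon> * sgn (\<rho> u)\<close>, so that the linear term has the favourable
    sign.\<close>
  define \<epsilon> where "\<epsilon> = min 1 (r / (2 * (A + 1)))"
  have \<epsilon>: "\<epsilon> > 0" "\<epsilon> \<le> 1" using r A by (auto simp: \<epsilon>_def)
  have "\<epsilon> * r \<le> \<epsilon>\<^sup>2 * A"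
    using key[of "\<epsilon> * sgn (\<rho> u)"] \<epsilon> u(2)
    by (simp add: abs_mult power_mult_distrib mult.assoc r_def flip: abs_sgn) (simp add: sgn_if split: if_splits)
  then have "r \<le> \<epsilon> * A" using \<epsilon>(1) by (simp add: power2_eq_square mult.assoc)
  also have "\<dots> \<le> r / (2 * (A + 1)) * A" using A by (intro mult_right_mono) (auto simp: \<epsilon>_def)
  also have "\<dots> < r" using r A by (simp add: field_simps add_nonneg_pos)
  finally show False by simp
qed

end

theorem theorem2p5:
  fixes q :: real
    and B :: "real^3 \<Rightarrow> real^3"
    and \<rho> :: "(real^3 \<Rightarrow> real) \<Rightarrow> real"
  assumes "1 \<le> q" and "q < 2"
    and "B \<in> L2 \<inter> Linf"
    and "\<rho> \<in> XB_dual B"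
  shows "(\<exists>!\<phi>. is_minimiser q B \<rho> \<phi>) \<and>
         (XB_dual_nonzero B \<rho> \<longrightarrow> (\<forall>\<phi>. is_minimiser q B \<rho> \<phi> \<longrightarrow> \<phi> \<noteq> (\<lambda>x. 0)))"
proof -
  interpret born_infeld q B \<rho> by unfold_locales (use assms in auto)
  show ?thesis using ex1_minimiser zero_not_minimiser by blast
qed


end
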